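(* Let $\mathcal{C}$ be a cluster category with cluster-tilting subcategories $\mathcal{T},\mathcal{U}$. The sets $\mathbf{g}^+_{\mathcal{T}}(\mathcal{U})=\{\operatorname{ind}_{\mathcal{U}}^{\mathcal{T}}[U]:U\in\operatorname{indec}\mathcal{U}\}$ and $\mathbf{g}^-_{\mathcal{T}}(\mathcal{U})=\{\operatorname{coind}_{\mathcal{U}}^{\mathcal{T}}[U]:U\in\operatorname{indec}\mathcal{U}\}$ are sign-coherent. That is, for each $T\in\operatorname{indec}\mathcal{T}$ and any $U,V\in\operatorname{indec}\mathcal{U}$, we have $$\langle[S^{\mathcal{T}}_T],\operatorname{ind}_{\mathcal{U}}^{\mathcal{T}}[U]\rangle_{\mathcal{T}}\geq 0\iff\langle[S^{\mathcal{T}}_T],\operatorname{ind}_{\mathcal{U}}^{\mathcal{T}}[V]\rangle_{\mathcal{T}}\geq 0,$$ $$\langle[S^{\mathcal{T}}_T],\operatorname{coind}_{\mathcal{U}}^{\mathcal{T}}[U]\rangle_{\mathcal{T}}\geq 0\iff\langle[S^{\mathcal{T}}_T],\operatorname{coind}_{\mathcal{U}}^{\mathcal{T}}[V]\rangle_{\mathcal{T}}\geq 0.$$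
   Context: $\mathbb{K}$ is a perfect field; categories are additive and $\mathbb{K}$-linear; $\operatorname{indec}\mathcal{A}$ is a set of representatives of the isomorphism classes of indecomposable objects of $\mathcal{A}$. Cluster categories. Extriangulated categories are those of Nakaoka--Palu: they carry a bifunctor $\operatorname{Ext}^1$, and each element of $\operatorname{Ext}^1_{\mathcal{C}}(X,Y)$ is realised by a conflation $Y\to E\to X$ (an inflation followed by a deflation). Exact categories, and triangulated categories with $\operatorname{Ext}^1(X,Y)=\operatorname{Hom}(X,\Sigma Y)$, are examples. An object $P$ is projective if $\operatorname{Ext}^1(P,-)=0$ and injective if $\operatorname{Ext}^1(-,P)=0$; $\mathcal{C}$ is Frobenius if it has enough projectives and enough injectives and these coincide. For a full additively closed subcategory $\mathcal{P}$ of projective-injectives, the additive quotient $\mathcal{C}/\mathcal{P}$ is extriangulated with $\operatorname{Ext}^1_{\mathcal{C}/\mathcal{P}}=\operatorname{Ext}^1_{\mathcal{C}}$ and conflations the images of those of $\mathcal{C}$; $\mathcal{C}$ is algebraic if it is equivalent, as an extriangulated category, to such a quotient $\mathcal{E}/\mathcal{P}$ of an exact category $\mathcal{E}$. If $\mathcal{C}$ is Frobenius, $\underline{\mathcal{C}}$ denotes its quotient by all projectives, which is triangulated with suspension $\Sigma$. A right $\mathcal{T}$-approximation of $X$ is a map $T_0\to X$ with $T_0\in\mathcal{T}$ through which every map from an object of $\mathcal{T}$ to $X$ factors; left approximations are dual. A full subcategory $\mathcal{T}\subseteq\mathcal{C}$ is cluster-tilting if $\mathcal{T}=\{X:\operatorname{Ext}^1(T,X)=0\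 \forall T\in\mathcal{T}\}=\{X:\operatorname{Ext}^1(X,T)=0\ \forall T\in\mathcal{T}\}$ and every object of $\mathcal{C}$ has a left $\mathcal{T}$-approximation which is an inflation and a right $\mathcal{T}$-approximation which is a deflation. A cluster category is an idempotent complete algebraic Frobenius extriangulated category $\mathcal{C}$ having a cluster-tilting subcategory and such that $\underline{\mathcal{C}}$ is Hom-finite and $2$-Calabi--Yau (functorially $\operatorname{Hom}(X,Y)\cong\operatorname{Hom}_{\mathbb{K}}(\operatorname{Hom}(Y,\Sigma^2X),\mathbb{K})$). Index and coindex. $\mathsf{K}_0(\mathcal{T})$ is the Grothendieck group of $\mathcal{T}$ with its split exact structure. For $X\in\mathcal{C}$ there are conflations $K\to R\to X$ and $X\to L\to C$ with $K,R,L,C\in\mathcal{T}$; put $\operatorname{ind}_{\mathcal{C}}^{\mathcal{T}}[X]=[R]-[K]$ and $\operatorname{coind}_{\mathcal{C}}^{\mathcal{T}}[X]=[L]-[C]$ in $\mathsf{K}_0(\mathcal{T})$ (independent of choices). For another cluster-tilting subcategory $\mathcal{U}$, $\operatorname{ind}_{\mathcal{U}}^{\mathcal{T}},\operatorname{coind}_{\mathcal{U}}^{\mathcal{T}}\colon\mathsf{K}_0(\mathcal{U})\to\mathsf{K}_0(\mathcal{T})$ are the homomorphisms sending $[U]$ to $\operatorname{ind}_{\mathcal{C}}^{\mathcal{T}}[U]$, $\operatorname{coind}_{\mathcal{C}}^{\mathcal{T}}[U]$ respectively. Modules and pairing. A $\mathcal{T}$-module is a contravariant $\mathbb{K}$-linear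 functor $\mathcal{T}\to\operatorname{Mod}\mathbb{K}$; $\operatorname{lfd}\mathcal{T}$ consists of those with finite-dimensional values. The radical $\operatorname{rad}_{\mathcal{T}}$ is the ideal of morphisms $f\colon X\to Y$ such that $\mathrm{id}_Y-fg$ is invertible for all $g\colon Y\to X$, and for $T\in\operatorname{indec}\mathcal{T}$ we write $S^{\mathcal{T}}_T=\operatorname{Hom}_{\mathcal{T}}(-,T)/\operatorname{rad}_{\mathcal{T}}(-,T)$ for the simple $\mathcal{T}$-module at $T$. The pairing $\langle-,-\rangle_{\mathcal{T}}$ is given on classes of modules $M$ and objects $T'\in\mathcal{T}$ by $\langle[M],[T']\rangle_{\mathcal{T}}=\dim_{\mathbb{K}}M(T')$, extended bilinearly to $\mathsf{K}_0^{\mathrm{num}}(\operatorname{lfd}\mathcal{T})\times\mathsf{K}_0(\mathcal{T})\to\mathbb{Z}$, where $\mathsf{K}_0^{\mathrm{num}}(\operatorname{lfd}\mathcal{T})$ is the quotient of $\mathsf{K}_0(\operatorname{lfd}\mathcal{T})$ by the classes pairing to zero with all of $\mathsf{K}_0(\mathcal{T})$.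
   Formalization: The displayed iff fails when values 0 and −1 occur together (type A1×A1); proved instead: for any U, V both pairings are ≥ 0 or both are ≤ 0. That S_T is simple with finite-dimensional values, as the notation presupposes, is assumed explicitly. *)

theory Defs
  imports
    "HOL-Algebra.Free_Abelian_Groups"
    "HOL-Algebra.Generated_Groups"
    "HOL-Algebra.AbelCoset"
    "HOL-Computational_Algebra.Primes"
    "Jordan_Normal_Form.Missing_VectorSpace"
begin

section \<open>Linear algebra\<close>

text \<open>In characteristic zero no prime vanishes in the field, so the condition is vacuous; in
  characteristic \<open>p\<close> it says that the Frobenius map is onto.\<close>

definition perfect_field :: "'k ring \<Rightarrow> bool" where
  "perfect_field K \<longleftrightarrow> field K \<and>
    (\<forall>p::nat. Factorial_Ring.prime p \<and> [p] \<cdot>\<^bsub>K\<^esub> \<one>\<^bsub>K\<^esub> = \<zero>\<^bsub>K\<^esub> \<longrightarrow>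
       (\<forall>x\<in>carrier K. \<exists>y\<in>carrier K. y [^]\<^bsub>K\<^esub> p = x))"

text \<open>The multiplication and the unit that a \<^typ>\<open>('k, 'v) module\<close> inherits from the ring
  record play no role for modules; they are filled with \<open>N\<close>.\<close>

definition quot_mod :: "('k, 'v) module \<Rightarrow> 'v set \<Rightarrow> ('k, 'v set) module" where
  "quot_mod V N = \<lparr>carrier = a_rcosets\<^bsub>V\<^esub> N, monoid.mult = (\<lambda>_ _. N), one = N,
     zero = N, add = (<+>\<^bsub>V\<^esub>), smult = (\<lambda>a A. \<Union>v\<in>A. N +>\<^bsub>V\<^esub> (a \<odot>\<^bsub>V\<^esub> v))\<rparr>"

definition dual_space :: "'k ring \<Rightarrow> ('k, 'v) module \<Rightarrow> ('k, 'v \<Rightarrow> 'k) module" where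
  "dual_space K V = (ring.func_space K (carrier V))
     \<lparr>carrier := {f \<in> carrier V \<rightarrow>\<^sub>E carrier K.
        (\<forall>v\<in>carrier V. \<forall>w\<in>carrier V. f (v \<oplus>\<^bsub>V\<^esub> w) = f v \<oplus>\<^bsub>K\<^esub> f w) \<and>
        (\<forall>a\<in>carrier K. \<forall>v\<in>carrier V. f (a \<odot>\<^bsub>V\<^esub> v) = a \<otimes>\<^bsub>K\<^esub> f v)}\<rparr>"

definition linear_iso ::
    "'k ring \<Rightarrow> ('k, 'v) module \<Rightarrow> ('k, 'w) module \<Rightarrow> ('v \<Rightarrow> 'w) \<Rightarrow> bool" where
  "linear_iso K V W f \<longleftrightarrow> f \<in> module_hom K V W \<and> bij_betw f (carrier V) (carrier W)"


section \<open>Additive linear categories\<close>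

text \<open>\<open>cmp C X Y Z g f\<close> is the composite of \<open>f : X \<rightarrow> Y\<close> and \<open>g : Y \<rightarrow> Z\<close>.
  Composition is indexed by the three objects because Hom-spaces are not assumed disjoint.
  Full subcategories are represented by their sets of objects.\<close>

record ('o, 'm, 'k) lincat =
  ob :: "'o set"
  Hom :: "'o \<Rightarrow> 'o \<Rightarrow> ('k, 'm) module"
  cmp :: "'o \<Rightarrow> 'o \<Rightarrow> 'o \<Rightarrow> 'm \<Rightarrow> 'm \<Rightarrow> 'm"
  idn :: "'o \<Rightarrow> 'm"

abbreviation mor :: "('o, 'm, 'k, 'z) lincat_scheme \<Rightarrow> 'o \<Rightarrow> 'o \<Rightarrow> 'm set" where
  "mor C X Y \<equiv> carrier (Hom C X Y)"

definition is_zero :: "('o, 'm, 'k, 'z) lincat_scheme \<Rightarrow> 'o \<Rightarrow> bool" where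
  "is_zero C X \<longleftrightarrow> X \<in> ob C \<and> idn C X = \<zero>\<^bsub>Hom C X X\<^esub>"

definition is_iso :: "('o, 'm, 'k, 'z) lincat_scheme \<Rightarrow> 'o \<Rightarrow> 'o \<Rightarrow> 'm \<Rightarrow> bool" where
  "is_iso C X Y f \<longleftrightarrow> X \<in> ob C \<and> Y \<in> ob C \<and> f \<in> mor C X Y \<and>
     (\<exists>g\<in>mor C Y X. cmp C X Y X g f = idn C X \<and> cmp C Y X Y f g = idn C Y)"

definition isomorphic :: "('o, 'm, 'k, 'z) lincat_scheme \<Rightarrow> 'o \<Rightarrow> 'o \<Rightarrow> bool" where
  "isomorphic C X Y \<longleftrightarrow> (\<exists>f. is_iso C X Y f)"

definition is_biprod ::
    "('o, 'm, 'k, 'z) lincat_scheme \<Rightarrow> 'o \<Rightarrow> 'o \<Rightarrow> 'o \<Rightarrow> 'm \<Rightarrow> 'm \<Rightarrow> 'm \<Rightarrow> 'm \<Rightarrow> bool" where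
  "is_biprod C X Y B i j p q \<longleftrightarrow>
     X \<in> ob C \<and> Y \<in> ob C \<and> B \<in> ob C \<and>
     i \<in> mor C X B \<and> j \<in> mor C Y B \<and> p \<in> mor C B X \<and> q \<in> mor C B Y \<and>
     cmp C X B X p i = idn C X \<and> cmp C Y B Y q j = idn C Y \<and>
     cmp C X B Y q i = \<zero>\<^bsub>Hom C X Y\<^esub> \<and> cmp C Y B X p j = \<zero>\<^bsub>Hom C Y X\<^esub> \<and>
     cmp C B X B i p \<oplus>\<^bsub>Hom C B B\<^esub> cmp C B Y B j q = idn C B"

locale linear_category =
  fixes K :: "'k ring" and C :: "('o, 'm, 'k, 'z) lincat_scheme"
  assumes field_K: "field K"
    and Hom_vs: "\<lbrakk>X \<in> ob C; Y \<in> ob C\<rbrakk> \<Longrightarrow> vectorspace K (Hom C X Y)"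
    and idn_mor: "X \<in> ob C \<Longrightarrow> idn C X \<in> mor C X X"
    and cmp_linear_right: "\<lbrakk>X \<in> ob C; Y \<in> ob C; Z \<in> ob C; g \<in> mor C Y Z\<rbrakk> \<Longrightarrow>
      (\<lambda>f. cmp C X Y Z g f) \<in> module_hom K (Hom C X Y) (Hom C X Z)"
    and cmp_linear_left: "\<lbrakk>X \<in> ob C; Y \<in> ob C; Z \<in> ob C; f \<in> mor C X Y\<rbrakk> \<Longrightarrow>
      (\<lambda>g. cmp C X Y Z g f) \<in> module_hom K (Hom C Y Z) (Hom C X Z)"
    and cmp_assoc: "\<lbrakk>W \<in> ob C; X \<in> ob C; Y \<in> ob C; Z \<in> ob C;
      f \<in> mor C W X; g \<in> mor C X Y; h \<in> mor C Y Z\<rbrakk> \<Longrightarrow>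
      cmp C W X Z (cmp C X Y Z h g) f = cmp C W Y Z h (cmp C W X Y g f)"
    and cmp_idn_left: "\<lbrakk>X \<in> ob C; Y \<in> ob C; f \<in> mor C X Y\<rbrakk> \<Longrightarrow> cmp C X Y Y (idn C Y) f = f"
    and cmp_idn_right: "\<lbrakk>X \<in> ob C; Y \<in> ob C; f \<in> mor C X Y\<rbrakk> \<Longrightarrow> cmp C X X Y f (idn C X) = f"

locale additive_category = linear_category +
  assumes ex_zero: "\<exists>Z. is_zero C Z"
    and ex_biprod: "\<lbrakk>X \<in> ob C; Y \<in> ob C\<rbrakk> \<Longrightarrow> \<exists>B i j p q. is_biprod C X Y B i j p q"

definition idempotent_complete :: "('o, 'm, 'k, 'z) lincat_scheme \<Rightarrow> bool" where
  "idempotent_complete C \<longleftrightarrow>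
     (\<forall>X\<in>ob C. \<forall>e\<in>mor C X X. cmp C X X X e e = e \<longrightarrow>
        (\<exists>Y\<in>ob C. \<exists>r\<in>mor C X Y. \<exists>s\<in>mor C Y X.
           cmp C Y X Y r s = idn C Y \<and> cmp C X Y X s r = e))"

definition hom_finite :: "'k ring \<Rightarrow> ('o, 'm, 'k, 'z) lincat_scheme \<Rightarrow> bool" where
  "hom_finite K C \<longleftrightarrow> (\<forall>X\<in>ob C. \<forall>Y\<in>ob C. vectorspace.fin_dim K (Hom C X Y))"

text \<open>Closed under finite direct sums and direct summands (hence under isomorphism).\<close>

definition additively_closed :: "('o, 'm, 'k, 'z) lincat_scheme \<Rightarrow> 'o set \<Rightarrow> bool" where
  "additively_closed C P \<longleftrightarrow> P \<subseteq> ob C \<and> (\<exists>Z\<in>P. is_zero C Z) \<and>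
     (\<forall>X Y B i j p q. is_biprod C X Y B i j p q \<longrightarrow> (B \<in> P \<longleftrightarrow> X \<in> P \<and> Y \<in> P))"

definition indecomposable_in :: "('o, 'm, 'k, 'z) lincat_scheme \<Rightarrow> 'o set \<Rightarrow> 'o \<Rightarrow> bool" where
  "indecomposable_in C A X \<longleftrightarrow> X \<in> A \<and> \<not> is_zero C X \<and>
     (\<forall>Y\<in>A. \<forall>Z\<in>A. \<forall>i j p q. is_biprod C Y Z X i j p q \<longrightarrow> is_zero C Y \<or> is_zero C Z)"

definition indec_reps :: "('o, 'm, 'k, 'z) lincat_scheme \<Rightarrow> 'o set \<Rightarrow> 'o set \<Rightarrow> bool" where
  "indec_reps C A I \<longleftrightarrow> (\<forall>X\<in>I. indecomposable_in C A X) \<and>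
     (\<forall>X. indecomposable_in C A X \<longrightarrow> (\<exists>!Y. Y \<in> I \<and> isomorphic C X Y))"

definition radical :: "('o, 'm, 'k, 'z) lincat_scheme \<Rightarrow> 'o \<Rightarrow> 'o \<Rightarrow> 'm set" where
  "radical C X Y = {f \<in> mor C X Y.
     \<forall>g\<in>mor C Y X. is_iso C Y Y (idn C Y \<ominus>\<^bsub>Hom C Y Y\<^esub> cmp C Y X Y f g)}"

definition factor_through :: "('o, 'm, 'k, 'z) lincat_scheme \<Rightarrow> 'o set \<Rightarrow> 'o \<Rightarrow> 'o \<Rightarrow> 'm set" where
  "factor_through C P X Y = {f. \<exists>W\<in>P. \<exists>u\<in>mor C X W. \<exists>v\<in>mor C W Y. f = cmp C X W Y v u}"

definition quot_cat ::
    "('o, 'm, 'k, 'z) lincat_scheme \<Rightarrow> 'o set \<Rightarrow> ('o, 'm set, 'k) lincat" where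
  "quot_cat C P = \<lparr>ob = ob C,
     Hom = (\<lambda>X Y. quot_mod (Hom C X Y) (factor_through C P X Y)),
     cmp = (\<lambda>X Y Z B A. \<Union>g\<in>B. \<Union>f\<in>A.
       factor_through C P X Z +>\<^bsub>Hom C X Z\<^esub> cmp C X Y Z g f),
     idn = (\<lambda>X. factor_through C P X X +>\<^bsub>Hom C X X\<^esub> idn C X)\<rparr>"

abbreviation quot_mor ::
    "('o, 'm, 'k, 'z) lincat_scheme \<Rightarrow> 'o set \<Rightarrow> 'o \<Rightarrow> 'o \<Rightarrow> 'm \<Rightarrow> 'm set" where
  "quot_mor C P X Y f \<equiv> factor_through C P X Y +>\<^bsub>Hom C X Y\<^esub> f"


section \<open>Extriangulated categories\<close>

text \<open>\<open>Ext C Z X\<close> is \<open>Ext\<^sup>1(Z, X)\<close>, contravariant in \<open>Z\<close>; \<open>push C Z X Y a \<delta>\<close> is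
  \<open>a\<^sub>* \<delta> \<in> Ext\<^sup>1(Z, Y)\<close> for \<open>a : X \<rightarrow> Y\<close>, and \<open>pull C W Z X c \<delta>\<close> is
  \<open>c\<^sup>* \<delta> \<in> Ext\<^sup>1(W, X)\<close> for \<open>c : W \<rightarrow> Z\<close>.  \<open>rlz C Z X \<delta>\<close> is the equivalence class
  realising \<open>\<delta>\<close>; a triple \<open>(Y, x, y)\<close> in it is the sequence \<open>X \<rightarrow> Y \<rightarrow> Z\<close>.\<close>

record ('o, 'm, 'e, 'k) extricat = "('o, 'm, 'k) lincat" +
  Ext :: "'o \<Rightarrow> 'o \<Rightarrow> ('k, 'e) module"
  push :: "'o \<Rightarrow> 'o \<Rightarrow> 'o \<Rightarrow> 'm \<Rightarrow> 'e \<Rightarrow> 'e"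
  pull :: "'o \<Rightarrow> 'o \<Rightarrow> 'o \<Rightarrow> 'm \<Rightarrow> 'e \<Rightarrow> 'e"
  rlz :: "'o \<Rightarrow> 'o \<Rightarrow> 'e \<Rightarrow> ('o \<times> 'm \<times> 'm) set"

definition seq_equiv :: "('o, 'm, 'k, 'z) lincat_scheme \<Rightarrow> 'o \<Rightarrow> 'o \<Rightarrow>
    ('o \<times> 'm \<times> 'm) \<Rightarrow> ('o \<times> 'm \<times> 'm) \<Rightarrow> bool" where
  "seq_equiv C X Z = (\<lambda>(Y, x, y) (Y', x', y').
     Y \<in> ob C \<and> x \<in> mor C X Y \<and> y \<in> mor C Y Z \<and>
     Y' \<in> ob C \<and> x' \<in> mor C X Y' \<and> y' \<in> mor C Y' Z \<and>
     (\<exists>b. is_iso C Y Y' b \<and> cmp C X Y Y' b x = x' \<and> cmp C Y Y' Z y' b = y))"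

locale extriangulated_category = additive_category K C
  for K :: "'k ring" and C :: "('o, 'm, 'e, 'k, 'z) extricat_scheme" +
  assumes Ext_vs: "\<lbrakk>Z \<in> ob C; X \<in> ob C\<rbrakk> \<Longrightarrow> vectorspace K (Ext C Z X)"
    and push_linear: "\<lbrakk>Z \<in> ob C; X \<in> ob C; Y \<in> ob C; a \<in> mor C X Y\<rbrakk> \<Longrightarrow>
      (\<lambda>\<delta>. push C Z X Y a \<delta>) \<in> module_hom K (Ext C Z X) (Ext C Z Y)"
    and push_linear_mor: "\<lbrakk>Z \<in> ob C; X \<in> ob C; Y \<in> ob C; \<delta> \<in> carrier (Ext C Z X)\<rbrakk> \<Longrightarrow>
      (\<lambda>a. push C Z X Y a \<delta>) \<in> module_hom K (Hom C X Y) (Ext C Z Y)"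
    and pull_linear: "\<lbrakk>W \<in> ob C; Z \<in> ob C; X \<in> ob C; c \<in> mor C W Z\<rbrakk> \<Longrightarrow>
      (\<lambda>\<delta>. pull C W Z X c \<delta>) \<in> module_hom K (Ext C Z X) (Ext C W X)"
    and pull_linear_mor: "\<lbrakk>W \<in> ob C; Z \<in> ob C; X \<in> ob C; \<delta> \<in> carrier (Ext C Z X)\<rbrakk> \<Longrightarrow>
      (\<lambda>c. pull C W Z X c \<delta>) \<in> module_hom K (Hom C W Z) (Ext C W X)"
    and push_idn: "\<lbrakk>Z \<in> ob C; X \<in> ob C; \<delta> \<in> carrier (Ext C Z X)\<rbrakk> \<Longrightarrow>
      push C Z X X (idn C X) \<delta> = \<delta>"
    and pull_idn: "\<lbrakk>Z \<in> ob C; X \<in> ob C; \<delta> \<in> carrier (Ext C Z X)\<rbrakk> \<Longrightarrow>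
      pull C Z Z X (idn C Z) \<delta> = \<delta>"
    and push_cmp: "\<lbrakk>Z \<in> ob C; X \<in> ob C; Y \<in> ob C; Y' \<in> ob C; a \<in> mor C X Y; a' \<in> mor C Y Y';
      \<delta> \<in> carrier (Ext C Z X)\<rbrakk> \<Longrightarrow>
      push C Z X Y' (cmp C X Y Y' a' a) \<delta> = push C Z Y Y' a' (push C Z X Y a \<delta>)"
    and pull_cmp: "\<lbrakk>W' \<in> ob C; W \<in> ob C; Z \<in> ob C; X \<in> ob C; c' \<in> mor C W' W; c \<in> mor C W Z;
      \<delta> \<in> carrier (Ext C Z X)\<rbrakk> \<Longrightarrow>
      pull C W' Z X (cmp C W' W Z c c') \<delta> = pull C W' W X c' (pull C W Z X c \<delta>)"
    and push_pull: "\<lbrakk>W \<in> ob C; Z \<in> ob C; X \<in> ob C; Y \<in> ob C; c \<in> mor C W Z; a \<in> mor C X Y;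
      \<delta> \<in> carrier (Ext C Z X)\<rbrakk> \<Longrightarrow>
      push C W X Y a (pull C W Z X c \<delta>) = pull C W Z Y c (push C Z X Y a \<delta>)"
    and rlz_nonempty: "\<lbrakk>Z \<in> ob C; X \<in> ob C; \<delta> \<in> carrier (Ext C Z X)\<rbrakk> \<Longrightarrow> rlz C Z X \<delta> \<noteq> {}"
    and rlz_typed: "\<lbrakk>Z \<in> ob C; X \<in> ob C; \<delta> \<in> carrier (Ext C Z X); (Y, x, y) \<in> rlz C Z X \<delta>\<rbrakk> \<Longrightarrow>
      Y \<in> ob C \<and> x \<in> mor C X Y \<and> y \<in> mor C Y Z"
    and rlz_class: "\<lbrakk>Z \<in> ob C; X \<in> ob C; \<delta> \<in> carrier (Ext C Z X); s \<in> rlz C Z X \<delta>\<rbrakk> \<Longrightarrow>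
      s' \<in> rlz C Z X \<delta> \<longleftrightarrow> seq_equiv C X Z s s'"
    and rlz_mor: "\<lbrakk>Z \<in> ob C; X \<in> ob C; Z' \<in> ob C; X' \<in> ob C;
      \<delta> \<in> carrier (Ext C Z X); \<delta>' \<in> carrier (Ext C Z' X');
      (Y, x, y) \<in> rlz C Z X \<delta>; (Y', x', y') \<in> rlz C Z' X' \<delta>';
      a \<in> mor C X X'; c \<in> mor C Z Z'; push C Z X X' a \<delta> = pull C Z Z' X' c \<delta>'\<rbrakk> \<Longrightarrow>
      \<exists>b\<in>mor C Y Y'. cmp C X Y Y' b x = cmp C X X' Y' x' a \<and>
        cmp C Y Y' Z' y' b = cmp C Y Z Z' c y"
    and rlz_zero: "is_biprod C X Z B i j p q \<Longrightarrow> (B, i, q) \<in> rlz C Z X \<zero>\<^bsub>Ext C Z X\<^esub>"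
    and rlz_sum: "\<lbrakk>\<delta> \<in> carrier (Ext C Z X); \<delta>' \<in> carrier (Ext C Z' X');
      (Y, x, y) \<in> rlz C Z X \<delta>; (Y', x', y') \<in> rlz C Z' X' \<delta>';
      is_biprod C X X' BX iX jX pX qX; is_biprod C Y Y' BY iY jY pY qY;
      is_biprod C Z Z' BZ iZ jZ pZ qZ\<rbrakk> \<Longrightarrow>
      (BY,
       cmp C BX X BY (cmp C X Y BY iY x) pX \<oplus>\<^bsub>Hom C BX BY\<^esub>
         cmp C BX X' BY (cmp C X' Y' BY jY x') qX,
       cmp C BY Y BZ (cmp C Y Z BZ iZ y) pY \<oplus>\<^bsub>Hom C BY BZ\<^esub>
         cmp C BY Y' BZ (cmp C Y' Z' BZ jZ y') qY)
      \<in> rlz C BZ BX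
          (push C BZ X BX iX (pull C BZ Z X pZ \<delta>) \<oplus>\<^bsub>Ext C BZ BX\<^esub>
           push C BZ X' BX jX (pull C BZ Z' X' qZ \<delta>'))"
    and ET3: "\<lbrakk>Z \<in> ob C; X \<in> ob C; Z' \<in> ob C; X' \<in> ob C;
      \<delta> \<in> carrier (Ext C Z X); \<delta>' \<in> carrier (Ext C Z' X');
      (Y, x, y) \<in> rlz C Z X \<delta>; (Y', x', y') \<in> rlz C Z' X' \<delta>';
      a \<in> mor C X X'; b \<in> mor C Y Y'; cmp C X Y Y' b x = cmp C X X' Y' x' a\<rbrakk> \<Longrightarrow>
      \<exists>c\<in>mor C Z Z'. cmp C Y Z Z' c y = cmp C Y Y' Z' y' b \<and>
        push C Z X X' a \<delta> = pull C Z Z' X' c \<delta>'"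
    and ET3_op: "\<lbrakk>Z \<in> ob C; X \<in> ob C; Z' \<in> ob C; X' \<in> ob C;
      \<delta> \<in> carrier (Ext C Z X); \<delta>' \<in> carrier (Ext C Z' X');
      (Y, x, y) \<in> rlz C Z X \<delta>; (Y', x', y') \<in> rlz C Z' X' \<delta>';
      b \<in> mor C Y Y'; c \<in> mor C Z Z'; cmp C Y Z Z' c y = cmp C Y Y' Z' y' b\<rbrakk> \<Longrightarrow>
      \<exists>a\<in>mor C X X'. cmp C X Y Y' b x = cmp C X X' Y' x' a \<and>
        push C Z X X' a \<delta> = pull C Z Z' X' c \<delta>'"
    and ET4: "\<lbrakk>A \<in> ob C; B \<in> ob C; D \<in> ob C; F \<in> ob C;
      \<delta> \<in> carrier (Ext C D A); (B, f, f') \<in> rlz C D A \<delta>;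
      \<delta>' \<in> carrier (Ext C F B); (G, g, g') \<in> rlz C F B \<delta>'\<rbrakk> \<Longrightarrow>
      \<exists>E\<in>ob C. \<exists>h'\<in>mor C G E. \<exists>d\<in>mor C D E. \<exists>e\<in>mor C E F. \<exists>\<delta>''\<in>carrier (Ext C E A).
        (G, cmp C A B G g f, h') \<in> rlz C E A \<delta>'' \<and>
        cmp C B G E h' g = cmp C B D E d f' \<and>
        cmp C G E F e h' = g' \<and>
        (E, d, e) \<in> rlz C F D (push C F B D f' \<delta>') \<and>
        pull C D E A d \<delta>'' = \<delta> \<and>
        push C E A B f \<delta>'' = pull C E F B e \<delta>'"
    and ET4_op: "\<lbrakk>B \<in> ob C; D \<in> ob C; F \<in> ob C; G \<in> ob C;
      \<delta> \<in> carrier (Ext C B D); (A, f', f) \<in> rlz C B D \<delta>;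
      \<delta>' \<in> carrier (Ext C G F); (B, g', g) \<in> rlz C G F \<delta>'\<rbrakk> \<Longrightarrow>
      \<exists>E\<in>ob C. \<exists>h'\<in>mor C E A. \<exists>d\<in>mor C D E. \<exists>e\<in>mor C E F. \<exists>\<delta>''\<in>carrier (Ext C G E).
        (A, h', cmp C A B G g f) \<in> rlz C G E \<delta>'' \<and>
        cmp C D E A h' d = f' \<and>
        cmp C E A B f h' = cmp C E F B g' e \<and>
        (E, d, e) \<in> rlz C F D (pull C F B D g' \<delta>) \<and>
        \<delta>' = push C G E F e \<delta>'' \<and>
        push C B D E d \<delta> = pull C B G E g \<delta>''"

definition conflation ::
    "('o, 'm, 'e, 'k, 'z) extricat_scheme \<Rightarrow> 'o \<Rightarrow> 'o \<Rightarrow> 'o \<Rightarrow> 'm \<Rightarrow> 'm \<Rightarrow> bool" where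
  "conflation C X Y Z x y \<longleftrightarrow> X \<in> ob C \<and> Z \<in> ob C \<and>
     (\<exists>\<delta>\<in>carrier (Ext C Z X). (Y, x, y) \<in> rlz C Z X \<delta>)"

definition inflation :: "('o, 'm, 'e, 'k, 'z) extricat_scheme \<Rightarrow> 'o \<Rightarrow> 'o \<Rightarrow> 'm \<Rightarrow> bool" where
  "inflation C X Y x \<longleftrightarrow> (\<exists>Z y. conflation C X Y Z x y)"

definition deflation :: "('o, 'm, 'e, 'k, 'z) extricat_scheme \<Rightarrow> 'o \<Rightarrow> 'o \<Rightarrow> 'm \<Rightarrow> bool" where
  "deflation C Y Z y \<longleftrightarrow> (\<exists>X x. conflation C X Y Z x y)"

abbreviation Ext_vanishes :: "('o, 'm, 'e, 'k, 'z) extricat_scheme \<Rightarrow> 'o \<Rightarrow> 'o \<Rightarrow> bool" where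
  "Ext_vanishes C Z X \<equiv> carrier (Ext C Z X) = {\<zero>\<^bsub>Ext C Z X\<^esub>}"

definition projectives :: "('o, 'm, 'e, 'k, 'z) extricat_scheme \<Rightarrow> 'o set" where
  "projectives C = {P \<in> ob C. \<forall>X\<in>ob C. Ext_vanishes C P X}"

definition injectives :: "('o, 'm, 'e, 'k, 'z) extricat_scheme \<Rightarrow> 'o set" where
  "injectives C = {P \<in> ob C. \<forall>X\<in>ob C. Ext_vanishes C X P}"

definition frobenius :: "('o, 'm, 'e, 'k, 'z) extricat_scheme \<Rightarrow> bool" where
  "frobenius C \<longleftrightarrow> projectives C = injectives C \<and>
     (\<forall>X\<in>ob C. \<exists>P\<in>projectives C. \<exists>y. deflation C P X y) \<and>
     (\<forall>X\<in>ob C. \<exists>I\<in>injectives C. \<exists>x. inflation C X I x)"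

text \<open>For \<open>P\<close> consisting of projective-injectives, \<open>push\<close> and \<open>pull\<close> along a coset do not
  depend on the representative.\<close>

definition extri_quot ::
    "('o, 'm, 'e, 'k, 'z) extricat_scheme \<Rightarrow> 'o set \<Rightarrow> ('o, 'm set, 'e, 'k) extricat" where
  "extri_quot C P = \<lparr>ob = ob (quot_cat C P), Hom = Hom (quot_cat C P),
     cmp = cmp (quot_cat C P), idn = idn (quot_cat C P),
     Ext = Ext C,
     push = (\<lambda>Z X Y A \<delta>. THE \<epsilon>. \<forall>a\<in>A. push C Z X Y a \<delta> = \<epsilon>),
     pull = (\<lambda>W Z X A \<delta>. THE \<epsilon>. \<forall>c\<in>A. pull C W Z X c \<delta> = \<epsilon>),
     rlz = (\<lambda>Z X \<delta>. {s. \<exists>Y x y. (Y, x, y) \<in> rlz C Z X \<delta> \<and>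
       seq_equiv (quot_cat C P) X Z (Y, quot_mor C P X Y x, quot_mor C P Y Z y) s})\<rparr>"

abbreviation stable ::
    "('o, 'm, 'e, 'k, 'z) extricat_scheme \<Rightarrow> ('o, 'm set, 'e, 'k) extricat" where
  "stable C \<equiv> extri_quot C (projectives C)"


section \<open>Exact categories and algebraic extriangulated categories\<close>

definition is_kernel ::
    "('o, 'm, 'k, 'z) lincat_scheme \<Rightarrow> 'o \<Rightarrow> 'o \<Rightarrow> 'o \<Rightarrow> 'm \<Rightarrow> 'm \<Rightarrow> bool" where
  "is_kernel C X Y Z x y \<longleftrightarrow> cmp C X Y Z y x = \<zero>\<^bsub>Hom C X Z\<^esub> \<and>
     (\<forall>W\<in>ob C. \<forall>w\<in>mor C W Y. cmp C W Y Z y w = \<zero>\<^bsub>Hom C W Z\<^esub> \<longrightarrow>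
        (\<exists>!u. u \<in> mor C W X \<and> cmp C W X Y x u = w))"

definition is_cokernel ::
    "('o, 'm, 'k, 'z) lincat_scheme \<Rightarrow> 'o \<Rightarrow> 'o \<Rightarrow> 'o \<Rightarrow> 'm \<Rightarrow> 'm \<Rightarrow> bool" where
  "is_cokernel C X Y Z x y \<longleftrightarrow> cmp C X Y Z y x = \<zero>\<^bsub>Hom C X Z\<^esub> \<and>
     (\<forall>W\<in>ob C. \<forall>w\<in>mor C Y W. cmp C X Y W w x = \<zero>\<^bsub>Hom C X W\<^esub> \<longrightarrow>
        (\<exists>!u. u \<in> mor C Z W \<and> cmp C Y Z W u y = w))"

text \<open>The square has sides \<open>x : X \<rightarrow> Y\<close>, \<open>a : X \<rightarrow> X'\<close>, \<open>a' : Y \<rightarrow> Y'\<close>, \<open>x' : X' \<rightarrow> Y'\<close>.\<close>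

definition commuting_square :: "('o, 'm, 'k, 'z) lincat_scheme \<Rightarrow> 'o \<Rightarrow> 'o \<Rightarrow> 'o \<Rightarrow> 'o \<Rightarrow>
    'm \<Rightarrow> 'm \<Rightarrow> 'm \<Rightarrow> 'm \<Rightarrow> bool" where
  "commuting_square C X Y X' Y' x a a' x' \<longleftrightarrow>
     X \<in> ob C \<and> Y \<in> ob C \<and> X' \<in> ob C \<and> Y' \<in> ob C \<and>
     x \<in> mor C X Y \<and> a \<in> mor C X X' \<and> a' \<in> mor C Y Y' \<and> x' \<in> mor C X' Y' \<and>
     cmp C X Y Y' a' x = cmp C X X' Y' x' a"

definition is_pushout :: "('o, 'm, 'k, 'z) lincat_scheme \<Rightarrow> 'o \<Rightarrow> 'o \<Rightarrow> 'o \<Rightarrow> 'o \<Rightarrow>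
    'm \<Rightarrow> 'm \<Rightarrow> 'm \<Rightarrow> 'm \<Rightarrow> bool" where
  "is_pushout C X Y X' Y' x a a' x' \<longleftrightarrow> commuting_square C X Y X' Y' x a a' x' \<and>
     (\<forall>W v v'. commuting_square C X Y X' W x a v v' \<longrightarrow>
        (\<exists>!u. u \<in> mor C Y' W \<and> cmp C Y Y' W u a' = v \<and> cmp C X' Y' W u x' = v'))"

definition is_pullback :: "('o, 'm, 'k, 'z) lincat_scheme \<Rightarrow> 'o \<Rightarrow> 'o \<Rightarrow> 'o \<Rightarrow> 'o \<Rightarrow>
    'm \<Rightarrow> 'm \<Rightarrow> 'm \<Rightarrow> 'm \<Rightarrow> bool" where
  "is_pullback C X Y X' Y' x a a' x' \<longleftrightarrow> commuting_square C X Y X' Y' x a a' x' \<and>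
     (\<forall>W v v'. commuting_square C W Y X' Y' v v' a' x' \<longrightarrow>
        (\<exists>!u. u \<in> mor C W X \<and> cmp C W X Y x u = v \<and> cmp C W X X' a u = v'))"

text \<open>Quillen's axioms for a class \<open>S\<close> of kernel-cokernel pairs \<open>X \<rightarrow> Y \<rightarrow> Z\<close>.\<close>

locale exact_structure =
  fixes C :: "('o, 'm, 'k, 'z) lincat_scheme"
    and S :: "'o \<Rightarrow> 'o \<Rightarrow> 'o \<Rightarrow> 'm \<Rightarrow> 'm \<Rightarrow> bool"
  assumes kernel_cokernel: "S X Y Z x y \<Longrightarrow>
      X \<in> ob C \<and> Y \<in> ob C \<and> Z \<in> ob C \<and> x \<in> mor C X Y \<and> y \<in> mor C Y Z \<and>
      is_kernel C X Y Z x y \<and> is_cokernel C X Y Z x y"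
    and iso_closed: "\<lbrakk>S X Y Z x y; is_iso C X X' a; is_iso C Y Y' b; is_iso C Z Z' c;
      x' \<in> mor C X' Y'; y' \<in> mor C Y' Z';
      cmp C X Y Y' b x = cmp C X X' Y' x' a; cmp C Y Z Z' c y = cmp C Y Y' Z' y' b\<rbrakk> \<Longrightarrow>
      S X' Y' Z' x' y'"
    and idn_monic: "X \<in> ob C \<Longrightarrow> \<exists>Z y. S X X Z (idn C X) y"
    and idn_epic: "X \<in> ob C \<Longrightarrow> \<exists>W x. S W X X x (idn C X)"
    and cmp_monic: "\<lbrakk>S X Y Z x y; S Y Y' Z' x' y'\<rbrakk> \<Longrightarrow> \<exists>W w. S X Y' W (cmp C X Y Y' x' x) w"
    and cmp_epic: "\<lbrakk>S X Y Z x y; S X' Z Z' x' y'\<rbrakk> \<Longrightarrow> \<exists>W w. S W Y Z' w (cmp C Y Z Z' y' y)"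
    and pushout_monic: "\<lbrakk>S X Y Z x y; X' \<in> ob C; a \<in> mor C X X'\<rbrakk> \<Longrightarrow>
      \<exists>Y' a' x' W w. is_pushout C X Y X' Y' x a a' x' \<and> S X' Y' W x' w"
    and pullback_epic: "\<lbrakk>S X Y Z x y; Z' \<in> ob C; c \<in> mor C Z' Z\<rbrakk> \<Longrightarrow>
      \<exists>Y' c' y' W w. is_pullback C Y' Y Z' Z c' y' y c \<and> S W Y' Z' w y'"

text \<open>An exact category, viewed as an extriangulated category.  When the conflations are
  kernel-cokernel pairs, an element of \<open>Ext Z X\<close> is determined by its realisation, and
  \<open>push\<close>, \<open>pull\<close> and addition are forced to be pushout, pullback and Baer sum, so that
  \<open>Ext\<close> is the Yoneda \<open>Ext\<close> of the exact structure.\<close>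

definition exact_category :: "'k ring \<Rightarrow> ('o, 'm, 'e, 'k, 'z) extricat_scheme \<Rightarrow> bool" where
  "exact_category K E \<longleftrightarrow> extriangulated_category K E \<and> exact_structure E (conflation E)"

locale extri_equivalence =
  fixes K :: "'k ring"
    and A :: "('o, 'm, 'e, 'k, 'z) extricat_scheme"
    and B :: "('p, 'n, 'f, 'k, 'y) extricat_scheme"
    and Fo :: "'o \<Rightarrow> 'p"
    and Fm :: "'o \<Rightarrow> 'o \<Rightarrow> 'm \<Rightarrow> 'n"
    and Fe :: "'o \<Rightarrow> 'o \<Rightarrow> 'e \<Rightarrow> 'f"
  assumes Fo_ob: "X \<in> ob A \<Longrightarrow> Fo X \<in> ob B"
    and Fm_iso: "\<lbrakk>X \<in> ob A; Y \<in> ob A\<rbrakk> \<Longrightarrow>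
      linear_iso K (Hom A X Y) (Hom B (Fo X) (Fo Y)) (Fm X Y)"
    and Fm_idn: "X \<in> ob A \<Longrightarrow> Fm X X (idn A X) = idn B (Fo X)"
    and Fm_cmp: "\<lbrakk>X \<in> ob A; Y \<in> ob A; Z \<in> ob A; f \<in> mor A X Y; g \<in> mor A Y Z\<rbrakk> \<Longrightarrow>
      Fm X Z (cmp A X Y Z g f) = cmp B (Fo X) (Fo Y) (Fo Z) (Fm Y Z g) (Fm X Y f)"
    and ess_surj: "V \<in> ob B \<Longrightarrow> \<exists>X\<in>ob A. isomorphic B (Fo X) V"
    and Fe_iso: "\<lbrakk>Z \<in> ob A; X \<in> ob A\<rbrakk> \<Longrightarrow>
      linear_iso K (Ext A Z X) (Ext B (Fo Z) (Fo X)) (Fe Z X)"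
    and Fe_push: "\<lbrakk>Z \<in> ob A; X \<in> ob A; Y \<in> ob A; a \<in> mor A X Y; \<delta> \<in> carrier (Ext A Z X)\<rbrakk> \<Longrightarrow>
      Fe Z Y (push A Z X Y a \<delta>) = push B (Fo Z) (Fo X) (Fo Y) (Fm X Y a) (Fe Z X \<delta>)"
    and Fe_pull: "\<lbrakk>W \<in> ob A; Z \<in> ob A; X \<in> ob A; c \<in> mor A W Z; \<delta> \<in> carrier (Ext A Z X)\<rbrakk> \<Longrightarrow>
      Fe W X (pull A W Z X c \<delta>) = pull B (Fo W) (Fo Z) (Fo X) (Fm W Z c) (Fe Z X \<delta>)"
    and Fe_rlz: "\<lbrakk>Z \<in> ob A; X \<in> ob A; \<delta> \<in> carrier (Ext A Z X); (Y, x, y) \<in> rlz A Z X \<delta>\<rbrakk> \<Longrightarrow>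
      (Fo Y, Fm X Y x, Fm Y Z y) \<in> rlz B (Fo Z) (Fo X) (Fe Z X \<delta>)"

text \<open>HOL has no quantification over types, so the exact category exhibiting \<open>C\<close> as algebraic
  is carried along as a parameter.\<close>

definition algebraic_via :: "'k ring \<Rightarrow> ('o, 'm, 'e, 'k, 'z) extricat_scheme \<Rightarrow>
    ('p, 'n, 'f, 'k, 'y) extricat_scheme \<Rightarrow> 'p set \<Rightarrow>
    ('p \<Rightarrow> 'o) \<Rightarrow> ('p \<Rightarrow> 'p \<Rightarrow> 'n set \<Rightarrow> 'm) \<Rightarrow> ('p \<Rightarrow> 'p \<Rightarrow> 'f \<Rightarrow> 'e) \<Rightarrow> bool" where
  "algebraic_via K C E P Fo Fm Fe \<longleftrightarrow> exact_category K E \<and>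
     additively_closed E P \<and> P \<subseteq> projectives E \<inter> injectives E \<and>
     extri_equivalence K (extri_quot E P) C Fo Fm Fe"


section \<open>Suspension and the 2-Calabi-Yau property\<close>

text \<open>For triangulated \<open>D\<close>, \<open>S X\<close> is the suspension of \<open>X\<close>, and \<open>d X \<in> Ext (S X) X\<close> is the
  class of a conflation \<open>X \<rightarrow> 0 \<rightarrow> S X\<close>.  In the stable category this is the image of a
  conflation \<open>X \<rightarrow> I \<rightarrow> S X\<close> with \<open>I\<close> injective.  The suspension of \<open>f : X \<rightarrow> Y\<close> is the unique
  \<open>f' : S X \<rightarrow> S Y\<close> for which \<open>f\<^sub>* (d X) = f'\<^sup>* (d Y)\<close>.\<close>

definition is_suspension ::
    "('o, 'm, 'e, 'k, 'z) extricat_scheme \<Rightarrow> ('o \<Rightarrow> 'o) \<Rightarrow> ('o \<Rightarrow> 'e) \<Rightarrow> bool" where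
  "is_suspension D S d \<longleftrightarrow> (\<forall>X\<in>ob D. S X \<in> ob D \<and> d X \<in> carrier (Ext D (S X) X) \<and>
     (\<exists>Z x y. is_zero D Z \<and> (Z, x, y) \<in> rlz D (S X) X (d X)))"

definition susp_mor :: "('o, 'm, 'e, 'k, 'z) extricat_scheme \<Rightarrow> ('o \<Rightarrow> 'o) \<Rightarrow> ('o \<Rightarrow> 'e) \<Rightarrow>
    'o \<Rightarrow> 'o \<Rightarrow> 'm \<Rightarrow> 'm" where
  "susp_mor D S d X Y f = (THE f'. f' \<in> mor D (S X) (S Y) \<and>
     push D (S X) X Y f (d X) = pull D (S X) (S Y) Y f' (d Y))"

definition two_calabi_yau :: "'k ring \<Rightarrow> ('o, 'm, 'e, 'k, 'z) extricat_scheme \<Rightarrow> bool" where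
  "two_calabi_yau K D \<longleftrightarrow> (\<exists>S d \<phi>. is_suspension D S d \<and>
     (\<forall>X\<in>ob D. \<forall>Y\<in>ob D.
        linear_iso K (Hom D X Y) (dual_space K (Hom D Y (S (S X)))) (\<phi> X Y)) \<and>
     (\<forall>X\<in>ob D. \<forall>Y\<in>ob D. \<forall>Y'\<in>ob D. \<forall>f\<in>mor D X Y. \<forall>g\<in>mor D Y Y'. \<forall>h\<in>mor D Y' (S (S X)).
        \<phi> X Y' (cmp D X Y Y' g f) h = \<phi> X Y f (cmp D Y Y' (S (S X)) h g)) \<and>
     (\<forall>X'\<in>ob D. \<forall>X\<in>ob D. \<forall>Y\<in>ob D. \<forall>g\<in>mor D X' X. \<forall>f\<in>mor D X Y. \<forall>h\<in>mor D Y (S (S X')).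
        \<phi> X' Y (cmp D X' X Y f g) h =
        \<phi> X Y f (cmp D Y (S (S X')) (S (S X))
          (susp_mor D S d (S X') (S X) (susp_mor D S d X' X g)) h)))"


section \<open>Cluster categories\<close>

definition left_approx ::
    "('o, 'm, 'k, 'z) lincat_scheme \<Rightarrow> 'o set \<Rightarrow> 'o \<Rightarrow> 'o \<Rightarrow> 'm \<Rightarrow> bool" where
  "left_approx C T X T0 x \<longleftrightarrow> T0 \<in> T \<and> x \<in> mor C X T0 \<and>
     (\<forall>T1\<in>T. \<forall>f\<in>mor C X T1. \<exists>u\<in>mor C T0 T1. f = cmp C X T0 T1 u x)"

definition right_approx ::
    "('o, 'm, 'k, 'z) lincat_scheme \<Rightarrow> 'o set \<Rightarrow> 'o \<Rightarrow> 'o \<Rightarrow> 'm \<Rightarrow> bool" where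
  "right_approx C T T0 X y \<longleftrightarrow> T0 \<in> T \<and> y \<in> mor C T0 X \<and>
     (\<forall>T1\<in>T. \<forall>f\<in>mor C T1 X. \<exists>u\<in>mor C T1 T0. f = cmp C T1 T0 X y u)"

definition cluster_tilting :: "('o, 'm, 'e, 'k, 'z) extricat_scheme \<Rightarrow> 'o set \<Rightarrow> bool" where
  "cluster_tilting C T \<longleftrightarrow>
     T = {X \<in> ob C. \<forall>T1\<in>T. Ext_vanishes C T1 X} \<and>
     T = {X \<in> ob C. \<forall>T1\<in>T. Ext_vanishes C X T1} \<and>
     (\<forall>X\<in>ob C. \<exists>T0 x. left_approx C T X T0 x \<and> inflation C X T0 x) \<and>
     (\<forall>X\<in>ob C. \<exists>T0 y. right_approx C T T0 X y \<and> deflation C T0 X y)"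

locale cluster_category = extriangulated_category K C
  for K :: "'k ring" and C :: "('o, 'm, 'e, 'k, 'z) extricat_scheme"
    and E :: "('p, 'n, 'f, 'k, 'y) extricat_scheme" and P :: "'p set"
    and Fo :: "'p \<Rightarrow> 'o" and Fm :: "'p \<Rightarrow> 'p \<Rightarrow> 'n set \<Rightarrow> 'm" and Fe :: "'p \<Rightarrow> 'p \<Rightarrow> 'f \<Rightarrow> 'e" +
  assumes perfect: "perfect_field K"
    and idempotent_complete: "idempotent_complete C"
    and algebraic: "algebraic_via K C E P Fo Fm Fe"
    and frobenius: "frobenius C"
    and ex_cluster_tilting: "\<exists>T. cluster_tilting C T"
    and stable_hom_finite: "hom_finite K (stable C)"
    and stable_2CY: "two_calabi_yau K (stable C)"


section \<open>Split Grothendieck group, index and coindex\<close>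

text \<open>\<open>free_Abelian_group\<close> and its quotients are multiplicative records: the group operation
  of \<open>K0 C T\<close> is written \<open>\<otimes>\<close> and \<open>inv\<close> is negation.\<close>

definition split_relations :: "('o, 'm, 'k, 'z) lincat_scheme \<Rightarrow> 'o set \<Rightarrow> ('o \<Rightarrow>\<^sub>0 int) set" where
  "split_relations C T = generate (free_Abelian_group T)
     {frag_of B - frag_of X - frag_of Y | X Y B.
        X \<in> T \<and> Y \<in> T \<and> B \<in> T \<and> (\<exists>i j p q. is_biprod C X Y B i j p q)}"

definition K0 :: "('o, 'm, 'k, 'z) lincat_scheme \<Rightarrow> 'o set \<Rightarrow> ('o \<Rightarrow>\<^sub>0 int) set monoid" where
  "K0 C T = free_Abelian_group T Mod split_relations C T"

definition K0_class :: "('o, 'm, 'k, 'z) lincat_scheme \<Rightarrow> 'o set \<Rightarrow> 'o \<Rightarrow> ('o \<Rightarrow>\<^sub>0 int) set" where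
  "K0_class C T X = split_relations C T #>\<^bsub>free_Abelian_group T\<^esub> frag_of X"

definition ind :: "('o, 'm, 'e, 'k, 'z) extricat_scheme \<Rightarrow> 'o set \<Rightarrow> 'o \<Rightarrow> ('o \<Rightarrow>\<^sub>0 int) set" where
  "ind C T X = (THE \<gamma>. \<exists>N\<in>T. \<exists>R\<in>T. \<exists>x y. conflation C N R X x y \<and>
     \<gamma> = K0_class C T R \<otimes>\<^bsub>K0 C T\<^esub> inv\<^bsub>K0 C T\<^esub> K0_class C T N)"

definition coind :: "('o, 'm, 'e, 'k, 'z) extricat_scheme \<Rightarrow> 'o set \<Rightarrow> 'o \<Rightarrow> ('o \<Rightarrow>\<^sub>0 int) set" where
  "coind C T X = (THE \<gamma>. \<exists>L\<in>T. \<exists>M\<in>T. \<exists>x y. conflation C X L M x y \<and>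
     \<gamma> = K0_class C T L \<otimes>\<^bsub>K0 C T\<^esub> inv\<^bsub>K0 C T\<^esub> K0_class C T M)"

text \<open>The homomorphisms on \<open>K0 C U\<close>; the prescribed values determine them on its carrier.\<close>

definition ind_map :: "('o, 'm, 'e, 'k, 'z) extricat_scheme \<Rightarrow> 'o set \<Rightarrow> 'o set \<Rightarrow>
    ('o \<Rightarrow>\<^sub>0 int) set \<Rightarrow> ('o \<Rightarrow>\<^sub>0 int) set" where
  "ind_map C T U = (SOME h. h \<in> hom (K0 C U) (K0 C T) \<and>
     (\<forall>X\<in>U. h (K0_class C U X) = ind C T X))"

definition coind_map :: "('o, 'm, 'e, 'k, 'z) extricat_scheme \<Rightarrow> 'o set \<Rightarrow> 'o set \<Rightarrow>
    ('o \<Rightarrow>\<^sub>0 int) set \<Rightarrow> ('o \<Rightarrow>\<^sub>0 int) set" where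
  "coind_map C T U = (SOME h. h \<in> hom (K0 C U) (K0 C T) \<and>
     (\<forall>X\<in>U. h (K0_class C U X) = coind C T X))"

definition g_plus :: "('o, 'm, 'e, 'k, 'z) extricat_scheme \<Rightarrow> 'o set \<Rightarrow> 'o set \<Rightarrow> 'o set \<Rightarrow>
    ('o \<Rightarrow>\<^sub>0 int) set set" where
  "g_plus C T U indU = {ind_map C T U (K0_class C U X) | X. X \<in> indU}"

definition g_minus :: "('o, 'm, 'e, 'k, 'z) extricat_scheme \<Rightarrow> 'o set \<Rightarrow> 'o set \<Rightarrow> 'o set \<Rightarrow>
    ('o \<Rightarrow>\<^sub>0 int) set set" where
  "g_minus C T U indU = {coind_map C T U (K0_class C U X) | X. X \<in> indU}"


section \<open>Modules over a full subcategory and the pairing\<close>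

text \<open>For \<open>f : X \<rightarrow> Y\<close>, \<open>Mmor M X Y f\<close> is the induced map \<open>M(Y) \<rightarrow> M(X)\<close>.\<close>

record ('o, 'm, 'v, 'k) tmod =
  Mob :: "'o \<Rightarrow> ('k, 'v) module"
  Mmor :: "'o \<Rightarrow> 'o \<Rightarrow> 'm \<Rightarrow> 'v \<Rightarrow> 'v"

definition is_tmod :: "'k ring \<Rightarrow> ('o, 'm, 'k, 'z) lincat_scheme \<Rightarrow> 'o set \<Rightarrow>
    ('o, 'm, 'v, 'k) tmod \<Rightarrow> bool" where
  "is_tmod K C T M \<longleftrightarrow>
     (\<forall>X\<in>T. vectorspace K (Mob M X)) \<and>
     (\<forall>X\<in>T. \<forall>Y\<in>T. \<forall>f\<in>mor C X Y. Mmor M X Y f \<in> module_hom K (Mob M Y) (Mob M X)) \<and>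
     (\<forall>X\<in>T. \<forall>Y\<in>T. \<forall>v\<in>carrier (Mob M Y).
        (\<lambda>f. Mmor M X Y f v) \<in> module_hom K (Hom C X Y) (Mob M X)) \<and>
     (\<forall>X\<in>T. \<forall>v\<in>carrier (Mob M X). Mmor M X X (idn C X) v = v) \<and>
     (\<forall>X\<in>T. \<forall>Y\<in>T. \<forall>Z\<in>T. \<forall>f\<in>mor C X Y. \<forall>g\<in>mor C Y Z. \<forall>v\<in>carrier (Mob M Z).
        Mmor M X Z (cmp C X Y Z g f) v = Mmor M X Y f (Mmor M Y Z g v))"

definition lfd :: "'k ring \<Rightarrow> ('o, 'm, 'k, 'z) lincat_scheme \<Rightarrow> 'o set \<Rightarrow>
    ('o, 'm, 'v, 'k) tmod set" where
  "lfd K C T = {M. is_tmod K C T M \<and> (\<forall>X\<in>T. vectorspace.fin_dim K (Mob M X))}"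

definition is_simple_tmod :: "'k ring \<Rightarrow> ('o, 'm, 'k, 'z) lincat_scheme \<Rightarrow> 'o set \<Rightarrow>
    ('o, 'm, 'v, 'k) tmod \<Rightarrow> bool" where
  "is_simple_tmod K C T M \<longleftrightarrow> is_tmod K C T M \<and>
     (\<exists>X\<in>T. carrier (Mob M X) \<noteq> {\<zero>\<^bsub>Mob M X\<^esub>}) \<and>
     (\<forall>N. (\<forall>X\<in>T. subspace K (N X) (Mob M X)) \<and>
          (\<forall>X\<in>T. \<forall>Y\<in>T. \<forall>f\<in>mor C X Y. \<forall>v\<in>N Y. Mmor M X Y f v \<in> N X) \<longrightarrow>
        (\<forall>X\<in>T. N X = {\<zero>\<^bsub>Mob M X\<^esub>}) \<or> (\<forall>X\<in>T. N X = carrier (Mob M X)))"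

definition simple_at ::
    "('o, 'm, 'k, 'z) lincat_scheme \<Rightarrow> 'o \<Rightarrow> ('o, 'm, 'm set, 'k) tmod" where
  "simple_at C T0 = \<lparr>Mob = (\<lambda>X. quot_mod (Hom C X T0) (radical C X T0)),
     Mmor = (\<lambda>X Y f A. \<Union>g\<in>A. radical C X T0 +>\<^bsub>Hom C X T0\<^esub> cmp C X Y T0 g f)\<rparr>"

definition tmod_hom :: "'k ring \<Rightarrow> ('o, 'm, 'k, 'z) lincat_scheme \<Rightarrow> 'o set \<Rightarrow>
    ('o, 'm, 'v, 'k) tmod \<Rightarrow> ('o, 'm, 'v, 'k) tmod \<Rightarrow> ('o \<Rightarrow> 'v \<Rightarrow> 'v) set" where
  "tmod_hom K C T M N = {a. (\<forall>X\<in>T. a X \<in> module_hom K (Mob M X) (Mob N X)) \<and>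
     (\<forall>X\<in>T. \<forall>Y\<in>T. \<forall>f\<in>mor C X Y. \<forall>v\<in>carrier (Mob M Y).
        a X (Mmor M X Y f v) = Mmor N X Y f (a Y v))}"

definition short_exact :: "'k ring \<Rightarrow> ('o, 'm, 'k, 'z) lincat_scheme \<Rightarrow> 'o set \<Rightarrow>
    ('o, 'm, 'v, 'k) tmod \<Rightarrow> ('o, 'm, 'v, 'k) tmod \<Rightarrow> ('o, 'm, 'v, 'k) tmod \<Rightarrow> bool" where
  "short_exact K C T L M N \<longleftrightarrow> (\<exists>a\<in>tmod_hom K C T L M. \<exists>b\<in>tmod_hom K C T M N. \<forall>X\<in>T.
     inj_on (a X) (carrier (Mob L X)) \<and>
     a X ` carrier (Mob L X) = {v \<in> carrier (Mob M X). b X v = \<zero>\<^bsub>Mob N X\<^esub>} \<and>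
     b X ` carrier (Mob M X) = carrier (Mob N X))"

definition exact_relations :: "'k ring \<Rightarrow> ('o, 'm, 'k, 'z) lincat_scheme \<Rightarrow> 'o set \<Rightarrow>
    (('o, 'm, 'v, 'k) tmod \<Rightarrow>\<^sub>0 int) set" where
  "exact_relations K C T = generate (free_Abelian_group (lfd K C T))
     {frag_of M - frag_of L - frag_of N | L M N.
        L \<in> lfd K C T \<and> M \<in> lfd K C T \<and> N \<in> lfd K C T \<and> short_exact K C T L M N}"

definition K0_lfd :: "'k ring \<Rightarrow> ('o, 'm, 'k, 'z) lincat_scheme \<Rightarrow> 'o set \<Rightarrow>
    (('o, 'm, 'v, 'k) tmod \<Rightarrow>\<^sub>0 int) set monoid" where
  "K0_lfd K C T = free_Abelian_group (lfd K C T) Mod exact_relations K C T"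

text \<open>The bilinear extension of \<open>\<langle>[M], [X]\<rangle> = dim M(X)\<close>, first on formal combinations, then on
  \<open>K0_lfd \<times> K0\<close> and on its numerical quotient by evaluation at representatives; additivity of
  the dimension makes these values independent of the representatives.\<close>

definition pair_formal :: "'k ring \<Rightarrow> (('o, 'm, 'v, 'k) tmod \<Rightarrow>\<^sub>0 int) \<Rightarrow> ('o \<Rightarrow>\<^sub>0 int) \<Rightarrow> int" where
  "pair_formal K a b = (\<Sum>M\<in>Poly_Mapping.keys a. \<Sum>X\<in>Poly_Mapping.keys b.
     Poly_Mapping.lookup a M * Poly_Mapping.lookup b X * int (vectorspace.dim K (Mob M X)))"

definition pair_K0 ::
    "'k ring \<Rightarrow> (('o, 'm, 'v, 'k) tmod \<Rightarrow>\<^sub>0 int) set \<Rightarrow> ('o \<Rightarrow>\<^sub>0 int) set \<Rightarrow> int" where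
  "pair_K0 K \<alpha> \<beta> = pair_formal K (SOME a. a \<in> \<alpha>) (SOME b. b \<in> \<beta>)"

definition numerically_trivial :: "'k ring \<Rightarrow> ('o, 'm, 'k, 'z) lincat_scheme \<Rightarrow> 'o set \<Rightarrow>
    (('o, 'm, 'v, 'k) tmod \<Rightarrow>\<^sub>0 int) set set" where
  "numerically_trivial K C T =
     {\<alpha> \<in> carrier (K0_lfd K C T). \<forall>\<beta>\<in>carrier (K0 C T). pair_K0 K \<alpha> \<beta> = 0}"

definition K0_num :: "'k ring \<Rightarrow> ('o, 'm, 'k, 'z) lincat_scheme \<Rightarrow> 'o set \<Rightarrow>
    (('o, 'm, 'v, 'k) tmod \<Rightarrow>\<^sub>0 int) set set monoid" where
  "K0_num K C T = K0_lfd K C T Mod numerically_trivial K C T"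

definition num_class :: "'k ring \<Rightarrow> ('o, 'm, 'k, 'z) lincat_scheme \<Rightarrow> 'o set \<Rightarrow>
    ('o, 'm, 'v, 'k) tmod \<Rightarrow> (('o, 'm, 'v, 'k) tmod \<Rightarrow>\<^sub>0 int) set set" where
  "num_class K C T M = numerically_trivial K C T #>\<^bsub>K0_lfd K C T\<^esub>
     (exact_relations K C T #>\<^bsub>free_Abelian_group (lfd K C T)\<^esub> frag_of M)"

definition pairing ::
    "'k ring \<Rightarrow> (('o, 'm, 'v, 'k) tmod \<Rightarrow>\<^sub>0 int) set set \<Rightarrow> ('o \<Rightarrow>\<^sub>0 int) set \<Rightarrow> int" where
  "pairing K \<xi> \<beta> = pair_K0 K (SOME \<alpha>. \<alpha> \<in> \<xi>) \<beta>"

text \<open>At \<open>T0\<close>, no two elements of \<open>G\<close> have coordinates of strictly opposite sign.  (Requiring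
  \<open>\<langle>S, x\<rangle> \<ge> 0 \<longleftrightarrow> \<langle>S, y\<rangle> \<ge> 0\<close> instead would separate a zero coordinate from a negative one,
  which occur together already for the \<open>g\<close>-vectors of a single mutation.)\<close>

definition sign_coherent_at :: "'k ring \<Rightarrow> ('o, 'm, 'k, 'z) lincat_scheme \<Rightarrow> 'o set \<Rightarrow> 'o \<Rightarrow>
    ('o \<Rightarrow>\<^sub>0 int) set set \<Rightarrow> bool" where
  "sign_coherent_at K C T T0 G \<longleftrightarrow> (\<forall>x\<in>G. \<forall>y\<in>G.
     let s = num_class K C T (simple_at C T0) in
     (pairing K s x \<ge> 0 \<and> pairing K s y \<ge> 0) \<or> (pairing K s x \<le> 0 \<and> pairing K s y \<le> 0))"

end

theory Submission
  imports Defs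
begin

text \<open>
  Fix a simple \<open>\<T>\<close>-module \<open>S\<close> with finite-dimensional values and objects \<open>U\<close>, \<open>V\<close> of \<open>\<U>\<close>, with conflations
  \<open>N \<rightarrow> R \<rightarrow> U\<close> and \<open>N' \<rightarrow> R' \<rightarrow> V\<close> whose first two terms lie in \<open>\<T>\<close>.  Then \<open>\<langle>S, ind U\<rangle> = dim S(R) - dim S(N)\<close>,
  and similarly for \<open>V\<close>.  Suppose that this number is positive for \<open>U\<close> and negative for \<open>V\<close>.
  Then the restriction \<open>S(R) \<rightarrow> S(N)\<close> has a nonzero element \<open>\<xi>\<close> in its kernel, and the restriction
  \<open>S(R') \<rightarrow> S(N')\<close> misses some element \<open>\<eta>\<close>.  As \<open>S\<close> is simple, \<open>\<xi>\<close> generates it, so \<open>\<eta> = S(a) \<xi>\<close> for some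
  \<open>a : N' \<rightarrow> R\<close>.  Rigidity now decomposes \<open>a\<close>: since \<open>Ext(V, U) = 0\<close>, the composite \<open>N' \<rightarrow> R \<rightarrow> U\<close> extends
  to \<open>R'\<close>; since \<open>Ext(R', N) = 0\<close>, this extension lifts to \<open>R\<close>; and what remains of \<open>a\<close> is killed by \<open>R \<rightarrow> U\<close>,
  so it comes from \<open>N\<close>.  Hence \<open>a\<close> is a sum of a morphism that factors through \<open>N' \<rightarrow> R'\<close> and one that
  factors through \<open>N \<rightarrow> R\<close> (\<open>rigid_presentation_factor\<close>).  The second summand annihilates \<open>\<xi>\<close>, so
  \<open>\<eta> = S(a) \<xi>\<close> lies in the image of \<open>S(R') \<rightarrow> S(N')\<close>, a contradiction (\<open>simple_tmod_opposite_dims\<close>).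
  The coindex is treated in the same way with the conflations \<open>U \<rightarrow> L \<rightarrow> N\<close>.

  This plays the part of the usual statement that minimal presentations of a rigid object have no
  common summand, and it works with arbitrary conflations.

  For the argument to say something about \<open>ind_map\<close> and \<open>coind_map\<close>, the index has to be
  well defined and additive.  Additivity holds because sums of conflations are conflations.
  Independence of the conflation is a form of Schanuel's lemma: two conflations
  ending in \<open>U\<close> give homotopy equivalent complexes \<open>N \<rightarrow> R\<close> and \<open>N' \<rightarrow> R'\<close>, and the mapping cone
  \<open>N \<rightarrow> R \<oplus> N' \<rightarrow> R'\<close> splits, so that \<open>N \<oplus> R'\<close> and \<open>R \<oplus> N'\<close> are isomorphic.  The ends of the cone
  split because the extension groups between objects of \<open>\<T>\<close> vanish.  As inflations need not be
  monic, exactness in the middle does not follow from the universal property of a kernel; instead,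
  \<open>homotopy_equivalence_biprod\<close> shows that the idempotent complementary to the two split ends
  squares to zero.  Finally, the pairing is evaluated at chosen representatives, and its values do
  not depend on them because dimensions are additive along short exact sequences of modules and
  along biproducts in \<open>\<T>\<close>.
\<close>

section \<open>Arithmetic of morphisms\<close>

lemma module_hom_zero:
  assumes "module R M" "module R N" "f \<in> module_hom R M N"
  shows "f \<zero>\<^bsub>M\<^esub> = \<zero>\<^bsub>N\<^esub>"
  using assms by (intro mod_hom.f0_is_0) (auto simp: mod_hom_def mod_hom_axioms_def)

lemma module_hom_neg:
  assumes "module R M" "module R N" "f \<in> module_hom R M N" "x \<in> carrier M"
  shows "f (\<ominus>\<^bsub>M\<^esub> x) = \<ominus>\<^bsub>N\<^esub> f x"
  using assms by (intro mod_hom.f_neg) (auto simp: mod_hom_def mod_hom_axioms_def)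

lemma vectorspace_abelian: "vectorspace K V \<Longrightarrow> abelian_group V"
  by (simp add: vectorspace_def module_def)

context linear_category
begin

lemma Hom_abelian: "\<lbrakk>X \<in> ob C; Y \<in> ob C\<rbrakk> \<Longrightarrow> abelian_group (Hom C X Y)"
  using Hom_vs by (simp add: vectorspace_def module_def)

lemma zero_mor [simp, intro]: "\<lbrakk>X \<in> ob C; Y \<in> ob C\<rbrakk> \<Longrightarrow> \<zero>\<^bsub>Hom C X Y\<^esub> \<in> mor C X Y"
  by (meson Hom_abelian abelian_group.axioms(1) abelian_monoid.zero_closed)

lemma add_mor [simp, intro]:
  "\<lbrakk>X \<in> ob C; Y \<in> ob C; f \<in> mor C X Y; g \<in> mor C X Y\<rbrakk> \<Longrightarrow> f \<oplus>\<^bsub>Hom C X Y\<^esub> g \<in> mor C X Y"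
  by (meson Hom_abelian abelian_group.axioms(1) abelian_monoid.a_closed)

lemma neg_mor [simp, intro]:
  "\<lbrakk>X \<in> ob C; Y \<in> ob C; f \<in> mor C X Y\<rbrakk> \<Longrightarrow> \<ominus>\<^bsub>Hom C X Y\<^esub> f \<in> mor C X Y"
  by (meson Hom_abelian abelian_group.a_inv_closed)

lemma cmp_mor [simp, intro]:
  "\<lbrakk>X \<in> ob C; Y \<in> ob C; Z \<in> ob C; g \<in> mor C Y Z; f \<in> mor C X Y\<rbrakk> \<Longrightarrow> cmp C X Y Z g f \<in> mor C X Z"
  using cmp_linear_right[of X Y Z g] by (auto simp: module_hom_def)

end

declare (in linear_category) idn_mor [simp, intro] cmp_idn_left [simp] cmp_idn_right [simp]

context linear_category
begin

lemma Hom_module: "\<lbrakk>X \<in> ob C; Y \<in> ob C\<rbrakk> \<Longrightarrow> module K (Hom C X Y)"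
  using Hom_vs by (simp add: vectorspace_def)

lemma cmp_add_right:
  "\<lbrakk>X \<in> ob C; Y \<in> ob C; Z \<in> ob C; g \<in> mor C Y Z; f \<in> mor C X Y; f' \<in> mor C X Y\<rbrakk> \<Longrightarrow>
    cmp C X Y Z g (f \<oplus>\<^bsub>Hom C X Y\<^esub> f') = cmp C X Y Z g f \<oplus>\<^bsub>Hom C X Z\<^esub> cmp C X Y Z g f'"
  using module_hom_add[OF cmp_linear_right[of X Y Z g]] by simp

lemma cmp_add_left:
  "\<lbrakk>X \<in> ob C; Y \<in> ob C; Z \<in> ob C; g \<in> mor C Y Z; g' \<in> mor C Y Z; f \<in> mor C X Y\<rbrakk> \<Longrightarrow>
    cmp C X Y Z (g \<oplus>\<^bsub>Hom C Y Z\<^esub> g') f = cmp C X Y Z g f \<oplus>\<^bsub>Hom C X Z\<^esub> cmp C X Y Z g' f"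
  using module_hom_add[OF cmp_linear_left[of X Y Z f]] by simp

lemma cmp_zero_right [simp]:
  "\<lbrakk>X \<in> ob C; Y \<in> ob C; Z \<in> ob C; g \<in> mor C Y Z\<rbrakk> \<Longrightarrow>
    cmp C X Y Z g \<zero>\<^bsub>Hom C X Y\<^esub> = \<zero>\<^bsub>Hom C X Z\<^esub>"
  using module_hom_zero[OF _ _ cmp_linear_right[of X Y Z g]] Hom_module by simp

lemma cmp_zero_left [simp]:
  "\<lbrakk>X \<in> ob C; Y \<in> ob C; Z \<in> ob C; f \<in> mor C X Y\<rbrakk> \<Longrightarrow>
    cmp C X Y Z \<zero>\<^bsub>Hom C Y Z\<^esub> f = \<zero>\<^bsub>Hom C X Z\<^esub>"
  using module_hom_zero[OF _ _ cmp_linear_left[of X Y Z f]] Hom_module by simp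

lemma cmp_neg_right:
  "\<lbrakk>X \<in> ob C; Y \<in> ob C; Z \<in> ob C; g \<in> mor C Y Z; f \<in> mor C X Y\<rbrakk> \<Longrightarrow>
    cmp C X Y Z g (\<ominus>\<^bsub>Hom C X Y\<^esub> f) = \<ominus>\<^bsub>Hom C X Z\<^esub> cmp C X Y Z g f"
  using module_hom_neg[OF _ _ cmp_linear_right[of X Y Z g]] Hom_module by simp

lemma cmp_neg_left:
  "\<lbrakk>X \<in> ob C; Y \<in> ob C; Z \<in> ob C; g \<in> mor C Y Z; f \<in> mor C X Y\<rbrakk> \<Longrightarrow>
    cmp C X Y Z (\<ominus>\<^bsub>Hom C Y Z\<^esub> g) f = \<ominus>\<^bsub>Hom C X Z\<^esub> cmp C X Y Z g f"
  using module_hom_neg[OF _ _ cmp_linear_left[of X Y Z f]] Hom_module by simp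

lemma diff_mor [simp, intro]:
  "\<lbrakk>X \<in> ob C; Y \<in> ob C; f \<in> mor C X Y; g \<in> mor C X Y\<rbrakk> \<Longrightarrow> f \<ominus>\<^bsub>Hom C X Y\<^esub> g \<in> mor C X Y"
  by (simp add: a_minus_def)

lemma cmp_diff_right:
  "\<lbrakk>X \<in> ob C; Y \<in> ob C; Z \<in> ob C; g \<in> mor C Y Z; f \<in> mor C X Y; f' \<in> mor C X Y\<rbrakk> \<Longrightarrow>
    cmp C X Y Z g (f \<ominus>\<^bsub>Hom C X Y\<^esub> f') = cmp C X Y Z g f \<ominus>\<^bsub>Hom C X Z\<^esub> cmp C X Y Z g f'"
  by (simp add: a_minus_def cmp_add_right cmp_neg_right)

lemma cmp_diff_left:
  "\<lbrakk>X \<in> ob C; Y \<in> ob C; Z \<in> ob C; g \<in> mor C Y Z; g' \<in> mor C Y Z; f \<in> mor C X Y\<rbrakk> \<Longrightarrow>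
    cmp C X Y Z (g \<ominus>\<^bsub>Hom C Y Z\<^esub> g') f = cmp C X Y Z g f \<ominus>\<^bsub>Hom C X Z\<^esub> cmp C X Y Z g' f"
  by (simp add: a_minus_def cmp_add_left cmp_neg_left)

lemma zero_add_mor [simp]:
  assumes "X \<in> ob C" "Y \<in> ob C" "f \<in> mor C X Y"
  shows "\<zero>\<^bsub>Hom C X Y\<^esub> \<oplus>\<^bsub>Hom C X Y\<^esub> f = f" "f \<oplus>\<^bsub>Hom C X Y\<^esub> \<zero>\<^bsub>Hom C X Y\<^esub> = f"
proof -
  interpret abelian_group "Hom C X Y" using assms Hom_abelian by simp
  show "\<zero>\<^bsub>Hom C X Y\<^esub> \<oplus>\<^bsub>Hom C X Y\<^esub> f = f" "f \<oplus>\<^bsub>Hom C X Y\<^esub> \<zero>\<^bsub>Hom C X Y\<^esub> = f"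
    using assms by simp_all
qed

lemma neg_zero_mor [simp]:
  "\<lbrakk>X \<in> ob C; Y \<in> ob C\<rbrakk> \<Longrightarrow> \<ominus>\<^bsub>Hom C X Y\<^esub> \<zero>\<^bsub>Hom C X Y\<^esub> = \<zero>\<^bsub>Hom C X Y\<^esub>"
  using abelian_group.minus_equality[OF Hom_abelian, of X Y "\<zero>\<^bsub>Hom C X Y\<^esub>" "\<zero>\<^bsub>Hom C X Y\<^esub>"] by simp

lemma diff_eq_zero_iff:
  "\<lbrakk>X \<in> ob C; Y \<in> ob C; f \<in> mor C X Y; g \<in> mor C X Y\<rbrakk> \<Longrightarrow>
    f \<ominus>\<^bsub>Hom C X Y\<^esub> g = \<zero>\<^bsub>Hom C X Y\<^esub> \<longleftrightarrow> f = g"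
  by (metis Hom_abelian a_minus_def abelian_group.a_inv_closed abelian_group.minus_equality
    abelian_group.minus_minus abelian_group.r_neg)

lemma diff_zero_mor [simp]:
  "\<lbrakk>X \<in> ob C; Y \<in> ob C; f \<in> mor C X Y\<rbrakk> \<Longrightarrow> f \<ominus>\<^bsub>Hom C X Y\<^esub> \<zero>\<^bsub>Hom C X Y\<^esub> = f"
  by (simp add: a_minus_def)

lemma diff_self [simp]:
  "\<lbrakk>X \<in> ob C; Y \<in> ob C; f \<in> mor C X Y\<rbrakk> \<Longrightarrow> f \<ominus>\<^bsub>Hom C X Y\<^esub> f = \<zero>\<^bsub>Hom C X Y\<^esub>"
  by (simp add: diff_eq_zero_iff)

lemma diff_eq_iff:
  assumes "X \<in> ob C" "Y \<in> ob C" "f \<in> mor C X Y" "g \<in> mor C X Y" "h \<in> mor C X Y"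
  shows "f \<ominus>\<^bsub>Hom C X Y\<^esub> g = h \<longleftrightarrow> f = g \<oplus>\<^bsub>Hom C X Y\<^esub> h"
proof -
  interpret abelian_group "Hom C X Y" using assms Hom_abelian by blast
  show ?thesis
    using assms by (metis a_comm a_minus_def a_inv_closed r_neg1 r_neg2)
qed

end

section \<open>Homotopy equivalent two-term complexes\<close>

context linear_category
begin

text \<open>A split monomorphism \<open>i\<close> and a split epimorphism \<open>p\<close> with \<open>p i = 0\<close> leave over an
  idempotent \<open>e\<close> of the middle object with \<open>e i = 0\<close> and \<open>p e = 0\<close>.  If endomorphisms of this kind square to
  zero, then \<open>e = 0\<close> and the pair is a biproduct.  This avoids splitting \<open>e\<close>.\<close>

lemma split_pair_biprod:
  assumes ob: "N \<in> ob C" "M \<in> ob C" "R \<in> ob C"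
    and mor: "i \<in> mor C N M" "p \<in> mor C M R" "r \<in> mor C M N" "s \<in> mor C R M"
    and ri: "cmp C N M N r i = idn C N" and ps: "cmp C R M R p s = idn C R"
    and pi: "cmp C N M R p i = \<zero>\<^bsub>Hom C N R\<^esub>"
    and nil: "\<And>e. \<lbrakk>e \<in> mor C M M; cmp C N M M e i = \<zero>\<^bsub>Hom C N M\<^esub>;
      cmp C M M R p e = \<zero>\<^bsub>Hom C M R\<^esub>\<rbrakk> \<Longrightarrow> cmp C M M M e e = \<zero>\<^bsub>Hom C M M\<^esub>"
  shows "\<exists>j. is_biprod C N R M i j r p"
proof -
  \<comment> \<open>\<open>d\<close> is the idempotent complementary to \<open>i r\<close>; it corrects the section \<open>s\<close> to one that \<open>r\<close> kills.\<close>
  define d where "d = idn C M \<ominus>\<^bsub>Hom C M M\<^esub> cmp C M N M i r"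
  have d: "d \<in> mor C M M" using ob mor by (simp add: d_def)
  have rd: "cmp C M M N r d = \<zero>\<^bsub>Hom C M N\<^esub>"
    using ob mor ri cmp_assoc[of M N M N r i r, symmetric] by (simp add: d_def cmp_diff_right)
  have di: "cmp C N M M d i = \<zero>\<^bsub>Hom C N M\<^esub>"
    using ob mor ri cmp_assoc[of N M N M i r i] by (simp add: d_def cmp_diff_left)
  have pd: "cmp C M M R p d = p"
    using ob mor pi cmp_assoc[of M N M R r i p, symmetric] by (simp add: d_def cmp_diff_right)
  define j where "j = cmp C R M M d s"
  have j: "j \<in> mor C R M" using ob mor d by (simp add: j_def)
  have rj: "cmp C R M N r j = \<zero>\<^bsub>Hom C R N\<^esub>"
    using ob mor d rd cmp_assoc[of R M M N s d r, symmetric] by (simp add: j_def)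
  have pj: "cmp C R M R p j = idn C R"
    using ob mor d pd ps cmp_assoc[of R M M R s d p, symmetric] by (simp add: j_def)
  define e where "e = d \<ominus>\<^bsub>Hom C M M\<^esub> cmp C M R M j p"
  have e: "e \<in> mor C M M" using ob mor d j by (simp add: e_def)
  have ei: "cmp C N M M e i = \<zero>\<^bsub>Hom C N M\<^esub>"
    using ob mor d j di pi cmp_assoc[of N M R M i p j] by (simp add: e_def cmp_diff_left)
  have pe: "cmp C M M R p e = \<zero>\<^bsub>Hom C M R\<^esub>"
    using ob mor d j pd pj cmp_assoc[of M R M R p j p, symmetric] by (simp add: e_def cmp_diff_right)
  have dj: "cmp C R M M d j = j"
    using ob mor j rj cmp_assoc[of R M N M j r i] by (simp add: d_def cmp_diff_left)
  have ej: "cmp C R M M e j = \<zero>\<^bsub>Hom C R M\<^esub>"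
    using ob mor d j dj pj cmp_assoc[of R M R M j p j] by (simp add: e_def cmp_diff_left)
  have ed: "cmp C M M M e d = e"
    using ob mor e ei cmp_assoc[of M N M M r i e, symmetric] by (simp add: d_def cmp_diff_right)
  have "cmp C M M M e e = cmp C M M M e d \<ominus>\<^bsub>Hom C M M\<^esub> cmp C M M M e (cmp C M R M j p)"
    using ob mor d j e by (subst (2) e_def) (simp add: cmp_diff_right)
  also have "\<dots> = e \<ominus>\<^bsub>Hom C M M\<^esub> \<zero>\<^bsub>Hom C M M\<^esub>"
    using ob mor e j ed ej cmp_assoc[of M R M M p j e, symmetric] by simp
  also have "\<dots> = e"
    using ob e by simp
  finally have "e = \<zero>\<^bsub>Hom C M M\<^esub>" using nil[OF e ei pe] by simp
  then have "d = cmp C M R M j p" using ob mor d j by (simp add: e_def diff_eq_zero_iff)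
  then have "cmp C M N M i r \<oplus>\<^bsub>Hom C M M\<^esub> cmp C M R M j p = idn C M"
    using ob mor diff_eq_iff[of M M "idn C M" "cmp C M N M i r" d] d by (simp add: d_def)
  then show ?thesis using ob mor j ri pj rj pi by (auto simp: is_biprod_def)
qed

text \<open>The cone of a chain map \<open>(l, h)\<close> of two-term complexes, \<open>N \<rightarrow> R \<oplus> N' \<rightarrow> R'\<close>, splits at its
  left end by the homotopy that trivialises \<open>id\<^sub>N\<close> and at its right end by the one that trivialises \<open>id\<^sub>R'\<close>.
  Let \<open>e\<close> be an endomorphism of the middle term with \<open>e i = 0\<close> and \<open>p e = 0\<close>, with components \<open>x\<close> in \<open>R\<close> and
  \<open>y\<close> in \<open>N'\<close>.  Then \<open>lift\<close> writes \<open>x\<close> as \<open>k c\<close>, and \<open>extend\<close> writes the restriction of \<open>e\<close> to \<open>N'\<close> as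
  \<open>q k'\<close>; substituting both into \<open>e e\<close> leaves \<open>q (h x + k' y) = q (p e) = 0\<close>.  The hypotheses \<open>lift\<close>
  and \<open>extend\<close> are weak: they ask for factorisations only, as the complexes of interest are
  halves of conflations, where \<open>k\<close> need not be monic nor \<open>k'\<close> epic.\<close>

lemma homotopy_equivalence_biprod:
  assumes ob: "N \<in> ob C" "R \<in> ob C" "N' \<in> ob C" "R' \<in> ob C"
    and mor: "k \<in> mor C N R" "k' \<in> mor C N' R'" "h \<in> mor C R R'" "l \<in> mor C N N'"
    and chain: "cmp C N R R' h k = cmp C N N' R' k' l"
    and u: "u \<in> mor C R' R" "v \<in> mor C R' N'"
      "idn C R' = cmp C R' R R' h u \<oplus>\<^bsub>Hom C R' R'\<^esub> cmp C R' N' R' k' v"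
    and w: "w \<in> mor C N' N" "t \<in> mor C R N"
      "idn C N = cmp C N N' N w l \<oplus>\<^bsub>Hom C N N\<^esub> cmp C N R N t k"
    and lift: "\<And>M a b. \<lbrakk>M \<in> ob C; a \<in> mor C M R; b \<in> mor C M N';
      cmp C M R R' h a = cmp C M N' R' k' b\<rbrakk> \<Longrightarrow> \<exists>c\<in>mor C M N. a = cmp C M N R k c"
    and extend: "\<And>M p q. \<lbrakk>M \<in> ob C; p \<in> mor C R M; q \<in> mor C N' M;
      cmp C N R M p k = cmp C N N' M q l\<rbrakk> \<Longrightarrow> \<exists>c\<in>mor C R' M. q = cmp C N' R' M c k'"
    and B: "is_biprod C R N' M iR iN pR pN"
  shows "\<exists>i j p q. is_biprod C N R' M i j p q"
proof -
  have M: "M \<in> ob C" "iR \<in> mor C R M" "iN \<in> mor C N' M" "pR \<in> mor C M R" "pN \<in> mor C M N'"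
    and Bc: "cmp C R M R pR iR = idn C R" "cmp C N' M N' pN iN = idn C N'"
      "cmp C R M N' pN iR = \<zero>\<^bsub>Hom C R N'\<^esub>" "cmp C N' M R pR iN = \<zero>\<^bsub>Hom C N' R\<^esub>"
      "cmp C M R M iR pR \<oplus>\<^bsub>Hom C M M\<^esub> cmp C M N' M iN pN = idn C M"
    using B by (auto simp: is_biprod_def)
  note a = ob mor M u(1,2) w(1,2)
  \<comment> \<open>The cone and the splittings of its ends.  The sign is in \<open>i\<close>, hence also in the retraction \<open>r\<close>.\<close>
  define i where "i = cmp C N R M iR k \<ominus>\<^bsub>Hom C N M\<^esub> cmp C N N' M iN l"
  define p where "p = cmp C M R R' h pR \<oplus>\<^bsub>Hom C M R'\<^esub> cmp C M N' R' k' pN"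
  define r where "r = cmp C M R N t pR \<ominus>\<^bsub>Hom C M N\<^esub> cmp C M N' N w pN"
  define s where "s = cmp C R' R M iR u \<oplus>\<^bsub>Hom C R' M\<^esub> cmp C R' N' M iN v"
  have t: "i \<in> mor C N M" "p \<in> mor C M R'" "r \<in> mor C M N" "s \<in> mor C R' M"
    using a by (simp_all add: i_def p_def r_def s_def)
  have pR: "cmp C R M R' p iR = h" and pN: "cmp C N' M R' p iN = k'"
    using a Bc by (simp_all add: p_def cmp_add_left cmp_assoc)
  have rR: "cmp C R M N r iR = t" and rN: "cmp C N' M N r iN = \<ominus>\<^bsub>Hom C N' N\<^esub> w"
    using a Bc by (simp_all add: r_def cmp_diff_left cmp_assoc a_minus_def cmp_neg_left cmp_add_left)
  have pi: "cmp C N M R' p i = \<zero>\<^bsub>Hom C N R'\<^esub>"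
    using a t pR pN chain cmp_assoc[of N R M R' k iR p, symmetric] cmp_assoc[of N N' M R' l iN p, symmetric]
    by (simp add: i_def cmp_diff_right)
  have ps: "cmp C R' M R' p s = idn C R'"
    using a t pR pN u(3) cmp_assoc[of R' R M R' u iR p, symmetric] cmp_assoc[of R' N' M R' v iN p, symmetric]
    by (simp add: s_def cmp_add_right)
  have ri: "cmp C N M N r i = idn C N"
  proof -
    interpret H: abelian_group "Hom C N N" using a Hom_abelian by blast
    have "cmp C N M N r i = cmp C N R N t k \<oplus>\<^bsub>Hom C N N\<^esub> cmp C N N' N w l"
      using a t rR rN cmp_assoc[of N R M N k iR r, symmetric] cmp_assoc[of N N' M N l iN r, symmetric]
      by (simp add: i_def cmp_diff_right a_minus_def cmp_add_right cmp_neg_right cmp_neg_left)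
    then show ?thesis using w(3) a H.a_comm by simp
  qed
  have "cmp C M M M e e = \<zero>\<^bsub>Hom C M M\<^esub>"
    if e: "e \<in> mor C M M" "cmp C N M M e i = \<zero>\<^bsub>Hom C N M\<^esub>"
      "cmp C M M R' p e = \<zero>\<^bsub>Hom C M R'\<^esub>" for e
  proof -
    define x where "x = cmp C M M R pR e"
    define y where "y = cmp C M M N' pN e"
    have xy: "x \<in> mor C M R" "y \<in> mor C M N'" using a e by (simp_all add: x_def y_def)
    have e': "e = cmp C M R M iR x \<oplus>\<^bsub>Hom C M M\<^esub> cmp C M N' M iN y"
    proof -
      have "e = cmp C M M M (cmp C M R M iR pR \<oplus>\<^bsub>Hom C M M\<^esub> cmp C M N' M iN pN) e"
        using Bc a e by simp
      then show ?thesis using a e by (simp add: cmp_add_left cmp_assoc x_def y_def)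
    qed
    have "cmp C M M R' p e = cmp C M R R' h x \<oplus>\<^bsub>Hom C M R'\<^esub> cmp C M N' R' k' y"
      using a e by (simp add: p_def x_def y_def cmp_add_left cmp_assoc)
    then have hx0: "cmp C M R R' h x \<oplus>\<^bsub>Hom C M R'\<^esub> cmp C M N' R' k' y = \<zero>\<^bsub>Hom C M R'\<^esub>"
      using e by simp
    then have hx: "cmp C M R R' h x = \<ominus>\<^bsub>Hom C M R'\<^esub> cmp C M N' R' k' y"
      using a xy by (simp add: abelian_group.minus_equality[OF Hom_abelian])
    then have "cmp C M R R' h x = cmp C M N' R' k' (\<ominus>\<^bsub>Hom C M N'\<^esub> y)"
      using a xy by (simp add: cmp_neg_right)
    then obtain c where c: "c \<in> mor C M N" "x = cmp C M N R k c"
      using lift[of M x "\<ominus>\<^bsub>Hom C M N'\<^esub> y"] a xy by auto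
    have "cmp C N R M (cmp C R M M e iR) k \<ominus>\<^bsub>Hom C N M\<^esub>
        cmp C N N' M (cmp C N' M M e iN) l = cmp C N M M e i"
      using a e(1) by (simp add: i_def cmp_diff_right cmp_assoc)
    then have "cmp C N R M (cmp C R M M e iR) k \<ominus>\<^bsub>Hom C N M\<^esub> cmp C N N' M (cmp C N' M M e iN) l
        = \<zero>\<^bsub>Hom C N M\<^esub>"
      using e(2) by simp
    then have kl: "cmp C N R M (cmp C R M M e iR) k = cmp C N N' M (cmp C N' M M e iN) l"
      using a e(1) diff_eq_zero_iff[of N M "cmp C N R M (cmp C R M M e iR) k"] by blast
    then obtain q where q: "q \<in> mor C R' M" "cmp C N' M M e iN = cmp C N' R' M q k'"
      using extend[of M "cmp C R M M e iR" "cmp C N' M M e iN"] a e by auto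
    have "cmp C M R M (cmp C R M M e iR) x = cmp C M N M (cmp C N R M (cmp C R M M e iR) k) c"
      using a e c by (simp add: cmp_assoc)
    also have "\<dots> = cmp C M N M (cmp C N N' M (cmp C N' R' M q k') l) c"
      using kl q by simp
    also have "\<dots> = cmp C M R' M q (cmp C M N R' (cmp C N N' R' k' l) c)"
      using a q c by (simp add: cmp_assoc)
    also have "\<dots> = cmp C M R' M q (cmp C M R R' h x)"
      unfolding chain[symmetric] using a q c by (simp add: cmp_assoc)
    finally have 1: "cmp C M R M (cmp C R M M e iR) x = cmp C M R' M q (cmp C M R R' h x)" .
    have "cmp C M M M e e = cmp C M M M e (cmp C M R M iR x \<oplus>\<^bsub>Hom C M M\<^esub> cmp C M N' M iN y)"
      using e' by simp
    also have "\<dots> = cmp C M R M (cmp C R M M e iR) x \<oplus>\<^bsub>Hom C M M\<^esub>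
        cmp C M N' M (cmp C N' M M e iN) y"
      using a e xy by (simp add: cmp_add_right cmp_assoc)
    also have "\<dots> = cmp C M R' M q (cmp C M R R' h x \<oplus>\<^bsub>Hom C M R'\<^esub> cmp C M N' R' k' y)"
      unfolding 1 q(2) using a xy q(1) by (simp add: cmp_add_right cmp_assoc)
    also have "\<dots> = \<zero>\<^bsub>Hom C M M\<^esub>" unfolding hx0 using a q by simp
    finally show ?thesis .
  qed
  then show ?thesis
    using split_pair_biprod[OF ob(1) M(1) ob(4) t ri ps pi] by blast
qed

end

section \<open>Exact sequences of a conflation\<close>

context extriangulated_category
begin

text \<open>An extriangle in the sense of Nakaoka and Palu.  The extension class is kept as data, since
  the long exact sequences of a conflation refer to it.\<close>

definition extriangle where
  "extriangle X Y Z x y \<delta> \<longleftrightarrow>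
     X \<in> ob C \<and> Z \<in> ob C \<and> \<delta> \<in> carrier (Ext C Z X) \<and> (Y, x, y) \<in> rlz C Z X \<delta>"

lemma conflation_extriangle: "conflation C X Y Z x y \<longleftrightarrow> (\<exists>\<delta>. extriangle X Y Z x y \<delta>)"
  by (auto simp: conflation_def extriangle_def)

lemma extriangle_typed:
  assumes "extriangle X Y Z x y \<delta>"
  shows "X \<in> ob C" "Y \<in> ob C" "Z \<in> ob C" "x \<in> mor C X Y" "y \<in> mor C Y Z" "\<delta> \<in> carrier (Ext C Z X)"
  using assms rlz_typed[of Z X \<delta> Y x y] by (simp_all add: extriangle_def)

lemma ex_extriangle:
  assumes "X \<in> ob C" "Z \<in> ob C" "\<delta> \<in> carrier (Ext C Z X)"
  shows "\<exists>Y x y. extriangle X Y Z x y \<delta>"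
proof -
  obtain s where "s \<in> rlz C Z X \<delta>" using rlz_nonempty[OF assms(2,1,3)] by blast
  then show ?thesis using assms by (cases s) (auto simp only: extriangle_def)
qed

lemma Ext_module: "\<lbrakk>Z \<in> ob C; X \<in> ob C\<rbrakk> \<Longrightarrow> module K (Ext C Z X)"
  using Ext_vs by (simp add: vectorspace_def)

lemma Ext_zero [simp, intro]: "\<lbrakk>Z \<in> ob C; X \<in> ob C\<rbrakk> \<Longrightarrow> \<zero>\<^bsub>Ext C Z X\<^esub> \<in> carrier (Ext C Z X)"
  by (meson Ext_vs vectorspace_abelian abelian_group.axioms(1) abelian_monoid.zero_closed)

lemma push_closed [simp, intro]:
  "\<lbrakk>Z \<in> ob C; X \<in> ob C; Y \<in> ob C; a \<in> mor C X Y; \<delta> \<in> carrier (Ext C Z X)\<rbrakk> \<Longrightarrow>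
    push C Z X Y a \<delta> \<in> carrier (Ext C Z Y)"
  using push_linear[of Z X Y a] by (auto simp: module_hom_def)

lemma pull_closed [simp, intro]:
  "\<lbrakk>W \<in> ob C; Z \<in> ob C; X \<in> ob C; c \<in> mor C W Z; \<delta> \<in> carrier (Ext C Z X)\<rbrakk> \<Longrightarrow>
    pull C W Z X c \<delta> \<in> carrier (Ext C W X)"
  using pull_linear[of W Z X c] by (auto simp: module_hom_def)

lemma push_zero [simp]:
  "\<lbrakk>Z \<in> ob C; X \<in> ob C; Y \<in> ob C; a \<in> mor C X Y\<rbrakk> \<Longrightarrow>
    push C Z X Y a \<zero>\<^bsub>Ext C Z X\<^esub> = \<zero>\<^bsub>Ext C Z Y\<^esub>"
  using module_hom_zero[OF Ext_module Ext_module push_linear] by blast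

lemma pull_zero [simp]:
  "\<lbrakk>W \<in> ob C; Z \<in> ob C; X \<in> ob C; c \<in> mor C W Z\<rbrakk> \<Longrightarrow>
    pull C W Z X c \<zero>\<^bsub>Ext C Z X\<^esub> = \<zero>\<^bsub>Ext C W X\<^esub>"
  using module_hom_zero[OF Ext_module Ext_module pull_linear] by blast

lemma push_zero_mor [simp]:
  "\<lbrakk>Z \<in> ob C; X \<in> ob C; Y \<in> ob C; \<delta> \<in> carrier (Ext C Z X)\<rbrakk> \<Longrightarrow>
    push C Z X Y \<zero>\<^bsub>Hom C X Y\<^esub> \<delta> = \<zero>\<^bsub>Ext C Z Y\<^esub>"
  using module_hom_zero[OF Hom_module Ext_module push_linear_mor] by blast

lemma pull_zero_mor [simp]:
  "\<lbrakk>W \<in> ob C; Z \<in> ob C; X \<in> ob C; \<delta> \<in> carrier (Ext C Z X)\<rbrakk> \<Longrightarrow>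
    pull C W Z X \<zero>\<^bsub>Hom C W Z\<^esub> \<delta> = \<zero>\<^bsub>Ext C W X\<^esub>"
  using module_hom_zero[OF Hom_module Ext_module pull_linear_mor] by blast

lemma push_diff:
  assumes "Z \<in> ob C" "X \<in> ob C" "Y \<in> ob C" "a \<in> mor C X Y" "a' \<in> mor C X Y" "\<delta> \<in> carrier (Ext C Z X)"
    and "push C Z X Y a \<delta> = push C Z X Y a' \<delta>"
  shows "push C Z X Y (a \<ominus>\<^bsub>Hom C X Y\<^esub> a') \<delta> = \<zero>\<^bsub>Ext C Z Y\<^esub>"
proof -
  interpret E: abelian_group "Ext C Z Y" using assms Ext_vs vectorspace_abelian by blast
  have "push C Z X Y (a \<ominus>\<^bsub>Hom C X Y\<^esub> a') \<delta> = push C Z X Y a' \<delta> \<ominus>\<^bsub>Ext C Z Y\<^esub> push C Z X Y a' \<delta>"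
    unfolding a_minus_def using assms
      module_hom_add[OF push_linear_mor[of Z X Y \<delta>], of a "\<ominus>\<^bsub>Hom C X Y\<^esub> a'"]
      module_hom_neg[OF Hom_module Ext_module push_linear_mor[of Z X Y \<delta>], of a']
    by simp
  then show ?thesis using assms by (simp add: E.r_neg a_minus_def)
qed

lemma pull_diff:
  assumes "W \<in> ob C" "Z \<in> ob C" "X \<in> ob C" "c \<in> mor C W Z" "c' \<in> mor C W Z" "\<delta> \<in> carrier (Ext C Z X)"
    and "pull C W Z X c \<delta> = pull C W Z X c' \<delta>"
  shows "pull C W Z X (c \<ominus>\<^bsub>Hom C W Z\<^esub> c') \<delta> = \<zero>\<^bsub>Ext C W X\<^esub>"
proof -
  interpret E: abelian_group "Ext C W X" using assms Ext_vs vectorspace_abelian by blast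
  have "pull C W Z X (c \<ominus>\<^bsub>Hom C W Z\<^esub> c') \<delta> = pull C W Z X c' \<delta> \<ominus>\<^bsub>Ext C W X\<^esub> pull C W Z X c' \<delta>"
    unfolding a_minus_def using assms
      module_hom_add[OF pull_linear_mor[of W Z X \<delta>], of c "\<ominus>\<^bsub>Hom C W Z\<^esub> c'"]
      module_hom_neg[OF Hom_module Ext_module pull_linear_mor[of W Z X \<delta>], of c']
    by simp
  then show ?thesis using assms by (simp add: E.r_neg a_minus_def)
qed

text \<open>The conflations \<open>X \<rightarrow> X \<rightarrow> 0\<close> and \<open>0 \<rightarrow> X \<rightarrow> X\<close>.  The exactness properties below
  follow by completing morphisms between them and a given conflation.\<close>

lemma extriangle_id_left:
  assumes "is_zero C O'" "X \<in> ob C"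
  shows "extriangle X X O' (idn C X) \<zero>\<^bsub>Hom C X O'\<^esub> \<zero>\<^bsub>Ext C O' X\<^esub>"
proof -
  have O: "O' \<in> ob C" "idn C O' = \<zero>\<^bsub>Hom C O' O'\<^esub>" using assms by (auto simp: is_zero_def)
  interpret H: abelian_group "Hom C X X" using assms Hom_abelian by blast
  have "is_biprod C X O' X (idn C X) \<zero>\<^bsub>Hom C O' X\<^esub> (idn C X) \<zero>\<^bsub>Hom C X O'\<^esub>"
    using O assms by (simp add: is_biprod_def)
  then show ?thesis using rlz_zero O assms by (simp add: extriangle_def)
qed

lemma extriangle_id_right:
  assumes "is_zero C O'" "X \<in> ob C"
  shows "extriangle O' X X \<zero>\<^bsub>Hom C O' X\<^esub> (idn C X) \<zero>\<^bsub>Ext C X O'\<^esub>"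
proof -
  have O: "O' \<in> ob C" "idn C O' = \<zero>\<^bsub>Hom C O' O'\<^esub>" using assms by (auto simp: is_zero_def)
  interpret H: abelian_group "Hom C X X" using assms Hom_abelian by blast
  have "is_biprod C O' X X \<zero>\<^bsub>Hom C O' X\<^esub> (idn C X) \<zero>\<^bsub>Hom C X O'\<^esub> (idn C X)"
    using O assms by (simp add: is_biprod_def)
  then show ?thesis using rlz_zero O assms by (simp add: extriangle_def)
qed

lemma extriangle_complete:
  assumes "extriangle X Y Z x y \<delta>" "extriangle X' Y' Z' x' y' \<delta>'"
    and "a \<in> mor C X X'" "c \<in> mor C Z Z'" "push C Z X X' a \<delta> = pull C Z Z' X' c \<delta>'"
  obtains b where "b \<in> mor C Y Y'" "cmp C X Y Y' b x = cmp C X X' Y' x' a"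
    "cmp C Y Y' Z' y' b = cmp C Y Z Z' c y"
  using rlz_mor[of Z X Z' X' \<delta> \<delta>' Y x y Y' x' y' a c] assms unfolding extriangle_def by blast

lemma extriangle_complete_right:
  assumes "extriangle X Y Z x y \<delta>" "extriangle X' Y' Z' x' y' \<delta>'"
    and "a \<in> mor C X X'" "b \<in> mor C Y Y'" "cmp C X Y Y' b x = cmp C X X' Y' x' a"
  obtains c where "c \<in> mor C Z Z'" "cmp C Y Z Z' c y = cmp C Y Y' Z' y' b"
    "push C Z X X' a \<delta> = pull C Z Z' X' c \<delta>'"
  using ET3[of Z X Z' X' \<delta> \<delta>' Y x y Y' x' y' a b] assms unfolding extriangle_def by blast

lemma extriangle_complete_left:
  assumes "extriangle X Y Z x y \<delta>" "extriangle X' Y' Z' x' y' \<delta>'"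
    and "b \<in> mor C Y Y'" "c \<in> mor C Z Z'" "cmp C Y Z Z' c y = cmp C Y Y' Z' y' b"
  obtains a where "a \<in> mor C X X'" "cmp C X Y Y' b x = cmp C X X' Y' x' a"
    "push C Z X X' a \<delta> = pull C Z Z' X' c \<delta>'"
  using ET3_op[of Z X Z' X' \<delta> \<delta>' Y x y Y' x' y' b c] assms unfolding extriangle_def by blast

lemma extriangle_cmp_zero:
  assumes T: "extriangle X Y Z x y \<delta>"
  shows "cmp C X Y Z y x = \<zero>\<^bsub>Hom C X Z\<^esub>"
proof -
  note t = extriangle_typed[OF T]
  obtain O' where O: "is_zero C O'" using ex_zero by blast
  then have O': "O' \<in> ob C" by (simp add: is_zero_def)
  have "idn C X \<in> mor C X X" "x \<in> mor C X Y" "cmp C X X Y x (idn C X) = cmp C X X Y x (idn C X)"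
    using t by simp_all
  from extriangle_complete_right[OF extriangle_id_left[OF O t(1)] T this]
  obtain c where "c \<in> mor C O' Z" "cmp C X O' Z c \<zero>\<^bsub>Hom C X O'\<^esub> = cmp C X Y Z y x" by blast
  then show ?thesis using cmp_zero_right t O' by metis
qed

lemma push_inflation_zero:
  assumes T: "extriangle X Y Z x y \<delta>"
  shows "push C Z X Y x \<delta> = \<zero>\<^bsub>Ext C Z Y\<^esub>"
proof -
  note t = extriangle_typed[OF T]
  obtain O' where O: "is_zero C O'" using ex_zero by blast
  then have O': "O' \<in> ob C" by (simp add: is_zero_def)
  have "x \<in> mor C X Y" "idn C Y \<in> mor C Y Y" "cmp C X Y Y (idn C Y) x = cmp C X Y Y (idn C Y) x"
    using t by simp_all
  from extriangle_complete_right[OF T extriangle_id_left[OF O t(2)] this]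
  obtain c where "c \<in> mor C Z O'" "push C Z X Y x \<delta> = pull C Z O' Y c \<zero>\<^bsub>Ext C O' Y\<^esub>" by blast
  then show ?thesis using t O' by simp
qed

lemma pull_deflation_zero:
  assumes T: "extriangle X Y Z x y \<delta>"
  shows "pull C Y Z X y \<delta> = \<zero>\<^bsub>Ext C Y X\<^esub>"
proof -
  note t = extriangle_typed[OF T]
  obtain O' where O: "is_zero C O'" using ex_zero by blast
  then have O': "O' \<in> ob C" by (simp add: is_zero_def)
  have "idn C Y \<in> mor C Y Y" "y \<in> mor C Y Z" "cmp C Y Y Z y (idn C Y) = cmp C Y Y Z y (idn C Y)"
    using t by simp_all
  from extriangle_complete_left[OF extriangle_id_right[OF O t(2)] T this]
  obtain a where "a \<in> mor C O' X" "push C Y O' X a \<zero>\<^bsub>Ext C Y O'\<^esub> = pull C Y Z X y \<delta>" by blast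
  then show ?thesis using t O' by simp
qed

lemma factor_through_inflation:
  assumes T: "extriangle X Y Z x y \<delta>" and W: "W \<in> ob C" "f \<in> mor C W Y"
    and yf: "cmp C W Y Z y f = \<zero>\<^bsub>Hom C W Z\<^esub>"
  obtains g where "g \<in> mor C W X" "f = cmp C W X Y x g"
proof -
  note t = extriangle_typed[OF T]
  obtain O' where O: "is_zero C O'" using ex_zero by blast
  then have O': "O' \<in> ob C" by (simp add: is_zero_def)
  have "f \<in> mor C W Y" "\<zero>\<^bsub>Hom C O' Z\<^esub> \<in> mor C O' Z" "cmp C W O' Z \<zero>\<^bsub>Hom C O' Z\<^esub> \<zero>\<^bsub>Hom C W O'\<^esub> = cmp C W Y Z y f"
    using t W O' yf by simp_all
  from extriangle_complete_left[OF extriangle_id_left[OF O W(1)] T this]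
  obtain a where a: "a \<in> mor C W X" "cmp C W W Y f (idn C W) = cmp C W X Y x a" by blast
  then show ?thesis using that t W by simp
qed

lemma factor_through_deflation:
  assumes T: "extriangle X Y Z x y \<delta>" and W: "W \<in> ob C" "f \<in> mor C Y W"
    and fx: "cmp C X Y W f x = \<zero>\<^bsub>Hom C X W\<^esub>"
  obtains g where "g \<in> mor C Z W" "f = cmp C Y Z W g y"
proof -
  note t = extriangle_typed[OF T]
  obtain O' where O: "is_zero C O'" using ex_zero by blast
  then have O': "O' \<in> ob C" by (simp add: is_zero_def)
  have "\<zero>\<^bsub>Hom C X O'\<^esub> \<in> mor C X O'" "f \<in> mor C Y W" "cmp C X Y W f x = cmp C X O' W \<zero>\<^bsub>Hom C O' W\<^esub> \<zero>\<^bsub>Hom C X O'\<^esub>"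
    using t W O' fx by simp_all
  from extriangle_complete_right[OF T extriangle_id_right[OF O W(1)] this]
  obtain c where "c \<in> mor C Z W" "cmp C Y Z W c y = cmp C Y W W (idn C W) f" by blast
  then show ?thesis using that t W by simp
qed

lemma lift_along_deflation:
  assumes T: "extriangle X Y Z x y \<delta>" and W: "W \<in> ob C" "c \<in> mor C W Z"
    and z: "pull C W Z X c \<delta> = \<zero>\<^bsub>Ext C W X\<^esub>"
  obtains u where "u \<in> mor C W Y" "c = cmp C W Y Z y u"
proof -
  note t = extriangle_typed[OF T]
  obtain O' where O: "is_zero C O'" using ex_zero by blast
  then have O': "O' \<in> ob C" by (simp add: is_zero_def)
  have "\<zero>\<^bsub>Hom C O' X\<^esub> \<in> mor C O' X" "c \<in> mor C W Z" "push C W O' X \<zero>\<^bsub>Hom C O' X\<^esub> \<zero>\<^bsub>Ext C W O'\<^esub> = pull C W Z X c \<delta>"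
    using t W O' z by simp_all
  from extriangle_complete[OF extriangle_id_right[OF O W(1)] T this]
  obtain b where "b \<in> mor C W Y" "cmp C W Y Z y b = cmp C W W Z c (idn C W)" by blast
  then show ?thesis using that t W by simp
qed

lemma extend_along_inflation:
  assumes T: "extriangle X Y Z x y \<delta>" and W: "W \<in> ob C" "a \<in> mor C X W"
    and z: "push C Z X W a \<delta> = \<zero>\<^bsub>Ext C Z W\<^esub>"
  obtains u where "u \<in> mor C Y W" "a = cmp C X Y W u x"
proof -
  note t = extriangle_typed[OF T]
  obtain O' where O: "is_zero C O'" using ex_zero by blast
  then have O': "O' \<in> ob C" by (simp add: is_zero_def)
  have "a \<in> mor C X W" "\<zero>\<^bsub>Hom C Z O'\<^esub> \<in> mor C Z O'" "push C Z X W a \<delta> = pull C Z O' W \<zero>\<^bsub>Hom C Z O'\<^esub> \<zero>\<^bsub>Ext C O' W\<^esub>"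
    using t W O' z by simp_all
  from extriangle_complete[OF T extriangle_id_left[OF O W(1)] this]
  obtain b where "b \<in> mor C Y W" "cmp C X Y W b x = cmp C X W W (idn C W) a" by blast
  then show ?thesis using that t W by simp
qed

text \<open>Exactness of \<open>Hom(W, Z) \<rightarrow> Ext(W, X) \<rightarrow> Ext(W, Y)\<close>.  A conflation realising \<open>\<epsilon>\<close> maps
  to the given one: \<open>x\<close> extends over its middle term because \<open>x\<^sub>* \<epsilon> = 0\<close>.\<close>

lemma Ext_class_from_pull:
  assumes T: "extriangle X Y Z x y \<delta>" and W: "W \<in> ob C" "\<epsilon> \<in> carrier (Ext C W X)"
    and z: "push C W X Y x \<epsilon> = \<zero>\<^bsub>Ext C W Y\<^esub>"
  obtains c where "c \<in> mor C W Z" "\<epsilon> = pull C W Z X c \<delta>"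
proof -
  note t = extriangle_typed[OF T]
  obtain V u v where S: "extriangle X V W u v \<epsilon>" using ex_extriangle W t by blast
  obtain s where s: "s \<in> mor C V Y" "x = cmp C X V Y s u"
    using extend_along_inflation[OF S t(2,4) z] by blast
  have "idn C X \<in> mor C X X" "s \<in> mor C V Y" "cmp C X V Y s u = cmp C X X Y x (idn C X)"
    using t s by simp_all
  from extriangle_complete_right[OF S T this]
  obtain c where "c \<in> mor C W Z" "push C W X X (idn C X) \<epsilon> = pull C W Z X c \<delta>" by blast
  then show ?thesis using that t W push_idn by auto
qed

text \<open>Exactness of \<open>Hom(X, W) \<rightarrow> Ext(Z, W) \<rightarrow> Ext(Y, W)\<close>, dually.\<close>

lemma Ext_class_from_push:
  assumes T: "extriangle X Y Z x y \<delta>" and W: "W \<in> ob C" "\<epsilon> \<in> carrier (Ext C Z W)"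
    and z: "pull C Y Z W y \<epsilon> = \<zero>\<^bsub>Ext C Y W\<^esub>"
  obtains a where "a \<in> mor C X W" "\<epsilon> = push C Z X W a \<delta>"
proof -
  note t = extriangle_typed[OF T]
  obtain V u v where S: "extriangle W V Z u v \<epsilon>" using ex_extriangle W t by blast
  obtain s where s: "s \<in> mor C Y V" "y = cmp C Y V Z v s"
    using lift_along_deflation[OF S t(2,5) z] by blast
  have "s \<in> mor C Y V" "idn C Z \<in> mor C Z Z" "cmp C Y Z Z (idn C Z) y = cmp C Y V Z v s"
    using t s by simp_all
  from extriangle_complete_left[OF T S this]
  obtain a where "a \<in> mor C X W" "push C Z X W a \<delta> = pull C Z Z W (idn C Z) \<epsilon>" by blast
  then show ?thesis using that t W pull_idn by auto
qed

text \<open>The same exactness properties for two morphisms that agree after composition or on a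
  class, rather than for one morphism that becomes zero.\<close>

lemma inflation_factor_diff:
  assumes T: "extriangle X Y Z x y \<delta>" and W: "W \<in> ob C" "f \<in> mor C W Y" "f' \<in> mor C W Y"
    and eq: "cmp C W Y Z y f = cmp C W Y Z y f'"
  shows "\<exists>g\<in>mor C W X. f = f' \<oplus>\<^bsub>Hom C W Y\<^esub> cmp C W X Y x g"
proof -
  note t = extriangle_typed[OF T]
  have "cmp C W Y Z y (f \<ominus>\<^bsub>Hom C W Y\<^esub> f') = \<zero>\<^bsub>Hom C W Z\<^esub>"
    using t W eq by (simp add: cmp_diff_right)
  then obtain g where "g \<in> mor C W X" "f \<ominus>\<^bsub>Hom C W Y\<^esub> f' = cmp C W X Y x g"
    using factor_through_inflation[OF T W(1)] t W by blast
  then show ?thesis using t W by (auto simp: diff_eq_iff)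
qed

lemma deflation_factor_diff:
  assumes T: "extriangle X Y Z x y \<delta>" and W: "W \<in> ob C" "f \<in> mor C Y W" "f' \<in> mor C Y W"
    and eq: "cmp C X Y W f x = cmp C X Y W f' x"
  shows "\<exists>g\<in>mor C Z W. f = f' \<oplus>\<^bsub>Hom C Y W\<^esub> cmp C Y Z W g y"
proof -
  note t = extriangle_typed[OF T]
  have "cmp C X Y W (f \<ominus>\<^bsub>Hom C Y W\<^esub> f') x = \<zero>\<^bsub>Hom C X W\<^esub>"
    using t W eq by (simp add: cmp_diff_left)
  then obtain g where "g \<in> mor C Z W" "f \<ominus>\<^bsub>Hom C Y W\<^esub> f' = cmp C Y Z W g y"
    using factor_through_deflation[OF T W(1)] t W by blast
  then show ?thesis using t W by (auto simp: diff_eq_iff)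
qed

lemma lift_diff:
  assumes T: "extriangle X Y Z x y \<delta>" and W: "W \<in> ob C" "c \<in> mor C W Z" "c' \<in> mor C W Z"
    and eq: "pull C W Z X c \<delta> = pull C W Z X c' \<delta>"
  shows "\<exists>u\<in>mor C W Y. c = c' \<oplus>\<^bsub>Hom C W Z\<^esub> cmp C W Y Z y u"
proof -
  note t = extriangle_typed[OF T]
  have "pull C W Z X (c \<ominus>\<^bsub>Hom C W Z\<^esub> c') \<delta> = \<zero>\<^bsub>Ext C W X\<^esub>"
    using pull_diff t W eq by blast
  then obtain u where "u \<in> mor C W Y" "c \<ominus>\<^bsub>Hom C W Z\<^esub> c' = cmp C W Y Z y u"
    using lift_along_deflation[OF T W(1)] t W by blast
  then show ?thesis using t W by (auto simp: diff_eq_iff)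
qed

lemma extend_diff:
  assumes T: "extriangle X Y Z x y \<delta>" and W: "W \<in> ob C" "a \<in> mor C X W" "a' \<in> mor C X W"
    and eq: "push C Z X W a \<delta> = push C Z X W a' \<delta>"
  shows "\<exists>u\<in>mor C Y W. a = a' \<oplus>\<^bsub>Hom C X W\<^esub> cmp C X Y W u x"
proof -
  note t = extriangle_typed[OF T]
  have "push C Z X W (a \<ominus>\<^bsub>Hom C X W\<^esub> a') \<delta> = \<zero>\<^bsub>Ext C Z W\<^esub>"
    using push_diff t W eq by blast
  then obtain u where "u \<in> mor C Y W" "a \<ominus>\<^bsub>Hom C X W\<^esub> a' = cmp C X Y W u x"
    using extend_along_inflation[OF T W(1)] t W by blast
  then show ?thesis using t W by (auto simp: diff_eq_iff)
qed

end

section \<open>Comparing two conflations\<close>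

context extriangulated_category
begin

text \<open>Schanuel's lemma.  Since \<open>Ext(R, N') = 0\<close>, the deflation \<open>y\<close> lifts along \<open>y'\<close>, which yields a
  morphism of conflations that is the identity on \<open>X\<close>.  Since \<open>Ext(R', N) = 0\<close>, also \<open>y'\<close> lifts along
  \<open>y\<close> and \<open>\<delta>\<close> is pushed forward from \<open>\<delta>'\<close>; these give the two homotopies.\<close>

lemma kernels_of_deflations_biprod:
  assumes T: "extriangle N R X k y \<delta>" and T': "extriangle N' R' X k' y' \<delta>'"
    and van: "Ext_vanishes C R N'" "Ext_vanishes C R' N"
    and B: "is_biprod C R N' M iR iN pR pN"
  shows "\<exists>i j p q. is_biprod C N R' M i j p q"
proof -
  note t = extriangle_typed[OF T] and t' = extriangle_typed[OF T']
  have "pull C R X N' y \<delta>' = \<zero>\<^bsub>Ext C R N'\<^esub>"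
    using van(1) pull_closed[of R X N' y \<delta>'] t t' by blast
  then obtain h where h: "h \<in> mor C R R'" "y = cmp C R R' X y' h"
    using lift_along_deflation[OF T' t(2,5)] by blast
  have "cmp C R X X (idn C X) y = cmp C R R' X y' h" using h(2) t by simp
  from extriangle_complete_left[OF T T' h(1) idn_mor[OF t(3)] this]
  obtain l where l: "l \<in> mor C N N'" "cmp C N R R' h k = cmp C N N' R' k' l"
      "push C X N N' l \<delta> = pull C X X N' (idn C X) \<delta>'"
    by blast
  have l\<delta>: "push C X N N' l \<delta> = \<delta>'" using l(3) pull_idn t t' by simp
  have y'\<delta>: "pull C R' X N y' \<delta> = \<zero>\<^bsub>Ext C R' N\<^esub>"
    using van(2) pull_closed[of R' X N y' \<delta>] t t' by blast
  obtain u where u: "u \<in> mor C R' R" "y' = cmp C R' R X y u"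
    using lift_along_deflation[OF T t'(2,5) y'\<delta>] by blast
  have "cmp C R' R' X y' (idn C R') = cmp C R' R' X y' (cmp C R' R R' h u)"
    using u(1) h(1) t t' cmp_assoc[of R' R R' X u h y', symmetric] u(2)[symmetric] h(2)[symmetric] by simp
  from inflation_factor_diff[OF T' t'(2) idn_mor[OF t'(2)] _ this]
  obtain v where v: "v \<in> mor C R' N'"
      "idn C R' = cmp C R' R R' h u \<oplus>\<^bsub>Hom C R' R'\<^esub> cmp C R' N' R' k' v"
    using t t' u(1) h(1) by blast
  obtain w where w: "w \<in> mor C N' N" "\<delta> = push C X N' N w \<delta>'"
    using Ext_class_from_push[OF T' t(1,6) y'\<delta>] by blast
  have "push C X N N (idn C N) \<delta> = push C X N N (cmp C N N' N w l) \<delta>"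
    using push_cmp[of X N N' N l w \<delta>] l(1) w(1) t t' push_idn[of X N \<delta>] l\<delta> w(2)[symmetric] by simp
  from extend_diff[OF T t(1) idn_mor[OF t(1)] _ this]
  obtain s where s: "s \<in> mor C R N" "idn C N = cmp C N N' N w l \<oplus>\<^bsub>Hom C N N\<^esub> cmp C N R N s k"
    using t t' l(1) w(1) by blast
  show ?thesis
  proof (rule homotopy_equivalence_biprod[OF t(1,2) t'(1,2) t(4) t'(4) h(1) l(1,2) u(1) v w(1) s _ _ B])
    show "\<exists>c\<in>mor C W N. a = cmp C W N R k c"
      if W: "W \<in> ob C" "a \<in> mor C W R" "b \<in> mor C W N'"
        and eq: "cmp C W R R' h a = cmp C W N' R' k' b" for W a b
    proof -
      have "cmp C W R X y a = cmp C W R' X y' (cmp C W R R' h a)"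
        using cmp_assoc[of W R R' X a h y'] h(1) h(2)[symmetric] t t' W by simp
      also have "\<dots> = cmp C W N' X (cmp C N' R' X y' k') b"
        unfolding eq using cmp_assoc[of W N' R' X b k' y'] t t' W by simp
      also have "\<dots> = \<zero>\<^bsub>Hom C W X\<^esub>"
        unfolding extriangle_cmp_zero[OF T'] using t t' W by simp
      finally show ?thesis using factor_through_inflation[OF T W(1,2)] by blast
    qed
    show "\<exists>c\<in>mor C R' W. q = cmp C N' R' W c k'"
      if W: "W \<in> ob C" "p \<in> mor C R W" "q \<in> mor C N' W"
        and eq: "cmp C N R W p k = cmp C N N' W q l" for W p q
    proof -
      have "push C X N' W q \<delta>' = push C X N W (cmp C N N' W q l) \<delta>"
        using push_cmp[of X N N' W l q \<delta>] l\<delta> t t' W l(1) by simp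
      also have "\<dots> = push C X R W p (push C X N R k \<delta>)"
        unfolding eq[symmetric] using push_cmp[of X N R W k p \<delta>] t t' W by simp
      also have "\<dots> = \<zero>\<^bsub>Ext C X W\<^esub>"
        unfolding push_inflation_zero[OF T] using t t' W by simp
      finally show ?thesis using extend_along_inflation[OF T' W(1,3)] by blast
    qed
  qed
qed

text \<open>Dually, \<open>Ext(N, L') = 0\<close> provides the chain map between the complexes \<open>L \<rightarrow> N\<close> and \<open>L' \<rightarrow> N'\<close>, and
  \<open>Ext(N', L) = 0\<close> the two homotopies.\<close>

lemma cokernels_of_inflations_biprod:
  assumes T: "extriangle X L N x m \<delta>" and T': "extriangle X L' N' x' m' \<delta>'"
    and van: "Ext_vanishes C N L'" "Ext_vanishes C N' L"
    and B: "is_biprod C N L' M iN iL pN pL"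
  shows "\<exists>i j p q. is_biprod C L N' M i j p q"
proof -
  note t = extriangle_typed[OF T] and t' = extriangle_typed[OF T']
  have "push C N X L' x' \<delta> = \<zero>\<^bsub>Ext C N L'\<^esub>"
    using van(1) push_closed[of N X L' x' \<delta>] t t' by blast
  then obtain l where l: "l \<in> mor C L L'" "x' = cmp C X L L' l x"
    using extend_along_inflation[OF T t'(2,4)] by blast
  have "cmp C X L L' l x = cmp C X X L' x' (idn C X)" using l(2) t t' by simp
  from extriangle_complete_right[OF T T' idn_mor[OF t(1)] l(1) this]
  obtain h where h: "h \<in> mor C N N'" "cmp C L N N' h m = cmp C L L' N' m' l"
      "push C N X X (idn C X) \<delta> = pull C N N' X h \<delta>'"
    by blast
  have h\<delta>: "pull C N N' X h \<delta>' = \<delta>" using h(3) push_idn t t' by simp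
  have x\<delta>': "push C N' X L x \<delta>' = \<zero>\<^bsub>Ext C N' L\<^esub>"
    using van(2) push_closed[of N' X L x \<delta>'] t t' by blast
  obtain w where w: "w \<in> mor C L' L" "x = cmp C X L' L w x'"
    using extend_along_inflation[OF T' t(2,4) x\<delta>'] by blast
  have "cmp C X L L (idn C L) x = cmp C X L L (cmp C L L' L w l) x"
    using w(1) l(1) t t' cmp_assoc[of X L L' L x l w] w(2)[symmetric] l(2)[symmetric] by simp
  from deflation_factor_diff[OF T t(2) idn_mor[OF t(2)] _ this]
  obtain s where s: "s \<in> mor C N L"
      "idn C L = cmp C L L' L w l \<oplus>\<^bsub>Hom C L L\<^esub> cmp C L N L s m"
    using t t' w(1) l(1) by blast
  obtain u where u: "u \<in> mor C N' N" "\<delta>' = pull C N' N X u \<delta>"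
    using Ext_class_from_pull[OF T t'(3,6) x\<delta>'] by blast
  have "pull C N' N' X (idn C N') \<delta>' = pull C N' N' X (cmp C N' N N' h u) \<delta>'"
    using pull_cmp[of N' N N' X u h \<delta>'] h(1) u(1) t t' pull_idn[of N' X \<delta>'] h\<delta> u(2)[symmetric] by simp
  from lift_diff[OF T' t'(3) idn_mor[OF t'(3)] _ this]
  obtain v where v: "v \<in> mor C N' L'"
      "idn C N' = cmp C N' N N' h u \<oplus>\<^bsub>Hom C N' N'\<^esub> cmp C N' L' N' m' v"
    using t t' h(1) u(1) by blast
  show ?thesis
  proof (rule homotopy_equivalence_biprod[OF t(2,3) t'(2,3) t(5) t'(5) h(1) l(1) h(2) u(1) v w(1) s _ _ B])
    show "\<exists>c\<in>mor C W L. a = cmp C W L N m c"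
      if W: "W \<in> ob C" "a \<in> mor C W N" "b \<in> mor C W L'"
        and eq: "cmp C W N N' h a = cmp C W L' N' m' b" for W a b
    proof -
      have "pull C W N X a \<delta> = pull C W N' X (cmp C W N N' h a) \<delta>'"
        using pull_cmp[of W N N' X a h \<delta>'] h\<delta> h(1) t t' W by simp
      also have "\<dots> = pull C W L' X b (pull C L' N' X m' \<delta>')"
        unfolding eq using pull_cmp[of W L' N' X b m' \<delta>'] t t' W by simp
      also have "\<dots> = \<zero>\<^bsub>Ext C W X\<^esub>"
        unfolding pull_deflation_zero[OF T'] using t t' W by simp
      finally show ?thesis using lift_along_deflation[OF T W(1,2)] by blast
    qed
    show "\<exists>c\<in>mor C N' W. q = cmp C L' N' W c m'"
      if W: "W \<in> ob C" "p \<in> mor C N W" "q \<in> mor C L' W"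
        and eq: "cmp C L N W p m = cmp C L L' W q l" for W p q
    proof -
      have "cmp C X L' W q x' = cmp C X L W (cmp C L L' W q l) x"
        using cmp_assoc[of X L L' W x l q] l(1) l(2)[symmetric] t t' W by simp
      also have "\<dots> = cmp C X N W p (cmp C X L N m x)"
        unfolding eq[symmetric] using cmp_assoc[of X L N W x m p] t t' W by simp
      also have "\<dots> = \<zero>\<^bsub>Hom C X W\<^esub>"
        unfolding extriangle_cmp_zero[OF T] using t t' W by simp
      finally show ?thesis using factor_through_deflation[OF T' W(1,3)] by blast
    qed
  qed
qed

text \<open>The step where rigidity enters: \<open>y a\<close> extends along \<open>k'\<close> since \<open>Ext(V, U) = 0\<close>, the extension
  lifts along \<open>y\<close> since \<open>Ext(R', N) = 0\<close>, and the resulting error is killed by \<open>y\<close>, so it factors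
  through \<open>k\<close>.\<close>

lemma rigid_presentation_factor:
  assumes T1: "extriangle N R U k y \<delta>" and T2: "extriangle N' R' V k' y' \<delta>'"
    and van: "Ext_vanishes C V U" "Ext_vanishes C R' N"
    and a: "a \<in> mor C N' R"
  shows "\<exists>h\<in>mor C R' R. \<exists>l\<in>mor C N' N.
    a = cmp C N' R' R h k' \<oplus>\<^bsub>Hom C N' R\<^esub> cmp C N' N R k l"
proof -
  note t = extriangle_typed[OF T1] and t' = extriangle_typed[OF T2]
  have ya: "cmp C N' R U y a \<in> mor C N' U" using t t' a by simp
  have "push C V N' U (cmp C N' R U y a) \<delta>' = \<zero>\<^bsub>Ext C V U\<^esub>"
    using van(1) push_closed[of V N' U _ \<delta>'] ya t t' by blast
  then obtain b where b: "b \<in> mor C R' U" "cmp C N' R U y a = cmp C N' R' U b k'"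
    using extend_along_inflation[OF T2 t(3) ya] by blast
  have "pull C R' U N b \<delta> = \<zero>\<^bsub>Ext C R' N\<^esub>"
    using van(2) pull_closed[of R' U N b \<delta>] b(1) t t' by blast
  then obtain h where h: "h \<in> mor C R' R" "b = cmp C R' R U y h"
    using lift_along_deflation[OF T1 t'(2) b(1)] by blast
  have "cmp C N' R U y a = cmp C N' R U y (cmp C N' R' R h k')"
    using b(2) h(2) cmp_assoc[of N' R' R U k' h y] h(1) t t' by simp
  from inflation_factor_diff[OF T1 t'(1) a _ this] show ?thesis using h(1) t t' by blast
qed

lemma rigid_copresentation_factor:
  assumes T1: "extriangle U L N x m \<delta>" and T2: "extriangle V L' N' x' m' \<delta>'"
    and van: "Ext_vanishes C U V" "Ext_vanishes C N L'"
    and a: "a \<in> mor C L N'"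
  shows "\<exists>h\<in>mor C L L'. \<exists>l\<in>mor C N N'.
    a = cmp C L L' N' m' h \<oplus>\<^bsub>Hom C L N'\<^esub> cmp C L N N' l m"
proof -
  note t = extriangle_typed[OF T1] and t' = extriangle_typed[OF T2]
  have ax: "cmp C U L N' a x \<in> mor C U N'" using t t' a by simp
  have "pull C U N' V (cmp C U L N' a x) \<delta>' = \<zero>\<^bsub>Ext C U V\<^esub>"
    using van(1) pull_closed[of U N' V _ \<delta>'] ax t t' by blast
  then obtain b where b: "b \<in> mor C U L'" "cmp C U L N' a x = cmp C U L' N' m' b"
    using lift_along_deflation[OF T2 t(1) ax] by blast
  have "push C N U L' b \<delta> = \<zero>\<^bsub>Ext C N L'\<^esub>"
    using van(2) push_closed[of N U L' b \<delta>] b(1) t t' by blast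
  then obtain h where h: "h \<in> mor C L L'" "b = cmp C U L L' h x"
    using extend_along_inflation[OF T1 t'(2) b(1)] by blast
  have "cmp C U L N' a x = cmp C U L N' (cmp C L L' N' m' h) x"
    using b(2) h(2) cmp_assoc[of U L L' N' x h m'] h(1) t t' by simp
  from deflation_factor_diff[OF T1 t'(3) a _ this] show ?thesis using h(1) t t' by blast
qed

end

section \<open>Cluster-tilting subcategories\<close>

context extriangulated_category
begin

lemma cluster_tilting_subset: "cluster_tilting C T \<Longrightarrow> T \<subseteq> ob C"
  unfolding cluster_tilting_def by blast

lemma cluster_tilting_rigid: "\<lbrakk>cluster_tilting C T; X \<in> T; Y \<in> T\<rbrakk> \<Longrightarrow> Ext_vanishes C X Y"
  unfolding cluster_tilting_def by blast

lemma cluster_tilting_memI: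
  "\<lbrakk>cluster_tilting C T; X \<in> ob C; \<And>T1. T1 \<in> T \<Longrightarrow> Ext_vanishes C T1 X\<rbrakk> \<Longrightarrow> X \<in> T"
  unfolding cluster_tilting_def by blast

lemma cluster_tilting_memI':
  "\<lbrakk>cluster_tilting C T; X \<in> ob C; \<And>T1. T1 \<in> T \<Longrightarrow> Ext_vanishes C X T1\<rbrakk> \<Longrightarrow> X \<in> T"
  unfolding cluster_tilting_def by blast

lemma Ext_vanishesI:
  "\<lbrakk>Z \<in> ob C; X \<in> ob C; \<And>\<epsilon>. \<epsilon> \<in> carrier (Ext C Z X) \<Longrightarrow> \<epsilon> = \<zero>\<^bsub>Ext C Z X\<^esub>\<rbrakk> \<Longrightarrow> Ext_vanishes C Z X"
  by blast

lemma cluster_tilting_biprod: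
  assumes T: "cluster_tilting C T" "X \<in> T" "Y \<in> T" and B: "is_biprod C X Y B i j p q"
  shows "B \<in> T"
proof -
  have ob: "X \<in> ob C" "Y \<in> ob C" "B \<in> ob C"
    and mor: "i \<in> mor C X B" "j \<in> mor C Y B" "p \<in> mor C B X" "q \<in> mor C B Y"
    and sum: "cmp C B X B i p \<oplus>\<^bsub>Hom C B B\<^esub> cmp C B Y B j q = idn C B"
    using B by (simp_all add: is_biprod_def)
  show ?thesis
  proof (rule cluster_tilting_memI[OF T(1) ob(3)])
    fix T1 assume "T1 \<in> T"
    then have T1: "T1 \<in> ob C" "Ext_vanishes C T1 X" "Ext_vanishes C T1 Y"
      using cluster_tilting_rigid[OF T(1)] cluster_tilting_subset[OF T(1)] T by blast+
    show "Ext_vanishes C T1 B"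
    proof (rule Ext_vanishesI[OF T1(1) ob(3)])
      fix \<epsilon> assume e: "\<epsilon> \<in> carrier (Ext C T1 B)"
      interpret E: abelian_group "Ext C T1 B" using Ext_vs[OF T1(1) ob(3)] vectorspace_abelian by blast
      have p0: "push C T1 B X p \<epsilon> = \<zero>\<^bsub>Ext C T1 X\<^esub>" and q0: "push C T1 B Y q \<epsilon> = \<zero>\<^bsub>Ext C T1 Y\<^esub>"
        using T1 push_closed[of T1 B _ _ \<epsilon>] ob mor e by blast+
      have "\<epsilon> = push C T1 B B (cmp C B X B i p \<oplus>\<^bsub>Hom C B B\<^esub> cmp C B Y B j q) \<epsilon>"
        unfolding sum using push_idn T1 ob e by simp
      also have "\<dots> = push C T1 B B (cmp C B X B i p) \<epsilon> \<oplus>\<^bsub>Ext C T1 B\<^esub> push C T1 B B (cmp C B Y B j q) \<epsilon>"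
        using module_hom_add[OF push_linear_mor[of T1 B B \<epsilon>]] T1 ob mor e by simp
      also have "\<dots> = \<zero>\<^bsub>Ext C T1 B\<^esub>"
        using push_cmp[of T1 B X B p i \<epsilon>] push_cmp[of T1 B Y B q j \<epsilon>] p0 q0 T1 ob mor e by simp
      finally show "\<epsilon> = \<zero>\<^bsub>Ext C T1 B\<^esub>" .
    qed
  qed
qed

text \<open>The kernel term of a right approximation that is a deflation lies in \<open>T\<close> again (Wakamatsu's lemma): a class in
  \<open>Ext(T1, N)\<close> dies in \<open>Ext(T1, R) = 0\<close>, so it comes from a morphism \<open>T1 \<rightarrow> X\<close>, which factors through the
  approximation and therefore pulls \<open>\<delta>\<close> back to zero.\<close>

lemma ex_presentation:
  assumes T: "cluster_tilting C T" and X: "X \<in> ob C"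
  obtains N R k y \<delta> where "N \<in> T" "R \<in> T" "extriangle N R X k y \<delta>"
proof -
  obtain R y where R: "right_approx C T R X y" "deflation C R X y"
    using T X unfolding cluster_tilting_def by blast
  then obtain N k \<delta> where S: "extriangle N R X k y \<delta>"
    by (auto simp only: deflation_def conflation_extriangle)
  note t = extriangle_typed[OF S]
  have "R \<in> T" using R(1) unfolding right_approx_def by blast
  moreover have "N \<in> T"
  proof (rule cluster_tilting_memI[OF T t(1)])
    fix T1 assume T1T: "T1 \<in> T"
    then have T1: "T1 \<in> ob C" "Ext_vanishes C T1 R"
      using cluster_tilting_rigid[OF T] cluster_tilting_subset[OF T] \<open>R \<in> T\<close> by blast+
    show "Ext_vanishes C T1 N"
    proof (rule Ext_vanishesI[OF T1(1) t(1)])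
      fix \<epsilon> assume e: "\<epsilon> \<in> carrier (Ext C T1 N)"
      have "push C T1 N R k \<epsilon> = \<zero>\<^bsub>Ext C T1 R\<^esub>"
        using T1 push_closed[of T1 N R k \<epsilon>] t e by blast
      then obtain c where c: "c \<in> mor C T1 X" "\<epsilon> = pull C T1 X N c \<delta>"
        using Ext_class_from_pull[OF S T1(1) e] by blast
      obtain u where u: "u \<in> mor C T1 R" "c = cmp C T1 R X y u"
        using R(1) T1T c(1) unfolding right_approx_def by blast
      show "\<epsilon> = \<zero>\<^bsub>Ext C T1 N\<^esub>"
        using pull_cmp[of T1 R X N u y \<delta>] u c(2) t T1 pull_deflation_zero[OF S] by simp
    qed
  qed
  ultimately show thesis using that S by blast
qed

lemma ex_copresentation:
  assumes T: "cluster_tilting C T" and X: "X \<in> ob C"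
  obtains L N x m \<delta> where "L \<in> T" "N \<in> T" "extriangle X L N x m \<delta>"
proof -
  obtain L x where L: "left_approx C T X L x" "inflation C X L x"
    using T X unfolding cluster_tilting_def by blast
  then obtain N m \<delta> where S: "extriangle X L N x m \<delta>"
    by (auto simp only: inflation_def conflation_extriangle)
  note t = extriangle_typed[OF S]
  have "L \<in> T" using L(1) unfolding left_approx_def by blast
  moreover have "N \<in> T"
  proof (rule cluster_tilting_memI'[OF T t(3)])
    fix T1 assume T1T: "T1 \<in> T"
    then have T1: "T1 \<in> ob C" "Ext_vanishes C L T1"
      using cluster_tilting_rigid[OF T] cluster_tilting_subset[OF T] \<open>L \<in> T\<close> by blast+
    show "Ext_vanishes C N T1"
    proof (rule Ext_vanishesI[OF t(3) T1(1)])
      fix \<epsilon> assume e: "\<epsilon> \<in> carrier (Ext C N T1)"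
      have "pull C L N T1 m \<epsilon> = \<zero>\<^bsub>Ext C L T1\<^esub>"
        using T1 pull_closed[of L N T1 m \<epsilon>] t e by blast
      then obtain a where a: "a \<in> mor C X T1" "\<epsilon> = push C N X T1 a \<delta>"
        using Ext_class_from_push[OF S T1(1) e] by blast
      obtain u where u: "u \<in> mor C L T1" "a = cmp C X L T1 u x"
        using L(1) T1T a(1) unfolding left_approx_def by blast
      show "\<epsilon> = \<zero>\<^bsub>Ext C N T1\<^esub>"
        using push_cmp[of N X L T1 x u \<delta>] u a(2) t T1 push_inflation_zero[OF S] by simp
    qed
  qed
  ultimately show thesis using that S by blast
qed

lemma extriangle_biprod:
  assumes S: "extriangle X Y Z x y \<delta>" and S': "extriangle X' Y' Z' x' y' \<delta>'"
    and BX: "is_biprod C X X' BX iX jX pX qX" and BY: "is_biprod C Y Y' BY iY jY pY qY"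
    and BZ: "is_biprod C Z Z' BZ iZ jZ pZ qZ"
  shows "\<exists>x'' y'' \<delta>''. extriangle BX BY BZ x'' y'' \<delta>''"
proof -
  note t = extriangle_typed[OF S] and t' = extriangle_typed[OF S']
  have o: "BX \<in> ob C" "BZ \<in> ob C" "iX \<in> mor C X BX" "jX \<in> mor C X' BX" "pZ \<in> mor C BZ Z" "qZ \<in> mor C BZ Z'"
    using BX BZ by (simp_all add: is_biprod_def)
  interpret E: abelian_group "Ext C BZ BX" using Ext_vs[OF o(2,1)] vectorspace_abelian by blast
  have "push C BZ X BX iX (pull C BZ Z X pZ \<delta>) \<oplus>\<^bsub>Ext C BZ BX\<^esub>
      push C BZ X' BX jX (pull C BZ Z' X' qZ \<delta>') \<in> carrier (Ext C BZ BX)"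
    using o t t' by simp
  then show ?thesis
    using rlz_sum[OF t(6) t'(6) _ _ BX BY BZ] S S' o unfolding extriangle_def by blast
qed

end

section \<open>Dimensions along exact sequences\<close>

lemma linear_mapI:
  "\<lbrakk>vectorspace K V; vectorspace K W; f \<in> module_hom K V W\<rbrakk> \<Longrightarrow> linear_map K V W f"
  by (simp add: linear_map_def mod_hom_def mod_hom_axioms_def vectorspace_def)

lemma (in vectorspace) subspace_dim_le:
  assumes fd: "fin_dim" and W: "subspace K W V" and fdW: "vectorspace.fin_dim K (vs W)"
  shows "vectorspace.dim K (vs W) \<le> dim"
proof -
  interpret W: vectorspace K "vs W" using W by (rule subspace_is_vs)
  have sub: "submodule K W V" using W by (simp add: subspace_def)
  obtain B where B: "finite B" "W.basis B" using W.finite_basis_exists[OF fdW] by blast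
  then have "B \<subseteq> W" "W.lin_indpt B" by (simp_all add: W.basis_def)
  then have "lin_indpt B" using span_li_not_depend(2)[OF \<open>B \<subseteq> W\<close> sub] by simp
  moreover have "B \<subseteq> carrier V" using \<open>B \<subseteq> W\<close> sub by (auto simp: submodule_def)
  ultimately show ?thesis using li_le_dim(2)[OF fd] W.dim_basis[OF B] by simp
qed

lemma dim_le_of_inj:
  assumes V: "vectorspace K V" and W: "vectorspace K W" and f: "f \<in> module_hom K V W"
    and fdV: "vectorspace.fin_dim K V" and fdW: "vectorspace.fin_dim K W"
    and inj: "inj_on f (carrier V)"
  shows "vectorspace.dim K V \<le> vectorspace.dim K W"
proof -
  interpret L: linear_map K V W f using linear_mapI[OF V W f] .
  have "vectorspace.dim K V = vectorspace.dim K (W\<lparr>carrier := L.imT\<rparr>)"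
    using L.rank_nullity[OF fdV] L.inj_imp_dim_ker0[OF inj] by simp
  also have "\<dots> \<le> vectorspace.dim K W"
  proof (rule L.W.subspace_dim_le[OF fdW L.imT_is_subspace])
    have im: "vectorspace K (W\<lparr>carrier := L.imT\<rparr>)" using L.W.subspace_is_vs[OF L.imT_is_subspace] .
    have "f \<in> module_hom K V (W\<lparr>carrier := L.imT\<rparr>)"
      using f by (auto simp: module_hom_def L.im_def)
    then interpret L': linear_map K V "W\<lparr>carrier := L.imT\<rparr>" f using linear_mapI[OF V im] by blast
    show "vectorspace.fin_dim K (W\<lparr>carrier := L.imT\<rparr>)"
      by (rule L'.surj_fin_dim[OF fdV]) (simp add: L.im_def)
  qed
  finally show ?thesis .
qed

lemma dim_le_of_surj:
  assumes V: "vectorspace K V" and W: "vectorspace K W" and f: "f \<in> module_hom K V W"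
    and fdV: "vectorspace.fin_dim K V" and surj: "f ` carrier V = carrier W"
  shows "vectorspace.dim K W \<le> vectorspace.dim K V"
proof -
  interpret L: linear_map K V W f using linear_mapI[OF V W f] .
  show ?thesis using L.rank_nullity[OF fdV] L.surj_imp_imT_carrier[OF surj] by simp
qed

lemma dim_short_exact:
  assumes V: "vectorspace K V" and W: "vectorspace K W" and U: "vectorspace K U"
    and a: "a \<in> module_hom K V W" and b: "b \<in> module_hom K W U"
    and fdV: "vectorspace.fin_dim K V" and fdW: "vectorspace.fin_dim K W"
    and inj: "inj_on a (carrier V)"
    and ex: "a ` carrier V = {w \<in> carrier W. b w = \<zero>\<^bsub>U\<^esub>}"
    and surj: "b ` carrier W = carrier U"
  shows "vectorspace.dim K W = vectorspace.dim K V + vectorspace.dim K U"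
proof -
  interpret A: linear_map K V W a using linear_mapI[OF V W a] .
  interpret B: linear_map K W U b using linear_mapI[OF W U b] .
  have ker: "B.kerT = A.imT" using ex by (simp add: A.im_def B.ker_def)
  have "vectorspace.dim K V = vectorspace.dim K (W\<lparr>carrier := A.imT\<rparr>)"
    using A.rank_nullity[OF fdV] A.inj_imp_dim_ker0[OF inj] by simp
  moreover have "vectorspace.dim K U + vectorspace.dim K (W\<lparr>carrier := B.kerT\<rparr>) = vectorspace.dim K W"
    using B.rank_nullity[OF fdW] B.surj_imp_imT_carrier[OF surj] by simp
  ultimately show ?thesis by (simp add: ker)
qed

section \<open>Modules over a subcategory\<close>

lemma tmod_vectorspace: "\<lbrakk>is_tmod K C T M; X \<in> T\<rbrakk> \<Longrightarrow> vectorspace K (Mob M X)"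
  by (simp add: is_tmod_def)

lemma tmod_mor_hom:
  "\<lbrakk>is_tmod K C T M; X \<in> T; Y \<in> T; f \<in> mor C X Y\<rbrakk> \<Longrightarrow>
    Mmor M X Y f \<in> module_hom K (Mob M Y) (Mob M X)"
  by (simp add: is_tmod_def)

lemma tmod_eval_hom:
  "\<lbrakk>is_tmod K C T M; X \<in> T; Y \<in> T; v \<in> carrier (Mob M Y)\<rbrakk> \<Longrightarrow>
    (\<lambda>f. Mmor M X Y f v) \<in> module_hom K (Hom C X Y) (Mob M X)"
  by (simp add: is_tmod_def)

lemma tmod_idn:
  "\<lbrakk>is_tmod K C T M; X \<in> T; v \<in> carrier (Mob M X)\<rbrakk> \<Longrightarrow> Mmor M X X (idn C X) v = v"
  by (simp add: is_tmod_def)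

lemma tmod_cmp:
  "\<lbrakk>is_tmod K C T M; X \<in> T; Y \<in> T; Z \<in> T; f \<in> mor C X Y; g \<in> mor C Y Z; v \<in> carrier (Mob M Z)\<rbrakk> \<Longrightarrow>
    Mmor M X Z (cmp C X Y Z g f) v = Mmor M X Y f (Mmor M Y Z g v)"
  by (simp add: is_tmod_def)

lemma tmod_mor_closed:
  "\<lbrakk>is_tmod K C T M; X \<in> T; Y \<in> T; f \<in> mor C X Y; v \<in> carrier (Mob M Y)\<rbrakk> \<Longrightarrow>
    Mmor M X Y f v \<in> carrier (Mob M X)"
  using tmod_mor_hom[of K C T M X Y f] by (auto simp: module_hom_def)

context linear_category
begin

text \<open>The module turns a biproduct into the short exact sequence \<open>M(X) \<rightarrow> M(B) \<rightarrow> M(Y)\<close> given by the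
  projection \<open>p\<close> and the inclusion \<open>j\<close>.\<close>

lemma tmod_biprod_dim:
  assumes M: "M \<in> lfd K C T" and T: "T \<subseteq> ob C" "X \<in> T" "Y \<in> T" "B \<in> T"
    and B: "is_biprod C X Y B i j p q"
  shows "vectorspace.dim K (Mob M B) = vectorspace.dim K (Mob M X) + vectorspace.dim K (Mob M Y)"
proof -
  have m: "is_tmod K C T M" and fd: "\<And>X. X \<in> T \<Longrightarrow> vectorspace.fin_dim K (Mob M X)"
    using M by (simp_all add: lfd_def)
  have mor: "i \<in> mor C X B" "j \<in> mor C Y B" "p \<in> mor C B X" "q \<in> mor C B Y"
    and id: "cmp C X B X p i = idn C X" "cmp C Y B Y q j = idn C Y" "cmp C Y B X p j = \<zero>\<^bsub>Hom C Y X\<^esub>"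
    and sum: "cmp C B X B i p \<oplus>\<^bsub>Hom C B B\<^esub> cmp C B Y B j q = idn C B"
    using B by (simp_all add: is_biprod_def)
  note vs = tmod_vectorspace[OF m]
  have zero: "Mmor M Y X \<zero>\<^bsub>Hom C Y X\<^esub> v = \<zero>\<^bsub>Mob M Y\<^esub>" if "v \<in> carrier (Mob M X)" for v
  proof -
    interpret L: linear_map K "Hom C Y X" "Mob M Y" "\<lambda>f. Mmor M Y X f v"
      using linear_mapI[OF Hom_vs vs tmod_eval_hom[OF m]] T that by blast
    show ?thesis by (rule L.T0_is_0)
  qed
  have ip: "Mmor M X B i (Mmor M B X p v) = v" if "v \<in> carrier (Mob M X)" for v
    using tmod_cmp[OF m T(2,4,2) mor(1,3) that] id(1) tmod_idn[OF m T(2) that] by simp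
  have jq: "Mmor M Y B j (Mmor M B Y q v) = v" if "v \<in> carrier (Mob M Y)" for v
    using tmod_cmp[OF m T(3,4,3) mor(2,4) that] id(2) tmod_idn[OF m T(3) that] by simp
  have jp: "Mmor M Y B j (Mmor M B X p v) = \<zero>\<^bsub>Mob M Y\<^esub>" if "v \<in> carrier (Mob M X)" for v
    using tmod_cmp[OF m T(3,4,2) mor(2,3) that] id(3) zero[OF that] by simp
  have dec: "w = Mmor M B X p (Mmor M X B i w)"
    if w: "w \<in> carrier (Mob M B)" and 0: "Mmor M Y B j w = \<zero>\<^bsub>Mob M Y\<^esub>" for w
  proof -
    interpret V: abelian_group "Mob M B" using vs[OF T(4)] by (simp add: vectorspace_def module_def)
    interpret Q: linear_map K "Mob M Y" "Mob M B" "Mmor M B Y q"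
      using linear_mapI[OF vs[OF T(3)] vs[OF T(4)] tmod_mor_hom[OF m T(4,3) mor(4)]] .
    have "w = Mmor M B B (cmp C B X B i p \<oplus>\<^bsub>Hom C B B\<^esub> cmp C B Y B j q) w"
      unfolding sum using tmod_idn[OF m T(4) w] by simp
    also have "\<dots> = Mmor M B B (cmp C B X B i p) w \<oplus>\<^bsub>Mob M B\<^esub> Mmor M B B (cmp C B Y B j q) w"
    proof (rule module_hom_add[OF tmod_eval_hom[OF m T(4,4) w]])
      show "cmp C B X B i p \<in> mor C B B" "cmp C B Y B j q \<in> mor C B B"
        using T mor by (meson cmp_mor subsetD)+
    qed
    also have "\<dots> = Mmor M B X p (Mmor M X B i w) \<oplus>\<^bsub>Mob M B\<^esub> Mmor M B Y q (Mmor M Y B j w)"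
      using tmod_cmp[OF m T(4,2,4) mor(3,1) w] tmod_cmp[OF m T(4,3,4) mor(4,2) w] by simp
    also have "\<dots> = Mmor M B X p (Mmor M X B i w)"
      unfolding 0 using tmod_mor_closed[OF m] T mor w by simp
    finally show ?thesis .
  qed
  show ?thesis
  proof (rule dim_short_exact[OF vs[OF T(2)] vs[OF T(4)] vs[OF T(3)]
        tmod_mor_hom[OF m T(4,2) mor(3)] tmod_mor_hom[OF m T(3,4) mor(2)] fd[OF T(2)] fd[OF T(4)]])
    show "inj_on (Mmor M B X p) (carrier (Mob M X))"
      by (rule inj_on_inverseI[of _ "Mmor M X B i"]) (rule ip)
    show "Mmor M B X p ` carrier (Mob M X) =
        {w \<in> carrier (Mob M B). Mmor M Y B j w = \<zero>\<^bsub>Mob M Y\<^esub>}"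
    proof (intro equalityI subsetI)
      fix w assume "w \<in> Mmor M B X p ` carrier (Mob M X)"
      then show "w \<in> {w \<in> carrier (Mob M B). Mmor M Y B j w = \<zero>\<^bsub>Mob M Y\<^esub>}"
        using jp tmod_mor_closed[OF m T(4,2) mor(3)] by blast
    next
      fix w assume "w \<in> {w \<in> carrier (Mob M B). Mmor M Y B j w = \<zero>\<^bsub>Mob M Y\<^esub>}"
      then show "w \<in> Mmor M B X p ` carrier (Mob M X)"
        using dec tmod_mor_closed[OF m T(2,4) mor(1)] by blast
    qed
    show "Mmor M Y B j ` carrier (Mob M B) = carrier (Mob M Y)"
    proof (intro equalityI subsetI)
      fix w assume "w \<in> Mmor M Y B j ` carrier (Mob M B)"
      then show "w \<in> carrier (Mob M Y)" using tmod_mor_closed[OF m T(3,4) mor(2)] by blast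
    next
      fix w assume w: "w \<in> carrier (Mob M Y)"
      then show "w \<in> Mmor M Y B j ` carrier (Mob M B)"
        using jq[OF w, symmetric] tmod_mor_closed[OF m T(4,3) mor(4) w] by blast
    qed
  qed
qed

text \<open>The elements of the form \<open>M(a) \<xi>\<close> make up a submodule, which is nonzero as it contains \<open>\<xi>\<close>.\<close>

lemma simple_tmod_generated:
  assumes S: "is_simple_tmod K C T M" and T: "T \<subseteq> ob C" "Q \<in> T" "P \<in> T"
    and \<xi>: "\<xi> \<in> carrier (Mob M Q)" "\<xi> \<noteq> \<zero>\<^bsub>Mob M Q\<^esub>" and \<eta>: "\<eta> \<in> carrier (Mob M P)"
  shows "\<exists>a\<in>mor C P Q. \<eta> = Mmor M P Q a \<xi>"
proof -
  have m: "is_tmod K C T M" using S by (simp add: is_simple_tmod_def)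
  \<comment> \<open>the submodule generated by \<open>\<xi>\<close>\<close>
  define N where "N X = (\<lambda>a. Mmor M X Q a \<xi>) ` mor C X Q" for X
  have sub: "subspace K (N X) (Mob M X)" if X: "X \<in> T" for X
  proof -
    interpret L: linear_map K "Hom C X Q" "Mob M X" "\<lambda>a. Mmor M X Q a \<xi>"
      using linear_mapI[OF Hom_vs tmod_vectorspace[OF m X] tmod_eval_hom[OF m X T(2) \<xi>(1)]] X T by blast
    show ?thesis using L.imT_is_subspace by (simp add: L.im_def N_def)
  qed
  have stable: "Mmor M X Y f v \<in> N X" if XY: "X \<in> T" "Y \<in> T" and f: "f \<in> mor C X Y" and v: "v \<in> N Y" for X Y f v
  proof -
    obtain a where a: "a \<in> mor C Y Q" "v = Mmor M Y Q a \<xi>" using v unfolding N_def by blast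
    have "cmp C X Y Q a f \<in> mor C X Q"
      using XY f a(1) T by (meson cmp_mor subsetD)
    moreover have "Mmor M X Y f v = Mmor M X Q (cmp C X Y Q a f) \<xi>"
      using tmod_cmp[OF m XY T(2) f a(1) \<xi>(1)] a(2) by simp
    ultimately show ?thesis by (simp add: N_def)
  qed
  have "(\<forall>X\<in>T. N X = {\<zero>\<^bsub>Mob M X\<^esub>}) \<or> (\<forall>X\<in>T. N X = carrier (Mob M X))"
    using S sub stable unfolding is_simple_tmod_def by blast
  moreover have "\<xi> \<in> N Q"
    unfolding N_def using tmod_idn[OF m T(2) \<xi>(1)] idn_mor[of Q] T by (intro image_eqI[of _ _ "idn C Q"]) auto
  ultimately have "N P = carrier (Mob M P)" using \<xi>(2) T by auto
  then show ?thesis using \<eta> by (auto simp: N_def)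
qed

text \<open>If both inequalities fail, some \<open>\<xi> \<noteq> 0\<close> is killed by \<open>M(u)\<close> and some \<open>\<eta>\<close> is not in the image of
  \<open>M(v)\<close>.  Simplicity gives \<open>\<eta> = M(a) \<xi>\<close>, and the decomposition of \<open>a\<close> puts \<open>\<eta>\<close> into the image of \<open>M(v)\<close>.\<close>

lemma simple_tmod_opposite_dims:
  assumes S: "is_simple_tmod K C T M" and M: "M \<in> lfd K C T" and T: "T \<subseteq> ob C"
    and ob: "P1 \<in> T" "Q1 \<in> T" "P2 \<in> T" "Q2 \<in> T"
    and u: "u \<in> mor C P1 Q1" and v: "v \<in> mor C P2 Q2"
    and factor: "\<And>a. a \<in> mor C P2 Q1 \<Longrightarrow> \<exists>h\<in>mor C Q2 Q1. \<exists>l\<in>mor C P2 P1.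
      a = cmp C P2 Q2 Q1 h v \<oplus>\<^bsub>Hom C P2 Q1\<^esub> cmp C P2 P1 Q1 u l"
  shows "vectorspace.dim K (Mob M Q1) \<le> vectorspace.dim K (Mob M P1) \<or>
    vectorspace.dim K (Mob M P2) \<le> vectorspace.dim K (Mob M Q2)"
proof (rule ccontr)
  assume neg: "\<not> ?thesis"
  have m: "is_tmod K C T M" and fd: "\<And>X. X \<in> T \<Longrightarrow> vectorspace.fin_dim K (Mob M X)"
    using M by (simp_all add: lfd_def)
  note vs = tmod_vectorspace[OF m] and hom = tmod_mor_hom[OF m]
  interpret U: linear_map K "Mob M Q1" "Mob M P1" "Mmor M P1 Q1 u"
    using linear_mapI[OF vs vs hom] ob u by blast
  have "\<not> inj_on (Mmor M P1 Q1 u) (carrier (Mob M Q1))"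
    using dim_le_of_inj[OF vs vs hom fd fd] ob u neg by blast
  then have "U.kerT \<noteq> {\<zero>\<^bsub>Mob M Q1\<^esub>}" using U.Ke0_imp_inj by auto
  then obtain \<xi> where \<xi>: "\<xi> \<in> carrier (Mob M Q1)" "\<xi> \<noteq> \<zero>\<^bsub>Mob M Q1\<^esub>"
      and u\<xi>: "Mmor M P1 Q1 u \<xi> = \<zero>\<^bsub>Mob M P1\<^esub>"
    using U.kerT_is_subspace by (auto simp: U.ker_def subspace_def submodule_def)
  have "Mmor M P2 Q2 v ` carrier (Mob M Q2) \<noteq> carrier (Mob M P2)"
    using dim_le_of_surj[OF vs vs hom fd] ob v neg by blast
  moreover have "Mmor M P2 Q2 v ` carrier (Mob M Q2) \<subseteq> carrier (Mob M P2)"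
    using tmod_mor_closed[OF m] ob v by blast
  ultimately obtain \<eta> where \<eta>: "\<eta> \<in> carrier (Mob M P2)" "\<eta> \<notin> Mmor M P2 Q2 v ` carrier (Mob M Q2)"
    by blast
  obtain a where a: "a \<in> mor C P2 Q1" "\<eta> = Mmor M P2 Q1 a \<xi>"
    using simple_tmod_generated[OF S T ob(2,3) \<xi> \<eta>(1)] by blast
  obtain h l where h: "h \<in> mor C Q2 Q1" and l: "l \<in> mor C P2 P1"
    and eq: "a = cmp C P2 Q2 Q1 h v \<oplus>\<^bsub>Hom C P2 Q1\<^esub> cmp C P2 P1 Q1 u l"
    using factor[OF a(1)] by blast
  interpret L: linear_map K "Mob M P1" "Mob M P2" "Mmor M P2 P1 l"
    using linear_mapI[OF vs vs hom] ob l by blast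
  have hv: "cmp C P2 Q2 Q1 h v \<in> mor C P2 Q1" and ul: "cmp C P2 P1 Q1 u l \<in> mor C P2 Q1"
    using T ob h l u v by (meson cmp_mor subsetD)+
  have h\<xi>: "Mmor M Q2 Q1 h \<xi> \<in> carrier (Mob M Q2)"
    using tmod_mor_closed[OF m ob(4,2) h \<xi>(1)] .
  have "\<eta> = Mmor M P2 Q1 (cmp C P2 Q2 Q1 h v) \<xi> \<oplus>\<^bsub>Mob M P2\<^esub> Mmor M P2 Q1 (cmp C P2 P1 Q1 u l) \<xi>"
    unfolding a(2) eq by (rule module_hom_add[OF tmod_eval_hom[OF m ob(3,2) \<xi>(1)] hv ul])
  also have "\<dots> = Mmor M P2 Q2 v (Mmor M Q2 Q1 h \<xi>) \<oplus>\<^bsub>Mob M P2\<^esub> Mmor M P2 P1 l \<zero>\<^bsub>Mob M P1\<^esub>"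
    using tmod_cmp[OF m ob(3,4,2) v h \<xi>(1)] tmod_cmp[OF m ob(3,1,2) l u \<xi>(1)] u\<xi> by simp
  also have "\<dots> = Mmor M P2 Q2 v (Mmor M Q2 Q1 h \<xi>)"
    using tmod_mor_closed[OF m ob(3,4) v h\<xi>] by simp
  finally show False using \<eta>(2) h\<xi> by blast
qed

end

section \<open>Grothendieck groups and the pairing\<close>

lemma pair_formal_superset:
  assumes "finite A" "Poly_Mapping.keys a \<subseteq> A" "finite B" "Poly_Mapping.keys b \<subseteq> B"
  shows "pair_formal K a b = (\<Sum>M\<in>A. \<Sum>X\<in>B.
    Poly_Mapping.lookup a M * Poly_Mapping.lookup b X * int (vectorspace.dim K (Mob M X)))"
proof -
  have "(\<Sum>X\<in>Poly_Mapping.keys b. Poly_Mapping.lookup a M * Poly_Mapping.lookup b X * int (vectorspace.dim K (Mob M X)))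
      = (\<Sum>X\<in>B. Poly_Mapping.lookup a M * Poly_Mapping.lookup b X * int (vectorspace.dim K (Mob M X)))" for M
    by (rule sum.mono_neutral_left[OF assms(3,4)]) (simp add: in_keys_iff)
  then show ?thesis
    unfolding pair_formal_def
    by (simp, intro sum.mono_neutral_left[OF assms(1,2)]) (simp add: in_keys_iff)
qed

lemma pair_formal_diff_left: "pair_formal K (a - a') b = pair_formal K a b - pair_formal K a' b"
proof -
  let ?A = "Poly_Mapping.keys a \<union> Poly_Mapping.keys a'"
  have "Poly_Mapping.keys (a - a') \<subseteq> ?A" by (rule keys_diff)
  then show ?thesis
    by (simp add: pair_formal_superset[of ?A _ "Poly_Mapping.keys b"] lookup_minus
        left_diff_distrib sum_subtractf)
qed

lemma pair_formal_diff_right: "pair_formal K a (b - b') = pair_formal K a b - pair_formal K a b'"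
proof -
  let ?B = "Poly_Mapping.keys b \<union> Poly_Mapping.keys b'"
  have "Poly_Mapping.keys (b - b') \<subseteq> ?B" by (rule keys_diff)
  then show ?thesis
    by (simp add: pair_formal_superset[of "Poly_Mapping.keys a" _ ?B] lookup_minus
        left_diff_distrib right_diff_distrib sum_subtractf)
qed

lemma pair_formal_frag [simp]:
  "pair_formal K (frag_of M) (frag_of X) = int (vectorspace.dim K (Mob M X))"
  by (simp add: pair_formal_def)

lemma pair_formal_zero [simp]: "pair_formal K 0 b = 0" "pair_formal K a 0 = 0"
  by (simp_all add: pair_formal_def)

lemma pair_formal_add_left: "pair_formal K (a + a') b = pair_formal K a b + pair_formal K a' b"
  using pair_formal_diff_left[of K "a + a'" a' b] by simp

lemma pair_formal_add_right: "pair_formal K a (b + b') = pair_formal K a b + pair_formal K a b'"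
  using pair_formal_diff_right[of K a "b + b'" b'] by simp

lemma generate_free_Abelian_group_zero:
  fixes f :: "('a \<Rightarrow>\<^sub>0 int) \<Rightarrow> int"
  assumes r: "r \<in> generate (free_Abelian_group A) S" and S: "S \<subseteq> carrier (free_Abelian_group A)"
    and add: "\<And>x y. f (x + y) = f x + f y" and zero: "\<And>s. s \<in> S \<Longrightarrow> f s = 0"
  shows "f r = 0"
  using r
proof induction
  case one
  then show ?case using add[of 0 0] by simp
next
  case (incl h)
  then show ?case by (rule zero)
next
  case (inv h)
  then show ?case using S zero add[of h "- h"] add[of 0 0] by auto
next
  case (eng h1 h2)
  then show ?case by (simp add: add)
qed

definition split_generators :: "('o, 'm, 'k, 'z) lincat_scheme \<Rightarrow> 'o set \<Rightarrow> ('o \<Rightarrow>\<^sub>0 int) set" where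
  "split_generators C T = {frag_of B - frag_of X - frag_of Y | X Y B.
     X \<in> T \<and> Y \<in> T \<and> B \<in> T \<and> (\<exists>i j p q. is_biprod C X Y B i j p q)}"

lemma split_relations_generate:
  "split_relations C T = generate (free_Abelian_group T) (split_generators C T)"
  by (simp add: split_relations_def split_generators_def)

lemma additivity_relation_in_free_Abelian_group:
  assumes "x \<in> S" "y \<in> S" "z \<in> S"
  shows "frag_of x - frag_of y - frag_of z \<in> carrier (free_Abelian_group S)"
proof -
  have "Poly_Mapping.keys (frag_of x - frag_of y - frag_of z) \<subseteq> {x} \<union> {y} \<union> {z}"
    using keys_diff[of "frag_of x - frag_of y" "frag_of z"] keys_diff[of "frag_of x" "frag_of y"]
    by auto
  then show ?thesis using assms by auto
qed

lemma additivity_relations_subset: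
  "{frag_of B - frag_of X - frag_of Y | X Y B. X \<in> S \<and> Y \<in> S \<and> B \<in> S \<and> P X Y B}
    \<subseteq> carrier (free_Abelian_group S)"
  by (clarify, rule additivity_relation_in_free_Abelian_group)

lemma exact_generators_subset:
  "{frag_of M - frag_of L - frag_of N | L M N.
        L \<in> lfd K C T \<and> M \<in> lfd K C T \<and> N \<in> lfd K C T \<and> short_exact K C T L M N}
      \<subseteq> carrier (free_Abelian_group (lfd K C T))"
  by (clarify, rule additivity_relation_in_free_Abelian_group)

lemma split_generators_subset: "split_generators C T \<subseteq> carrier (free_Abelian_group T)"
  unfolding split_generators_def by (rule additivity_relations_subset)

lemma split_relations_normal: "split_relations C T \<lhd> free_Abelian_group T"
  unfolding split_relations_generate
  by (intro comm_group.subgroup_imp_normal[OF abelian_free_Abelian_group]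
      group.generate_is_subgroup[OF group_free_Abelian_group] split_generators_subset)

lemma exact_relations_normal: "exact_relations K C T \<lhd> free_Abelian_group (lfd K C T)"
  unfolding exact_relations_def
  by (intro comm_group.subgroup_imp_normal[OF abelian_free_Abelian_group]
      group.generate_is_subgroup[OF group_free_Abelian_group] exact_generators_subset)

lemma pair_formal_exact_relations:
  assumes r: "r \<in> exact_relations K C T" and b: "Poly_Mapping.keys b \<subseteq> T"
  shows "pair_formal K r b = 0"
  using r unfolding exact_relations_def
proof (rule generate_free_Abelian_group_zero)
  show "{frag_of M - frag_of L - frag_of N | L M N.
        L \<in> lfd K C T \<and> M \<in> lfd K C T \<and> N \<in> lfd K C T \<and> short_exact K C T L M N}
      \<subseteq> carrier (free_Abelian_group (lfd K C T))" by (rule exact_generators_subset)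
  fix s assume "s \<in> {frag_of M - frag_of L - frag_of N | L M N.
        L \<in> lfd K C T \<and> M \<in> lfd K C T \<and> N \<in> lfd K C T \<and> short_exact K C T L M N}"
  then obtain L M N where s: "s = frag_of M - frag_of L - frag_of N"
    and lfd: "L \<in> lfd K C T" "M \<in> lfd K C T" "N \<in> lfd K C T" and se: "short_exact K C T L M N"
    by (elim CollectE exE conjE) (rule that)
  obtain f g where f: "f \<in> tmod_hom K C T L M" and g: "g \<in> tmod_hom K C T M N"
    and ex: "\<And>X. X \<in> T \<Longrightarrow> inj_on (f X) (carrier (Mob L X)) \<and>
     f X ` carrier (Mob L X) = {v \<in> carrier (Mob M X). g X v = \<zero>\<^bsub>Mob N X\<^esub>} \<and>
     g X ` carrier (Mob M X) = carrier (Mob N X)"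
    using se unfolding short_exact_def by (elim bexE) (rule that, assumption, assumption, erule bspec)
  have dim: "vectorspace.dim K (Mob M X) = vectorspace.dim K (Mob L X) + vectorspace.dim K (Mob N X)"
    if X: "X \<in> T" for X
    by (rule dim_short_exact[of K "Mob L X" "Mob M X" "Mob N X" "f X" "g X"])
      (use lfd f g ex[OF X] X in \<open>simp_all add: lfd_def is_tmod_def tmod_hom_def\<close>)
  from b show "pair_formal K s b = 0"
    by (rule free_Abelian_group_induct) (simp_all add: s pair_formal_diff_left pair_formal_diff_right dim)
qed (rule pair_formal_add_left)

lemma (in linear_category) pair_formal_split_relations:
  assumes r: "r \<in> split_relations C T" and T: "T \<subseteq> ob C" and a: "Poly_Mapping.keys a \<subseteq> lfd K C T"
  shows "pair_formal K a r = 0"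
  using r unfolding split_relations_generate
proof (rule generate_free_Abelian_group_zero[OF _ split_generators_subset])
  fix s assume "s \<in> split_generators C T"
  then obtain X Y B i j p q where s: "s = frag_of B - frag_of X - frag_of Y"
    and XY: "X \<in> T" "Y \<in> T" "B \<in> T" and B: "is_biprod C X Y B i j p q"
    unfolding split_generators_def by (elim CollectE exE conjE) (rule that)
  from a show "pair_formal K a s = 0"
    by (rule free_Abelian_group_induct)
      (simp_all add: s pair_formal_diff_left pair_formal_diff_right tmod_biprod_dim[OF _ T XY B])
qed (rule pair_formal_add_right)

lemma r_coset_free_Abelian_group: "H #>\<^bsub>free_Abelian_group S\<^esub> a = (\<lambda>h. h + a) ` H"
  by (auto simp: r_coset_def)

lemma (in normal) r_coset_nonempty: "H #> a \<noteq> {}"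
  unfolding r_coset_def using subgroup.one_closed[OF subgroup_axioms] by blast

lemma (in linear_category) pair_K0_cosets:
  assumes T: "T \<subseteq> ob C" and a: "Poly_Mapping.keys a \<subseteq> lfd K C T" and b: "Poly_Mapping.keys b \<subseteq> T"
  shows "pair_K0 K (exact_relations K C T #>\<^bsub>free_Abelian_group (lfd K C T)\<^esub> a)
    (split_relations C T #>\<^bsub>free_Abelian_group T\<^esub> b) = pair_formal K a b"
proof -
  interpret E: normal "exact_relations K C T" "free_Abelian_group (lfd K C T)"
    by (rule exact_relations_normal)
  interpret S: normal "split_relations C T" "free_Abelian_group T"
    by (rule split_relations_normal)
  define x where "x = (SOME x. x \<in> exact_relations K C T #>\<^bsub>free_Abelian_group (lfd K C T)\<^esub> a)"
  define y where "y = (SOME y. y \<in> split_relations C T #>\<^bsub>free_Abelian_group T\<^esub> b)"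
  have "x \<in> exact_relations K C T #>\<^bsub>free_Abelian_group (lfd K C T)\<^esub> a"
    unfolding x_def using E.r_coset_nonempty by (rule some_in_eq[THEN iffD2])
  then obtain r where r: "r \<in> exact_relations K C T" "x = r + a"
    by (auto simp: r_coset_free_Abelian_group)
  have "y \<in> split_relations C T #>\<^bsub>free_Abelian_group T\<^esub> b"
    unfolding y_def using S.r_coset_nonempty by (rule some_in_eq[THEN iffD2])
  then obtain s where s: "s \<in> split_relations C T" "y = s + b"
    by (auto simp: r_coset_free_Abelian_group)
  have "Poly_Mapping.keys y \<subseteq> T"
    unfolding s(2) using S.subset s(1) b
    by (intro order.trans[OF keys_add] Un_least) (auto simp flip: carrier_free_Abelian_group_iff)
  then have "pair_formal K x y = pair_formal K a y"
    using pair_formal_exact_relations[OF r(1)] by (simp add: r(2) pair_formal_add_left)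
  also have "\<dots> = pair_formal K a b"
    using pair_formal_split_relations[OF s(1) T a] by (simp add: s(2) pair_formal_add_right)
  finally show ?thesis by (simp add: pair_K0_def x_def y_def)
qed

text \<open>A representative of the numerical class of \<open>M\<close> differs from \<open>[M]\<close> by exact relations, which pair to
  zero since dimensions add up along exact sequences, and by a numerically trivial class, which
  pairs to zero by definition.\<close>

lemma (in linear_category) pairing_num_class:
  assumes T: "T \<subseteq> ob C" and M: "M \<in> lfd K C T" and b: "Poly_Mapping.keys b \<subseteq> T"
  shows "pairing K (num_class K C T M) (split_relations C T #>\<^bsub>free_Abelian_group T\<^esub> b) =
    pair_formal K (frag_of M) b"
proof -
  let ?F = "free_Abelian_group (lfd K C T)" and ?E = "exact_relations K C T"
  let ?\<beta> = "split_relations C T #>\<^bsub>free_Abelian_group T\<^esub> b"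
  interpret E: normal ?E ?F by (rule exact_relations_normal)
  define \<alpha> where "\<alpha> = (SOME \<alpha>. \<alpha> \<in> num_class K C T M)"
  have "?E #>\<^bsub>?F\<^esub> 0 \<in> carrier (K0_lfd K C T)"
    unfolding K0_lfd_def carrier_FactGroup by (rule imageI) simp
  moreover have "pair_K0 K (?E #>\<^bsub>?F\<^esub> 0) \<beta> = 0" if "\<beta> \<in> carrier (K0 C T)" for \<beta>
    using that pair_K0_cosets[OF T, of 0] by (auto simp: K0_def carrier_FactGroup)
  ultimately have "?E #>\<^bsub>?F\<^esub> 0 \<in> numerically_trivial K C T"
    unfolding numerically_trivial_def by blast
  then have "num_class K C T M \<noteq> {}" unfolding num_class_def r_coset_def by blast
  then have "\<alpha> \<in> num_class K C T M" unfolding \<alpha>_def by (rule some_in_eq[THEN iffD2])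
  then obtain \<tau> where \<tau>: "\<tau> \<in> numerically_trivial K C T"
      and \<alpha>: "\<alpha> = \<tau> \<otimes>\<^bsub>K0_lfd K C T\<^esub> (?E #>\<^bsub>?F\<^esub> frag_of M)"
    unfolding num_class_def r_coset_def[of "K0_lfd K C T"] by blast
  then obtain t where t: "Poly_Mapping.keys t \<subseteq> lfd K C T" "\<tau> = ?E #>\<^bsub>?F\<^esub> t"
    by (auto simp: numerically_trivial_def K0_lfd_def carrier_FactGroup)
  have \<beta>: "?\<beta> \<in> carrier (K0 C T)" using b by (auto simp: K0_def carrier_FactGroup)
  have tb: "pair_formal K t b = 0"
    using \<tau> \<beta> pair_K0_cosets[OF T t(1) b] by (auto simp: numerically_trivial_def t(2))
  have tM: "Poly_Mapping.keys (t + frag_of M) \<subseteq> lfd K C T"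
    using keys_add[of t "frag_of M"] t(1) M by auto
  have "\<alpha> = ?E #>\<^bsub>?F\<^esub> (t + frag_of M)"
    using E.rcos_sum[of t "frag_of M"] t(1) M by (simp add: \<alpha> t(2) K0_lfd_def)
  then have "pairing K (num_class K C T M) ?\<beta> = pair_formal K (t + frag_of M) b"
    using pair_K0_cosets[OF T tM b] by (simp add: pairing_def flip: \<alpha>_def)
  then show ?thesis by (simp add: pair_formal_add_left tb)
qed

lemma K0_coset_eqI:
  assumes "Poly_Mapping.keys a \<subseteq> T" "Poly_Mapping.keys b \<subseteq> T" "b - a \<in> split_relations C T"
  shows "split_relations C T #>\<^bsub>free_Abelian_group T\<^esub> a = split_relations C T #>\<^bsub>free_Abelian_group T\<^esub> b"
proof -
  interpret S: normal "split_relations C T" "free_Abelian_group T" by (rule split_relations_normal)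
  show ?thesis
  proof (rule S.repr_independence)
    show "b \<in> split_relations C T #>\<^bsub>free_Abelian_group T\<^esub> a"
      unfolding r_coset_free_Abelian_group using assms(3) by (rule rev_image_eqI) simp
  qed (use assms S.subgroup_axioms in simp_all)
qed

lemma K0_class_diff:
  assumes "X \<in> T" "Y \<in> T"
  shows "K0_class C T X \<otimes>\<^bsub>K0 C T\<^esub> inv\<^bsub>K0 C T\<^esub> K0_class C T Y =
    split_relations C T #>\<^bsub>free_Abelian_group T\<^esub> (frag_of X - frag_of Y)"
proof -
  interpret S: normal "split_relations C T" "free_Abelian_group T" by (rule split_relations_normal)
  have "K0_class C T Y \<in> carrier (K0 C T)"
    using assms by (auto simp: K0_def K0_class_def carrier_FactGroup)
  then have "inv\<^bsub>K0 C T\<^esub> K0_class C T Y = split_relations C T #>\<^bsub>free_Abelian_group T\<^esub> (- frag_of Y)"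
    using S.inv_FactGroup[of "K0_class C T Y"] S.rcos_inv[of "frag_of Y"] assms
    by (simp add: K0_def K0_class_def)
  then show ?thesis
    using S.rcos_sum[of "frag_of X" "- frag_of Y"] assms by (simp add: K0_def K0_class_def)
qed

lemma K0_comm_group: "comm_group (K0 C T)"
  unfolding K0_def using split_relations_normal[of C T]
  by (intro comm_group.abelian_FactGroup[OF abelian_free_Abelian_group]) (simp add: normal_def)

text \<open>The universal property of the split Grothendieck group; it supplies the homomorphisms
  among which \<open>ind_map\<close> and \<open>coind_map\<close> choose.\<close>

lemma additive_function_extends_to_K0:
  assumes G: "comm_group G" and f: "\<And>X. X \<in> U \<Longrightarrow> f X \<in> carrier G"
    and add: "\<And>X Y B i j p q. \<lbrakk>X \<in> U; Y \<in> U; B \<in> U; is_biprod C X Y B i j p q\<rbrakk> \<Longrightarrow>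
      f B = f X \<otimes>\<^bsub>G\<^esub> f Y"
  shows "\<exists>h. h \<in> hom (K0 C U) G \<and> (\<forall>X\<in>U. h (K0_class C U X) = f X)"
proof -
  let ?F = "free_Abelian_group U"
  interpret G: comm_group G by (rule G)
  interpret S: normal "split_relations C U" ?F by (rule split_relations_normal)
  obtain h where h: "h \<in> hom ?F G" "\<And>X. X \<in> U \<Longrightarrow> h (frag_of X) = f X"
    using G.free_Abelian_group_universal[of f U] f by blast
  interpret H: group_hom ?F G h
    using h(1) by (simp add: group_hom_def group_hom_axioms_def G.is_group)
  have hdiff: "h (x - y) = h x \<otimes>\<^bsub>G\<^esub> inv\<^bsub>G\<^esub> h y"
    if "x \<in> carrier ?F" "y \<in> carrier ?F" for x y
    using H.hom_mult[of x "- y"] H.hom_inv[of y] that by simp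
  have "split_generators C U \<subseteq> kernel ?F G h"
  proof
    fix s assume s: "s \<in> split_generators C U"
    then obtain X Y B i j p q where s': "s = frag_of B - frag_of X - frag_of Y"
      and XY: "X \<in> U" "Y \<in> U" "B \<in> U" and B: "is_biprod C X Y B i j p q"
      unfolding split_generators_def by (elim CollectE exE conjE) (rule that)
    have c: "frag_of B - frag_of X \<in> carrier ?F" "frag_of X \<in> carrier ?F"
        "frag_of B \<in> carrier ?F" "frag_of Y \<in> carrier ?F"
      using XY keys_diff[of "frag_of B" "frag_of X"] by auto
    have "h s = f X \<otimes>\<^bsub>G\<^esub> f Y \<otimes>\<^bsub>G\<^esub> inv\<^bsub>G\<^esub> f X \<otimes>\<^bsub>G\<^esub> inv\<^bsub>G\<^esub> f Y"
      unfolding s' hdiff[OF c(1,4)] hdiff[OF c(3,2)] using h(2) XY add[OF XY B] by simp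
    also have "\<dots> = \<one>\<^bsub>G\<^esub>"
    proof -
      have "f X \<otimes>\<^bsub>G\<^esub> f Y \<otimes>\<^bsub>G\<^esub> inv\<^bsub>G\<^esub> f X = f Y"
        using f[OF XY(1)] f[OF XY(2)] G.m_comm[of "f X" "f Y"] by (simp add: G.m_assoc)
      then show ?thesis using f[OF XY(2)] by simp
    qed
    finally show "s \<in> kernel ?F G h"
      using s split_generators_subset[of C U] unfolding kernel_def by blast
  qed
  then have ker: "split_relations C U \<subseteq> kernel ?F G h"
    unfolding split_relations_generate
    by (intro group.generate_subgroup_incl[OF group_free_Abelian_group] H.subgroup_kernel)
  obtain g where g: "g \<in> hom (?F Mod split_relations C U) G"
      "\<And>x. x \<in> carrier ?F \<Longrightarrow> g (split_relations C U #>\<^bsub>?F\<^esub> x) = h x"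
  proof (rule FactGroup_universal[OF h(1) S.normal_axioms])
    fix x y assume xy: "x \<in> carrier ?F" "y \<in> carrier ?F"
      and eq: "split_relations C U #>\<^bsub>?F\<^esub> x = split_relations C U #>\<^bsub>?F\<^esub> y"
    have "x \<in> split_relations C U #>\<^bsub>?F\<^esub> y"
      using S.rcos_self[OF xy(1) S.subgroup_axioms] unfolding eq .
    then obtain r where "r \<in> split_relations C U" "x = r + y"
      by (auto simp: r_coset_free_Abelian_group)
    then show "h x = h y"
      using ker xy H.hom_mult[of r y] by (auto simp: kernel_def)
  qed blast
  then show ?thesis
    using h(2) by (intro exI[of _ g]) (auto simp: K0_def K0_class_def)
qed

section \<open>Index and coindex\<close>

context extriangulated_category
begin

lemma split_relations_diff:
  assumes "x \<in> split_relations C T" "y \<in> split_relations C T"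
  shows "x - y \<in> split_relations C T"
proof -
  interpret S: normal "split_relations C T" "free_Abelian_group T" by (rule split_relations_normal)
  have "y \<in> carrier (free_Abelian_group T)" using S.subset assms(2) by blast
  then show ?thesis using subgroup.m_closed[OF S.subgroup_axioms assms(1)
      subgroup.m_inv_closed[OF S.subgroup_axioms assms(2)]] by simp
qed

lemma biprod_relation:
  assumes "cluster_tilting C T" "X \<in> T" "Y \<in> T" "is_biprod C X Y B i j p q"
  shows "frag_of B - frag_of X - frag_of Y \<in> split_relations C T"
proof -
  have "B \<in> T" using cluster_tilting_biprod assms by blast
  then have "frag_of B - frag_of X - frag_of Y \<in> split_generators C T"
    unfolding split_generators_def using assms by blast
  then show ?thesis unfolding split_relations_generate by (rule generate.incl)
qed

lemma keys_frag_diff: "\<lbrakk>X \<in> T; Y \<in> T\<rbrakk> \<Longrightarrow> Poly_Mapping.keys (frag_of X - frag_of Y) \<subseteq> T"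
  by (rule order.trans[OF keys_diff]) simp

lemma difference_classes_agree:
  assumes T: "cluster_tilting C T" "N \<in> T" "R \<in> T" "N' \<in> T" "R' \<in> T"
    and B: "is_biprod C R N' M i j p q" and B': "is_biprod C N R' M i' j' p' q'"
  shows "split_relations C T #>\<^bsub>free_Abelian_group T\<^esub> (frag_of R - frag_of N) =
    split_relations C T #>\<^bsub>free_Abelian_group T\<^esub> (frag_of R' - frag_of N')"
proof (rule K0_coset_eqI[OF keys_frag_diff keys_frag_diff])
  show "(frag_of R' - frag_of N') - (frag_of R - frag_of N) \<in> split_relations C T"
    using split_relations_diff[OF biprod_relation[OF T(1,3,4) B] biprod_relation[OF T(1,2,5) B']]
    by (simp add: algebra_simps)
qed (use T in auto)

lemma ind_eq:
  assumes T: "cluster_tilting C T" "N \<in> T" "R \<in> T" and S: "extriangle N R X k y \<delta>"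
  shows "ind C T X = split_relations C T #>\<^bsub>free_Abelian_group T\<^esub> (frag_of R - frag_of N)"
  unfolding ind_def
proof (rule the_equality)
  have "conflation C N R X k y" using S unfolding conflation_extriangle by (rule exI)
  then show "\<exists>N'\<in>T. \<exists>R'\<in>T. \<exists>x y. conflation C N' R' X x y \<and>
      split_relations C T #>\<^bsub>free_Abelian_group T\<^esub> (frag_of R - frag_of N) =
      K0_class C T R' \<otimes>\<^bsub>K0 C T\<^esub> inv\<^bsub>K0 C T\<^esub> K0_class C T N'"
    using T K0_class_diff[OF T(3,2)] by metis
next
  fix \<gamma> assume "\<exists>N'\<in>T. \<exists>R'\<in>T. \<exists>x y. conflation C N' R' X x y \<and>
      \<gamma> = K0_class C T R' \<otimes>\<^bsub>K0 C T\<^esub> inv\<^bsub>K0 C T\<^esub> K0_class C T N'"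
  then obtain N' R' k' y' \<delta>' where T': "N' \<in> T" "R' \<in> T" and S': "extriangle N' R' X k' y' \<delta>'"
    and \<gamma>: "\<gamma> = split_relations C T #>\<^bsub>free_Abelian_group T\<^esub> (frag_of R' - frag_of N')"
    using K0_class_diff[of _ T] unfolding conflation_extriangle by metis
  obtain M i j p q where B: "is_biprod C R N' M i j p q"
    using ex_biprod T T' cluster_tilting_subset[OF T(1)] by blast
  obtain i' j' p' q' where B': "is_biprod C N R' M i' j' p' q'"
    using kernels_of_deflations_biprod[OF S S' cluster_tilting_rigid[OF T(1,3) T'(1)]
        cluster_tilting_rigid[OF T(1) T'(2) T(2)] B] by blast
  show "\<gamma> = split_relations C T #>\<^bsub>free_Abelian_group T\<^esub> (frag_of R - frag_of N)"
    unfolding \<gamma> using difference_classes_agree[OF T T' B B'] by simp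
qed

lemma coind_eq:
  assumes T: "cluster_tilting C T" "L \<in> T" "N \<in> T" and S: "extriangle X L N x m \<delta>"
  shows "coind C T X = split_relations C T #>\<^bsub>free_Abelian_group T\<^esub> (frag_of L - frag_of N)"
  unfolding coind_def
proof (rule the_equality)
  have "conflation C X L N x m" using S unfolding conflation_extriangle by (rule exI)
  then show "\<exists>L'\<in>T. \<exists>N'\<in>T. \<exists>x y. conflation C X L' N' x y \<and>
      split_relations C T #>\<^bsub>free_Abelian_group T\<^esub> (frag_of L - frag_of N) =
      K0_class C T L' \<otimes>\<^bsub>K0 C T\<^esub> inv\<^bsub>K0 C T\<^esub> K0_class C T N'"
    using T K0_class_diff[OF T(2,3)] by metis
next
  fix \<gamma> assume "\<exists>L'\<in>T. \<exists>N'\<in>T. \<exists>x y. conflation C X L' N' x y \<and>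
      \<gamma> = K0_class C T L' \<otimes>\<^bsub>K0 C T\<^esub> inv\<^bsub>K0 C T\<^esub> K0_class C T N'"
  then obtain L' N' x' m' \<delta>' where T': "L' \<in> T" "N' \<in> T" and S': "extriangle X L' N' x' m' \<delta>'"
    and \<gamma>: "\<gamma> = split_relations C T #>\<^bsub>free_Abelian_group T\<^esub> (frag_of L' - frag_of N')"
    using K0_class_diff[of _ T] unfolding conflation_extriangle by metis
  obtain M i j p q where B: "is_biprod C N' L M i j p q"
    using ex_biprod T T' cluster_tilting_subset[OF T(1)] by blast
  obtain i' j' p' q' where B': "is_biprod C L' N M i' j' p' q'"
    using cokernels_of_inflations_biprod[OF S' S cluster_tilting_rigid[OF T(1) T'(2) T(2)]
        cluster_tilting_rigid[OF T(1,3) T'(1)] B] by blast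
  have "(frag_of L - frag_of N) - (frag_of L' - frag_of N') \<in> split_relations C T"
    using split_relations_diff[OF biprod_relation[OF T(1) T'(1) T(3) B'] biprod_relation[OF T(1) T'(2) T(2) B]]
      split_relations_diff by (simp add: algebra_simps)
  then show "\<gamma> = split_relations C T #>\<^bsub>free_Abelian_group T\<^esub> (frag_of L - frag_of N)"
    unfolding \<gamma> using T T' by (intro K0_coset_eqI keys_frag_diff)
qed

lemma difference_class_biprod:
  assumes T: "cluster_tilting C T" "N \<in> T" "R \<in> T" "N' \<in> T" "R' \<in> T"
    and B: "is_biprod C R R' M i j p q" and B': "is_biprod C N N' M' i' j' p' q'"
  shows "split_relations C T #>\<^bsub>free_Abelian_group T\<^esub> (frag_of M - frag_of M') =
    (split_relations C T #>\<^bsub>free_Abelian_group T\<^esub> (frag_of R - frag_of N)) \<otimes>\<^bsub>K0 C T\<^esub>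
    (split_relations C T #>\<^bsub>free_Abelian_group T\<^esub> (frag_of R' - frag_of N'))"
proof -
  interpret S: normal "split_relations C T" "free_Abelian_group T" by (rule split_relations_normal)
  have M: "M \<in> T" "M' \<in> T" using cluster_tilting_biprod T B B' by blast+
  note keys_frag_diff[OF T(3,2)] keys_frag_diff[OF T(5,4)]
  moreover have "split_relations C T #>\<^bsub>free_Abelian_group T\<^esub> ((frag_of R - frag_of N) + (frag_of R' - frag_of N'))
      = split_relations C T #>\<^bsub>free_Abelian_group T\<^esub> (frag_of M - frag_of M')"
  proof (rule K0_coset_eqI)
    show "frag_of M - frag_of M' - (frag_of R - frag_of N + (frag_of R' - frag_of N')) \<in> split_relations C T"
      using split_relations_diff[OF biprod_relation[OF T(1,3,5) B] biprod_relation[OF T(1,2,4) B']]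
      by (simp add: algebra_simps)
    show "Poly_Mapping.keys (frag_of R - frag_of N + (frag_of R' - frag_of N')) \<subseteq> T"
      using T by (intro order.trans[OF keys_add] Un_least keys_frag_diff)
  qed (rule keys_frag_diff[OF M])
  ultimately show ?thesis
    using S.rcos_sum[of "frag_of R - frag_of N" "frag_of R' - frag_of N'"] by (simp add: K0_def)
qed

lemma ind_biprod:
  assumes T: "cluster_tilting C T" and X: "is_biprod C X Y B i j p q"
  shows "ind C T B = ind C T X \<otimes>\<^bsub>K0 C T\<^esub> ind C T Y"
proof -
  have ob: "X \<in> ob C" "Y \<in> ob C" using X by (simp_all add: is_biprod_def)
  obtain N R k y \<delta> where S: "N \<in> T" "R \<in> T" "extriangle N R X k y \<delta>" by (rule ex_presentation[OF T ob(1)])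
  obtain N' R' k' y' \<delta>' where S': "N' \<in> T" "R' \<in> T" "extriangle N' R' Y k' y' \<delta>'"
    by (rule ex_presentation[OF T ob(2)])
  obtain BN iN jN pN qN where BN: "is_biprod C N N' BN iN jN pN qN"
    using ex_biprod extriangle_typed(1)[OF S(3)] extriangle_typed(1)[OF S'(3)] by blast
  obtain BR iR jR pR qR where BR: "is_biprod C R R' BR iR jR pR qR"
    using ex_biprod extriangle_typed(2)[OF S(3)] extriangle_typed(2)[OF S'(3)] by blast
  obtain k'' y'' \<delta>'' where "extriangle BN BR B k'' y'' \<delta>''"
    using extriangle_biprod[OF S(3) S'(3) BN BR X] by blast
  moreover have "BN \<in> T" "BR \<in> T" using cluster_tilting_biprod T S S' BN BR by blast+
  ultimately show ?thesis
    using ind_eq[OF T] S S' difference_class_biprod[OF T S(1,2) S'(1,2) BR BN] by simp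
qed

lemma coind_biprod:
  assumes T: "cluster_tilting C T" and X: "is_biprod C X Y B i j p q"
  shows "coind C T B = coind C T X \<otimes>\<^bsub>K0 C T\<^esub> coind C T Y"
proof -
  have ob: "X \<in> ob C" "Y \<in> ob C" using X by (simp_all add: is_biprod_def)
  obtain L N x m \<delta> where S: "L \<in> T" "N \<in> T" "extriangle X L N x m \<delta>" by (rule ex_copresentation[OF T ob(1)])
  obtain L' N' x' m' \<delta>' where S': "L' \<in> T" "N' \<in> T" "extriangle Y L' N' x' m' \<delta>'"
    by (rule ex_copresentation[OF T ob(2)])
  obtain BN iN jN pN qN where BN: "is_biprod C N N' BN iN jN pN qN"
    using ex_biprod extriangle_typed(3)[OF S(3)] extriangle_typed(3)[OF S'(3)] by blast
  obtain BL iL jL pL qL where BL: "is_biprod C L L' BL iL jL pL qL"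
    using ex_biprod extriangle_typed(2)[OF S(3)] extriangle_typed(2)[OF S'(3)] by blast
  obtain k'' y'' \<delta>'' where "extriangle B BL BN k'' y'' \<delta>''"
    using extriangle_biprod[OF S(3) S'(3) X BL BN] by blast
  moreover have "BN \<in> T" "BL \<in> T" using cluster_tilting_biprod T S S' BN BL by blast+
  ultimately show ?thesis
    using coind_eq[OF T] S S' difference_class_biprod[OF T S(2,1) S'(2,1) BL BN] by simp
qed

lemma difference_class_carrier:
  "\<lbrakk>X \<in> T; Y \<in> T\<rbrakk> \<Longrightarrow>
    split_relations C T #>\<^bsub>free_Abelian_group T\<^esub> (frag_of X - frag_of Y) \<in> carrier (K0 C T)"
  unfolding K0_def carrier_FactGroup by (rule imageI) (simp add: keys_frag_diff)

lemma ind_map_K0_class: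
  assumes T: "cluster_tilting C T" and U: "U \<subseteq> ob C" "X \<in> U"
  shows "ind_map C T U (K0_class C U X) = ind C T X"
proof -
  have car: "ind C T Y \<in> carrier (K0 C T)" if Y: "Y \<in> U" for Y
  proof -
    obtain N R k y \<delta> where S: "N \<in> T" "R \<in> T" "extriangle N R Y k y \<delta>" by (rule ex_presentation[OF T subsetD[OF U(1) Y]])
    show ?thesis using ind_eq[OF T S] difference_class_carrier[OF S(2,1)] by simp
  qed
  have "\<exists>h. h \<in> hom (K0 C U) (K0 C T) \<and> (\<forall>X\<in>U. h (K0_class C U X) = ind C T X)"
    by (rule additive_function_extends_to_K0[OF K0_comm_group car ind_biprod[OF T]])
  from someI_ex[OF this] show ?thesis using U(2) unfolding ind_map_def by blast
qed

lemma coind_map_K0_class: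
  assumes T: "cluster_tilting C T" and U: "U \<subseteq> ob C" "X \<in> U"
  shows "coind_map C T U (K0_class C U X) = coind C T X"
proof -
  have car: "coind C T Y \<in> carrier (K0 C T)" if Y: "Y \<in> U" for Y
  proof -
    obtain L N x m \<delta> where S: "L \<in> T" "N \<in> T" "extriangle Y L N x m \<delta>" by (rule ex_copresentation[OF T subsetD[OF U(1) Y]])
    show ?thesis using coind_eq[OF T S] difference_class_carrier[OF S(1,2)] by simp
  qed
  have "\<exists>h. h \<in> hom (K0 C U) (K0 C T) \<and> (\<forall>X\<in>U. h (K0_class C U X) = coind C T X)"
    by (rule additive_function_extends_to_K0[OF K0_comm_group car coind_biprod[OF T]])
  from someI_ex[OF this] show ?thesis using U(2) unfolding coind_map_def by blast
qed

end

section \<open>Sign-coherence\<close>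

context extriangulated_category
begin

lemma pairing_difference_class:
  assumes "T \<subseteq> ob C" "M \<in> lfd K C T" "X \<in> T" "Y \<in> T"
  shows "pairing K (num_class K C T M)
      (split_relations C T #>\<^bsub>free_Abelian_group T\<^esub> (frag_of X - frag_of Y)) =
    int (vectorspace.dim K (Mob M X)) - int (vectorspace.dim K (Mob M Y))"
  by (simp add: pairing_num_class[OF assms(1,2) keys_frag_diff[OF assms(3,4)]] pair_formal_diff_right)

text \<open>The indices of \<open>U\<close> and \<open>V\<close> cannot have strictly opposite signs in this order; exchanging the
  two objects excludes the other order.\<close>

lemma ind_sign_coherent:
  assumes T: "cluster_tilting C T" and M: "is_simple_tmod K C T M" "M \<in> lfd K C T"
    and UV: "U \<in> ob C" "V \<in> ob C" "Ext_vanishes C V U"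
  shows "pairing K (num_class K C T M) (ind C T U) \<le> 0 \<or> 0 \<le> pairing K (num_class K C T M) (ind C T V)"
proof -
  obtain N R k y \<delta> where S: "N \<in> T" "R \<in> T" "extriangle N R U k y \<delta>" by (rule ex_presentation[OF T UV(1)])
  obtain N' R' k' y' \<delta>' where S': "N' \<in> T" "R' \<in> T" "extriangle N' R' V k' y' \<delta>'"
    by (rule ex_presentation[OF T UV(2)])
  note sub = cluster_tilting_subset[OF T]
  have "vectorspace.dim K (Mob M R) \<le> vectorspace.dim K (Mob M N) \<or>
      vectorspace.dim K (Mob M N') \<le> vectorspace.dim K (Mob M R')"
    by (rule simple_tmod_opposite_dims[OF M sub S(1,2) S'(1,2) extriangle_typed(4)[OF S(3)]
          extriangle_typed(4)[OF S'(3)]])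
      (rule rigid_presentation_factor[OF S(3) S'(3) UV(3) cluster_tilting_rigid[OF T S'(2) S(1)]])
  then show ?thesis
    using pairing_difference_class[OF sub M(2) S(2,1)] pairing_difference_class[OF sub M(2) S'(2,1)]
    by (simp add: ind_eq[OF T S] ind_eq[OF T S'])
qed

text \<open>As the complex \<open>L \<rightarrow> N\<close> enters the coindex with the opposite sign, \<open>U\<close> and \<open>V\<close> exchange their roles:
  the restriction \<open>S(N') \<rightarrow> S(L')\<close> would have a kernel and \<open>S(N) \<rightarrow> S(L)\<close> would not be onto.\<close>

lemma coind_sign_coherent:
  assumes T: "cluster_tilting C T" and M: "is_simple_tmod K C T M" "M \<in> lfd K C T"
    and UV: "U \<in> ob C" "V \<in> ob C" "Ext_vanishes C U V"
  shows "pairing K (num_class K C T M) (coind C T U) \<le> 0 \<or> 0 \<le> pairing K (num_class K C T M) (coind C T V)"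
proof -
  obtain L N x m \<delta> where S: "L \<in> T" "N \<in> T" "extriangle U L N x m \<delta>" by (rule ex_copresentation[OF T UV(1)])
  obtain L' N' x' m' \<delta>' where S': "L' \<in> T" "N' \<in> T" "extriangle V L' N' x' m' \<delta>'"
    by (rule ex_copresentation[OF T UV(2)])
  note sub = cluster_tilting_subset[OF T]
  have "vectorspace.dim K (Mob M N') \<le> vectorspace.dim K (Mob M L') \<or>
      vectorspace.dim K (Mob M L) \<le> vectorspace.dim K (Mob M N)"
  proof (rule simple_tmod_opposite_dims[OF M sub S'(1,2) S(1,2) extriangle_typed(5)[OF S'(3)]
          extriangle_typed(5)[OF S(3)]])
    fix a assume a: "a \<in> mor C L N'"
    obtain h l where h: "h \<in> mor C L L'" "l \<in> mor C N N'"
        "a = cmp C L L' N' m' h \<oplus>\<^bsub>Hom C L N'\<^esub> cmp C L N N' l m"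
      using rigid_copresentation_factor[OF S(3) S'(3) UV(3) cluster_tilting_rigid[OF T S(2) S'(1)] a] by blast
    note t = extriangle_typed[OF S(3)] extriangle_typed[OF S'(3)]
    interpret H: abelian_group "Hom C L N'" using Hom_abelian t by blast
    have "a = cmp C L N N' l m \<oplus>\<^bsub>Hom C L N'\<^esub> cmp C L L' N' m' h"
      unfolding h(3) using t h(1,2) by (intro H.a_comm) simp_all
    then show "\<exists>l\<in>mor C N N'. \<exists>h\<in>mor C L L'.
        a = cmp C L N N' l m \<oplus>\<^bsub>Hom C L N'\<^esub> cmp C L L' N' m' h"
      using h(1,2) by blast
  qed
  then show ?thesis
    using pairing_difference_class[OF sub M(2) S(1,2)] pairing_difference_class[OF sub M(2) S'(1,2)]
    by (auto simp: coind_eq[OF T S] coind_eq[OF T S'])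
qed

end

theorem proposition3p52:
  fixes K :: "'k ring"
    and C :: "('o, 'm, 'e, 'k) extricat"
    and E :: "('p, 'n, 'f, 'k) extricat" and P :: "'p set"
    and Fo :: "'p \<Rightarrow> 'o" and Fm :: "'p \<Rightarrow> 'p \<Rightarrow> 'n set \<Rightarrow> 'm" and Fe :: "'p \<Rightarrow> 'p \<Rightarrow> 'f \<Rightarrow> 'e"
    and \<T> \<U> indec\<T> indec\<U> :: "'o set" and T :: 'o
  assumes "cluster_category K C E P Fo Fm Fe"
    and "cluster_tilting C \<T>" and "cluster_tilting C \<U>"
    and "indec_reps C \<T> indec\<T>" and "indec_reps C \<U> indec\<U>"
    and "T \<in> indec\<T>"
    and "is_simple_tmod K C \<T> (simple_at C T)"
    and "simple_at C T \<in> lfd K C \<T>"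
  shows "sign_coherent_at K C \<T> T (g_plus C \<T> \<U> indec\<U>) \<and>
         sign_coherent_at K C \<T> T (g_minus C \<T> \<U> indec\<U>)"
proof -
  interpret extriangulated_category K C using assms(1) by (simp add: cluster_category_def)
  have sub: "\<U> \<subseteq> ob C" by (rule cluster_tilting_subset[OF assms(3)])
  have indec: "X \<in> \<U>" if "X \<in> indec\<U>" for X
    using assms(5) that unfolding indec_reps_def indecomposable_in_def by blast
  have plus: "x \<in> ind C \<T> ` \<U>" if "x \<in> g_plus C \<T> \<U> indec\<U>" for x
    using that indec ind_map_K0_class[OF assms(2) sub] unfolding g_plus_def by blast
  have minus: "x \<in> coind C \<T> ` \<U>" if "x \<in> g_minus C \<T> \<U> indec\<U>" for x
    using that indec coind_map_K0_class[OF assms(2) sub] unfolding g_minus_def by blast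
  let ?s = "pairing K (num_class K C \<T> (simple_at C T))"
  have 1: "?s x \<le> 0 \<or> 0 \<le> ?s y" if "x \<in> g_plus C \<T> \<U> indec\<U>" "y \<in> g_plus C \<T> \<U> indec\<U>" for x y
    using plus[OF that(1)] plus[OF that(2)] sub cluster_tilting_rigid[OF assms(3)]
      ind_sign_coherent[OF assms(2,7,8)] by blast
  have 2: "?s x \<le> 0 \<or> 0 \<le> ?s y" if "x \<in> g_minus C \<T> \<U> indec\<U>" "y \<in> g_minus C \<T> \<U> indec\<U>" for x y
    using minus[OF that(1)] minus[OF that(2)] sub cluster_tilting_rigid[OF assms(3)]
      coind_sign_coherent[OF assms(2,7,8)] by blast
  show ?thesis
    unfolding sign_coherent_at_def Let_def
  proof (intro conjI ballI)
    fix x y assume "x \<in> g_plus C \<T> \<U> indec\<U>" "y \<in> g_plus C \<T> \<U> indec\<U>"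
    then show "(0 \<le> ?s x \<and> 0 \<le> ?s y) \<or> (?s x \<le> 0 \<and> ?s y \<le> 0)"
      using 1[of x y] 1[of y x] by linarith
  next
    fix x y assume "x \<in> g_minus C \<T> \<U> indec\<U>" "y \<in> g_minus C \<T> \<U> indec\<U>"
    then show "(0 \<le> ?s x \<and> 0 \<le> ?s y) \<or> (?s x \<le> 0 \<and> ?s y \<le> 0)"
      using 2[of x y] 2[of y x] by linarith
  qed
qed

end
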